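(* Let $k\ge1$, $\sigma_k=\min\{2k+1,k+3\}$, and let $u\in H^{\sigma_k+1}(\Omega)$ be periodic on the interval $\Omega$ with a uniform one-dimensional overlapping mesh of size $h$. For any $\boldsymbol\phi=(\phi_1,\phi_2)\in\overline V_x\times\overline W_x$ (piecewise constants on the primal, resp. dual, mesh) and any $l\in\{1,\dots,\min\{k,2\}\}$, the $l$-th correction function satisfies $$\Big|\sum_i\tilde B_{i+1/2}(\boldsymbol R^lu,\phi_2)\Big|\lesssim h^{\sigma_k}\|u\|_{H^{\sigma_k+1}}\|\phi_2\|,\qquad\Big|\sum_i\hat B_i(\boldsymbol R^lu,\phi_1)\Big|\lesssim h^{\sigma_k}\|u\|_{H^{\sigma_k+1}}\|\phi_1\|.$$
   Context: Convention: $A\lesssim B$ means $A\le MB$ with a constant $M>0$ independent of the mesh size $h$ (and here of $u$, $\boldsymbol\phi$). $\|\cdot\|$ is the $L^2(\Omega)$ norm. Mesh and spaces. All functions and Sobolev spaces are periodic on $\Omega$. Primal cells $I_i=[x_{i-1/2},x_{i+1/2}]$ of length $h$ with centres $x_i$; dual cells $I_{i+1/2}=[x_i,x_{i+1}]$. $V_h$ (resp. $W_h$): $L^2$ functions that are polynomials of degree $\le k$ on each $I_i$ (resp. $I_{i+1/2}$). $V_x^0\subset V_h$, $W_x^0\subset W_h$: functions with zero mean on every cell. $\overline V_x\subset V_h$, $\overline W_x\subset W_h$: functions constant on every cell. $(\cdot,\cdot)_i$, $(\cdot,\cdot)_{i+1/2}$: $L^2$ inner products on $I_i$, $I_{i+1/2}$.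 $\tau_{\max}=C_{\rm CFL}h$ with fixed $C_{\rm CFL}>0$. CDG operators, for $\boldsymbol w=(w_C,w_D)$: $$\hat B_i(\boldsymbol w,\phi_1)=\tfrac1{\tau_{\max}}\int_{I_i}(w_D-w_C)\phi_1dx+\int_{I_i}w_D\partial_x\phi_1dx-w_D(x_{i+1/2})\phi_1(x_{i+1/2}^-)+w_D(x_{i-1/2})\phi_1(x_{i-1/2}^+),$$ $$\tilde B_{i+1/2}(\boldsymbol w,\phi_2)=\tfrac1{\tau_{\max}}\int_{I_{i+1/2}}(w_C-w_D)\phi_2dx+\int_{I_{i+1/2}}w_C\partial_x\phi_2dx-w_C(x_{i+1})\phi_2(x_{i+1}^-)+w_C(x_i)\phi_2(x_i^+).$$ Projection. Define $$\widehat P_i(\omega;\phi)=\tfrac1{\tau_{\max}}\Big[\int_{x_{i-1/2}}^{x_i}(\omega(x+\tfrac h2)-\omega(x))\phi\,dx+\int_{x_i}^{x_{i+1/2}}(\omega(x-\tfrac h2)-\omega(x))\phi\,dx\Big]+\int_{x_{i-1/2}}^{x_i}\omega(x+\tfrac h2)\partial_x\phi\,dx+\int_{x_i}^{x_{i+1/2}}\omega(x-\tfrac h2)\partial_x\phi\,dx-\omega(x_i)\big(\phi(x_{i+1/2}^-)-\phi(x_{i-1/2}^+)\big),$$ and $\widetilde P_{i+1/2}$ by the same formula with every index shifted by $1/2$. $P_C^*\omega\in V_h$ is the (uniquely determined) function with $\int_{I_i}P_C^*\omega=\int_{I_i}\omega$ and $\widehat P_i(P_C^*\omega;\phi)=\widehat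 P_i(\omega;\phi)$ for all $\phi\in\mathbb P^k(I_i)$ and all $i$; $P_D^*\omega\in W_h$ is defined analogously on dual cells with $\widetilde P_{i+1/2}$. Correction functions. $\boldsymbol R^0u=(R_C^0u,R_D^0u):=(u-P_C^*u,\,u-P_D^*u)$. For $l=1,2$, $\boldsymbol R^lu=(R_C^lu,R_D^lu)\in V_x^0\times W_x^0$ is defined by requiring for all $(\phi_1,\phi_2)\in V_x^0\times W_x^0$ and all $i$ $$\widehat P_i(R_C^lu,\phi_1)=-(R_C^{l-1}\partial_xu,\phi_1)_i-\hat B_i(\boldsymbol R^{l-1}u,\phi_1)+\widehat P_i(R_C^{l-1}u,\phi_1),$$ $$\widetilde P_{i+1/2}(R_D^lu,\phi_2)=-(R_D^{l-1}\partial_xu,\phi_2)_{i+1/2}-\tilde B_{i+1/2}(\boldsymbol R^{l-1}u,\phi_2)+\widetilde P_{i+1/2}(R_D^{l-1}u,\phi_2).$$ *)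

theory Defs
  imports "HOL-Analysis.Analysis" "HOL-Library.Periodic_Fun"
    "HOL-Computational_Algebra.Polynomial"
begin

section \<open>Periodic Sobolev spaces on an interval\<close>

text \<open>Functions on \<open>\<Omega> = [a, b]\<close> with periodic boundary conditions are represented by
  \<open>(b - a)\<close>-periodic functions on the real line.\<close>

definition L2_norm :: "real \<Rightarrow> real \<Rightarrow> (real \<Rightarrow> real) \<Rightarrow> real" where
  "L2_norm a b f = sqrt (LBINT x:{a..b}. (f x)\<^sup>2)"

definition L2_fun :: "real \<Rightarrow> real \<Rightarrow> (real \<Rightarrow> real) set" where
  "L2_fun a b = {f \<in> borel_measurable lborel. set_integrable lborel {a..b} (\<lambda>x. (f x)\<^sup>2)}"

definition periodic_test_funs :: "real \<Rightarrow> real \<Rightarrow> (real \<Rightarrow> real) set" where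
  "periodic_test_funs a b =
     {\<psi>. periodic_fun_simple \<psi> (b - a) \<and> (\<forall>n. (deriv ^^ n) \<psi> differentiable_on UNIV)}"

text \<open>\<open>g\<close> is a \<open>j\<close>-th weak derivative of \<open>f\<close> on the torus: testing against periodic, not just
  compactly supported, functions excludes jumps across the identified end points.\<close>

definition weak_derivative ::
    "real \<Rightarrow> real \<Rightarrow> nat \<Rightarrow> (real \<Rightarrow> real) \<Rightarrow> (real \<Rightarrow> real) \<Rightarrow> bool" where
  "weak_derivative a b j f g \<longleftrightarrow>
     (\<forall>\<psi> \<in> periodic_test_funs a b.
        (LBINT x:{a..b}. f x * (deriv ^^ j) \<psi> x) = (- 1) ^ j * (LBINT x:{a..b}. g x * \<psi> x))"

definition sobolev_space :: "real \<Rightarrow> real \<Rightarrow> nat \<Rightarrow> (real \<Rightarrow> real) set" where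
  "sobolev_space a b m =
     {f. periodic_fun_simple f (b - a) \<and> f \<in> L2_fun a b \<and>
         (\<forall>j\<le>m. \<exists>g \<in> L2_fun a b. weak_derivative a b j f g)}"

text \<open>Weak derivatives are unique almost everywhere on \<open>[a, b]\<close>, so the norm does not depend
  on the choice made here.\<close>

definition sobolev_norm :: "real \<Rightarrow> real \<Rightarrow> nat \<Rightarrow> (real \<Rightarrow> real) \<Rightarrow> real" where
  "sobolev_norm a b m f =
     sqrt (\<Sum>j\<le>m. (L2_norm a b (SOME g. g \<in> L2_fun a b \<and> weak_derivative a b j f g))\<^sup>2)"


section \<open>Central discontinuous Galerkin method on overlapping meshes\<close>

text \<open>\<open>\<Omega> = [a, b]\<close>, \<open>N\<close> primal cells, polynomial degree \<open>k\<close>, and \<open>CFL\<close> is the constant in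
  \<open>\<tau>\<^sub>m\<^sub>a\<^sub>x = CFL * h\<close>.\<close>

locale cdg =
  fixes a b :: real and N k :: nat and CFL :: real
begin

definition h :: real where
  "h = (b - a) / real N"

definition \<tau>max :: real where
  "\<tau>max = CFL * h"

text \<open>The point \<open>x\<^sub>r\<close> for integer or half-integer \<open>r\<close>; thus \<open>x\<^sub>1\<^sub>/\<^sub>2 = a\<close> and \<open>x\<^sub>N\<^sub>+\<^sub>1\<^sub>/\<^sub>2 = b\<close>. The cell
  with centre \<open>x\<^sub>r\<close> is primal for integer \<open>r\<close> and dual for \<open>r\<close> in \<open>\<int> + 1/2\<close>. All cells of the
  periodically extended mesh are indexed by \<open>int\<close>; \<open>i = 1, \<dots>, N\<close> is one period.\<close>

definition node :: "real \<Rightarrow> real" where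
  "node r = a + (r - 1/2) * h"

definition cell :: "real \<Rightarrow> real set" where
  "cell r = {node (r - 1/2)..node (r + 1/2)}"

text \<open>Periodic piecewise polynomials of degree at most \<open>n\<close> on the cells with centres
  \<open>x\<^sub>i\<^sub>+\<^sub>s\<close> (\<open>s = 0\<close>: primal, \<open>s = 1/2\<close>: dual). Out of each \<open>L\<^sup>2\<close> class we take
  the representative that is right-continuous at the interfaces, so that elements are determined
  as functions. No quantity below depends on values at the interfaces, since
  only one-sided limits are taken there.\<close>

definition pw_poly :: "real \<Rightarrow> nat \<Rightarrow> (real \<Rightarrow> real) set" where
  "pw_poly s n =
     {v. periodic_fun_simple v (b - a) \<and>
         (\<forall>i::int. \<exists>p. degree p \<le> n \<and>
            (\<forall>x \<in> {node (of_int i + s - 1/2)..<node (of_int i + s + 1/2)}. v x = poly p x))}"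

definition V :: "(real \<Rightarrow> real) set" where "V = pw_poly 0 k"

definition W :: "(real \<Rightarrow> real) set" where "W = pw_poly (1/2) k"

definition V0 :: "(real \<Rightarrow> real) set" where
  "V0 = {v \<in> V. \<forall>i::int. (LBINT x:cell (of_int i). v x) = 0}"

definition W0 :: "(real \<Rightarrow> real) set" where
  "W0 = {v \<in> W. \<forall>i::int. (LBINT x:cell (of_int i + 1/2). v x) = 0}"

definition Vbar :: "(real \<Rightarrow> real) set" where "Vbar = pw_poly 0 0"

definition Wbar :: "(real \<Rightarrow> real) set" where "Wbar = pw_poly (1/2) 0"

text \<open>The first component of the pair \<open>w\<close> is \<open>w\<^sub>C\<close>, the second is \<open>w\<^sub>D\<close>.\<close>

definition Bhat :: "int \<Rightarrow> (real \<Rightarrow> real) \<times> (real \<Rightarrow> real) \<Rightarrow> (real \<Rightarrow> real) \<Rightarrow> real" where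
  "Bhat i w \<phi> = (let wC = fst w; wD = snd w; r = real_of_int i in
     1 / \<tau>max * (LBINT x:cell r. (wD x - wC x) * \<phi> x)
     + (LBINT x:cell r. wD x * deriv \<phi> x)
     - wD (node (r + 1/2)) * Lim (at_left (node (r + 1/2))) \<phi>
     + wD (node (r - 1/2)) * Lim (at_right (node (r - 1/2))) \<phi>)"

text \<open>\<open>Btilde i\<close> is the form on the dual cell \<open>[x\<^sub>i, x\<^sub>i\<^sub>+\<^sub>1]\<close>.\<close>

definition Btilde :: "int \<Rightarrow> (real \<Rightarrow> real) \<times> (real \<Rightarrow> real) \<Rightarrow> (real \<Rightarrow> real) \<Rightarrow> real" where
  "Btilde i w \<phi> = (let wC = fst w; wD = snd w; r = real_of_int i in
     1 / \<tau>max * (LBINT x:cell (r + 1/2). (wC x - wD x) * \<phi> x)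
     + (LBINT x:cell (r + 1/2). wC x * deriv \<phi> x)
     - wC (node (r + 1)) * Lim (at_left (node (r + 1))) \<phi>
     + wC (node r) * Lim (at_right (node r)) \<phi>)"

definition P_form :: "real \<Rightarrow> (real \<Rightarrow> real) \<Rightarrow> (real \<Rightarrow> real) \<Rightarrow> real" where
  "P_form r \<omega> \<phi> =
     1 / \<tau>max * ((LBINT x:{node (r - 1/2)..node r}. (\<omega> (x + h/2) - \<omega> x) * \<phi> x)
                + (LBINT x:{node r..node (r + 1/2)}. (\<omega> (x - h/2) - \<omega> x) * \<phi> x))
     + (LBINT x:{node (r - 1/2)..node r}. \<omega> (x + h/2) * deriv \<phi> x)
     + (LBINT x:{node r..node (r + 1/2)}. \<omega> (x - h/2) * deriv \<phi> x)
     - \<omega> (node r) * (Lim (at_left (node (r + 1/2))) \<phi> - Lim (at_right (node (r - 1/2))) \<phi>)"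

definition Phat :: "int \<Rightarrow> (real \<Rightarrow> real) \<Rightarrow> (real \<Rightarrow> real) \<Rightarrow> real" where
  "Phat i = P_form (of_int i)"

definition Ptilde :: "int \<Rightarrow> (real \<Rightarrow> real) \<Rightarrow> (real \<Rightarrow> real) \<Rightarrow> real" where
  "Ptilde i = P_form (of_int i + 1/2)"

definition PC :: "(real \<Rightarrow> real) \<Rightarrow> real \<Rightarrow> real" where
  "PC \<omega> = (THE v. v \<in> V \<and>
     (\<forall>i. (LBINT x:cell (of_int i). v x) = (LBINT x:cell (of_int i). \<omega> x) \<and>
          (\<forall>p. degree p \<le> k \<longrightarrow> Phat i v (poly p) = Phat i \<omega> (poly p))))"

definition PD :: "(real \<Rightarrow> real) \<Rightarrow> real \<Rightarrow> real" where
  "PD \<omega> = (THE v. v \<in> W \<and>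
     (\<forall>i. (LBINT x:cell (of_int i + 1/2). v x) = (LBINT x:cell (of_int i + 1/2). \<omega> x) \<and>
          (\<forall>p. degree p \<le> k \<longrightarrow> Ptilde i v (poly p) = Ptilde i \<omega> (poly p))))"

text \<open>The correction functions \<open>R l u = (R\<^sub>C\<^sup>l u, R\<^sub>D\<^sup>l u)\<close>. They are applied to the continuous
  representative \<open>u\<close> of an element of \<open>H\<^sup>m\<close> with \<open>l \<le> m - 2\<close>; it is of class \<open>C\<^sup>m\<^sup>-\<^sup>1\<close>, so that
  the classical derivative \<open>deriv u\<close> is the continuous representative of the weak one.\<close>

primrec R :: "nat \<Rightarrow> (real \<Rightarrow> real) \<Rightarrow> (real \<Rightarrow> real) \<times> (real \<Rightarrow> real)" where
  "R 0 u = (\<lambda>x. u x - PC u x, \<lambda>x. u x - PD u x)"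
| "R (Suc l) u = (THE w. w \<in> V0 \<times> W0 \<and>
     (\<forall>\<phi>1 \<in> V0. \<forall>\<phi>2 \<in> W0. \<forall>i.
        Phat i (fst w) \<phi>1 =
          - (LBINT x:cell (of_int i). fst (R l (deriv u)) x * \<phi>1 x)
          - Bhat i (R l u) \<phi>1 + Phat i (fst (R l u)) \<phi>1 \<and>
        Ptilde i (snd w) \<phi>2 =
          - (LBINT x:cell (of_int i + 1/2). snd (R l (deriv u)) x * \<phi>2 x)
          - Btilde i (R l u) \<phi>2 + Ptilde i (snd (R l u)) \<phi>2))"

end

end

theory Submission
  imports Defs
begin

text \<open>In the coordinate \<open>t = (x - c)/h\<close> primal and dual cells look alike, and \<open>P_form\<close> and the
  B-forms lose their dependence on \<open>h\<close>; so all local problems live on the single cell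
  \<open>[-1/2, 1/2]\<close>. There the identity
  \<open>P(q; q) = -(1/C) \<integral> (q(t + 1/2) - q(t))\<^sup>2\<close> gives unisolvence, hence existence of the projections and
  corrections with \<open>h\<close>-independent bounds. On a uniform mesh the \<open>l\<close>-th correction annihilates degree
  \<open>k + l\<close>, and tested with a constant its B-form is a difference of one functional at two
  translates; this gains one degree, for \<open>l = 1 < k\<close> even two because the functional vanishes on
  degree \<open>k + 2\<close>. So the local form annihilates degree \<open>\<sigma>\<close> in every case, and Taylor's formula with
  \<open>\<partial>\<^sup>\<sigma> u\<close> absolutely continuous, followed by Cauchy-Schwarz over the cells, yields the estimate.\<close>

section \<open>The reference cell\<close>

text \<open>The functional subtracted at two translates is \<open>PF w\<close> tested with
  \<open>t\<close>, equal to \<open>left_int w / C - w 0\<close> for mean-free \<open>w\<close>. On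
  a correction its value is prescribed by the defining equation, so the degrees it annihilates can
  be computed. For \<open>k = 1\<close> there is neither a second correction nor \<open>t^2\<close>
  among the test polynomials, and \<open>\<sigma>\<close> is 3; for \<open>k \<ge> 2\<close> either
  of them leads to \<open>k + 3\<close>. Two obstacles shape the rest. \<open>R\<close>
  differentiates with \<open>deriv\<close>, while \<open>u\<close> is given by weak derivatives:
  \<open>u\<close> must be identified with an iterated primitive of its top weak derivative before
  the local formulas apply. That derivative is only square integrable, so it cannot be bounded on a
  single cell in the maximum norm. Instead \<open>(deriv ^^ \<sigma>) u\<close> is compared with its
  value at the cell centre, and the oscillation is bounded by the integral of the absolute weak
  derivative over six cells. Cauchy-Schwarz gives a factor \<open>sqrt h\<close> there, which
  offsets the \<open>1 / sqrt h\<close> in the discrete norm of the piecewise constant; the rate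
  left is the \<open>h ^ \<sigma>\<close> from rescaling.\<close>

abbreviation (input) cts :: "(real \<Rightarrow> real) \<Rightarrow> bool" where
  "cts f \<equiv> continuous_on UNIV f"

abbreviation (input) left_int :: "(real \<Rightarrow> real) \<Rightarrow> real" where
  "left_int f \<equiv> integral {-1/2..0} f"

abbreviation (input) right_int :: "(real \<Rightarrow> real) \<Rightarrow> real" where
  "right_int f \<equiv> integral {0..1/2} f"

section \<open>Linear algebra, interval integrals and shifted polynomials\<close>

lemma homogeneous_system_nontrivial:
  fixes A :: "'i \<Rightarrow> 'j \<Rightarrow> real"
  assumes "finite I" "finite J" "card I < card J"
  shows "\<exists>x. (\<exists>j\<in>J. x j \<noteq> 0) \<and> (\<forall>i\<in>I. (\<Sum>j\<in>J. A i j * x j) = 0)"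
  using assms
proof (induction I arbitrary: A J rule: finite_induct)
  case empty
  then have "J \<noteq> {}" by auto
  then show ?case by (intro exI[of _ "\<lambda>_. 1"]) auto
next
  case (insert r I)
  show ?case
  proof (cases "\<forall>j\<in>J. A r j = 0")
    case True
    have "card I < card J" using insert by simp
    from insert.IH[OF insert.prems(1) this, of A] True show ?thesis
      by (auto simp: sum.neutral)
  next
    case False
    then obtain q where q: "q \<in> J" "A r q \<noteq> 0" by blast
    define J' where "J' = J - {q}"
    have J': "finite J'" "card I < card J'"
      using insert q by (auto simp: J'_def)
    \<comment> \<open>Elimination with pivot \<open>A r q\<close>: subtracting
      \<open>A i q / A r q\<close> times row \<open>r\<close> removes unknown \<open>q\<close> from
      every other row. One equation and one unknown disappear together, so the strict inequality of
      the counts survives.\<close>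
    obtain x where x: "\<exists>j\<in>J'. x j \<noteq> 0"
      "\<forall>i\<in>I. (\<Sum>j\<in>J'. (A i j - A i q * A r j / A r q) * x j) = 0"
      using insert.IH[OF J', of "\<lambda>i j. A i j - A i q * A r j / A r q"] by blast
    define s where "s = (\<Sum>j\<in>J'. A r j * x j)"
    define y where "y = x(q := - s / A r q)"
    have yJ: "(\<Sum>j\<in>J. B j * y j) = B q * (- s / A r q) + (\<Sum>j\<in>J'. B j * x j)" for B
    proof -
      have "(\<Sum>j\<in>J. B j * y j) = B q * y q + (\<Sum>j\<in>J'. B j * y j)"
        unfolding J'_def using q insert.prems by (simp add: sum.remove)
      also have "(\<Sum>j\<in>J'. B j * y j) = (\<Sum>j\<in>J'. B j * x j)"
        by (intro sum.cong) (auto simp: y_def J'_def)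
      finally show ?thesis by (simp add: y_def)
    qed
    have "(\<Sum>j\<in>J. A i j * y j) = 0" if "i \<in> I" for i
    proof -
      have "0 = (\<Sum>j\<in>J'. A i j * x j - A i q / A r q * (A r j * x j))"
        using x(2) that by (simp add: algebra_simps)
      also have "\<dots> = (\<Sum>j\<in>J'. A i j * x j) - A i q / A r q * s"
        by (simp add: sum_subtractf s_def sum_distrib_left)
      finally show ?thesis unfolding yJ by (simp add: field_simps)
    qed
    moreover have "(\<Sum>j\<in>J. A r j * y j) = 0"
      unfolding yJ using q by (simp add: s_def)
    moreover have "\<exists>j\<in>J. y j \<noteq> 0"
      using x(1) by (auto simp: y_def J'_def)
    ultimately show ?thesis by (intro exI[of _ y]) auto
  qed
qed

lemma linear_functional_poly_expansion:
  fixes F :: "real poly \<Rightarrow> real"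
  assumes lin: "\<And>\<alpha> p q. F (smult \<alpha> p + q) = \<alpha> * F p + F q" and "degree p \<le> n"
  shows "F p = (\<Sum>j\<le>n. coeff p j * F (monom 1 j))"
proof -
  have F0: "F 0 = 0" using lin[of 1 0 0] by simp
  have "F (\<Sum>j\<in>S. monom (coeff p j) j) = (\<Sum>j\<in>S. coeff p j * F (monom 1 j))"
    if "finite S" for S
    using that
  proof induction
    case (insert x S)
    then show ?case using lin[of "coeff p x" "monom 1 x"] by (simp add: smult_monom)
  qed (simp add: F0)
  from this[of "{..n}"] show ?thesis
    using poly_as_sum_of_monoms'[OF assms(2)] by simp
qed

lemma integrable_on_Icc_continuous_UNIV:
  fixes f :: "real \<Rightarrow> real"
  shows "cts f \<Longrightarrow> f integrable_on {c..d}"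
  by (auto intro!: integrable_continuous_real intro: continuous_on_subset)

lemma integral_combine_linear:
  fixes f g :: "real \<Rightarrow> real"
  assumes "cts f" "cts g"
  shows "integral {c..d} (\<lambda>t. \<alpha> * f t + g t) = \<alpha> * integral {c..d} f + integral {c..d} g"
proof -
  have "f integrable_on {c..d}" "g integrable_on {c..d}"
    using assms by (auto intro!: integrable_continuous_real intro: continuous_on_subset)
  then show ?thesis
    by (subst integral_add) (auto intro: integrable_on_mult_right)
qed

lemma DERIV_imp_continuous_on:
  fixes F :: "real \<Rightarrow> real"
  assumes "\<And>x. (F has_real_derivative f x) (at x)"
  shows "continuous_on S F"
  using assms DERIV_continuous_on has_field_derivative_at_within by blast

lemma has_integral_DERIV:
  fixes F :: "real \<Rightarrow> real"
  assumes "c \<le> d" "\<And>x. (F has_real_derivative f x) (at x)"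
  shows "(f has_integral F d - F c) {c..d}"
  using assms by (intro fundamental_theorem_of_calculus)
    (auto simp flip: has_real_derivative_iff_has_vector_derivative intro: has_field_derivative_at_within)

lemma continuous_on_shift:
  fixes f :: "real \<Rightarrow> real"
  assumes "cts f"
  shows "cts (\<lambda>t. f (t + d))" "cts (\<lambda>t. f (t - d))"
  by (auto intro!: continuous_on_compose2[OF assms] continuous_intros)

lemma continuous_on_poly_UNIV [simp, intro]: "cts (poly (p :: real poly))"
  by (intro continuous_intros)

lemma poly_eq_zero_if_zero_on_interval:
  fixes p :: "real poly"
  assumes "c < d" "\<And>t. t \<in> {c..d} \<Longrightarrow> poly p t = 0"
  shows "p = 0"
proof (rule ccontr)
  assume "p \<noteq> 0"
  then have "finite {x. poly p x = 0}" by (rule poly_roots_finite)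
  then have "finite {c..d}" by (rule finite_subset[rotated]) (use assms in auto)
  then show False using assms(1) by (simp add: infinite_Icc)
qed

lemma abs_integral_le:
  fixes f :: "real \<Rightarrow> real"
  assumes "c \<le> d" "cts f" "\<And>t. t \<in> {c..d} \<Longrightarrow> \<bar>f t\<bar> \<le> B"
  shows "\<bar>integral {c..d} f\<bar> \<le> B * (d - c)"
  using integral_bound[of c d f B] continuous_on_subset[OF assms(2)] assms(1,3) by simp

lemma poly_bounded_on_cell:
  fixes p :: "real poly"
  obtains M where "M \<ge> 0" "\<And>t. \<bar>t\<bar> \<le> 1/2 \<Longrightarrow> \<bar>poly p t\<bar> \<le> M"
proof -
  have "bounded (poly p ` {-1/2..1/2})"
    by (intro compact_imp_bounded compact_continuous_image continuous_intros compact_Icc)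
  then obtain M where M: "\<forall>y\<in>poly p ` {-1/2..1/2}. norm y \<le> M"
    unfolding bounded_iff by blast
  show thesis
  proof (rule that[of "max M 0"])
    fix t :: real assume "\<bar>t\<bar> \<le> 1/2"
    then have "t \<in> {-1/2..1/2}" by (auto simp: abs_le_iff)
    then have "norm (poly p t) \<le> M" using M by blast
    then show "\<bar>poly p t\<bar> \<le> max M 0" by simp
  qed simp
qed

lemma degree_shift_diff:
  fixes p :: "real poly"
  shows "degree p \<le> n \<Longrightarrow> degree (pcompose p [:d, 1:] - p) \<le> n - 1"
proof (induction n arbitrary: p)
  case 0
  then obtain c where "p = [:c:]" by (metis degree_eq_zeroE le_zero_eq)
  then show ?case by simp
next
  case (Suc n)
  obtain c q where p: "p = pCons c q" by (cases p)
  have q: "degree q \<le> n" using Suc.prems p by (auto split: if_splits)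
  have e: "pcompose p [:d, 1:] - p = pCons 0 (pcompose q [:d, 1:] - q) + smult d (pcompose q [:d, 1:])"
    by (simp add: p pcompose_pCons algebra_simps)
  have 1: "degree (smult d (pcompose q [:d, 1:])) \<le> n"
    using q by (auto intro: order.trans[OF degree_smult_le] simp: degree_pcompose)
  have 2: "degree (pCons 0 (pcompose q [:d, 1:] - q)) \<le> n"
  proof (cases n)
    case 0
    then obtain c where "q = [:c:]" using q by (metis degree_eq_zeroE le_zero_eq)
    then show ?thesis by simp
  next
    case (Suc n')
    then show ?thesis using Suc.IH[OF q] degree_pCons_le[of 0 "pcompose q [:d, 1:] - q"] by simp
  qed
  show ?case unfolding e using degree_add_le[OF 2 1] by simp
qed

text \<open>Taylor's formula in \<open>d\<close>: once the terms of order 0 and 1 are removed, every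
  remaining term carries at least two derivatives of \<open>p\<close>.\<close>

lemma degree_shift_diff2:
  fixes p :: "real poly"
  shows "degree p \<le> n \<Longrightarrow> degree (pcompose p [:d, 1:] - p - smult d (pderiv p)) \<le> n - 2"
proof (induction n arbitrary: p)
  case 0
  then obtain c where "p = [:c:]" by (metis degree_eq_zeroE le_zero_eq)
  then show ?case by (simp add: pderiv_pCons)
next
  case (Suc n)
  obtain c q where p: "p = pCons c q" by (cases p)
  have q: "degree q \<le> n" using Suc.prems p by (auto split: if_splits)
  let ?E = "pcompose q [:d, 1:] - q - smult d (pderiv q)"
  have e: "pcompose p [:d, 1:] - p - smult d (pderiv p) = pCons 0 ?E + smult d (pcompose q [:d, 1:] - q)"
    by (simp add: p pcompose_pCons pderiv_pCons algebra_simps smult_add_right smult_diff_right)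
  have 1: "degree (smult d (pcompose q [:d, 1:] - q)) \<le> n - 1"
    using degree_shift_diff[OF q, of d] by (auto intro: order.trans[OF degree_smult_le])
  have 2: "degree (pCons 0 ?E) \<le> n - 1"
  \<comment> \<open>For \<open>n = 1\<close> truncation makes \<open>n - 2\<close> equal to 0, and
    \<open>pCons 0\<close> would raise the bound of the induction hypothesis above
    \<open>n - 1\<close>. For \<open>degree q \<le> 1\<close> the remainder is zero by direct
    computation.\<close>
  proof (cases "n \<le> 1")
    case True
    then have "degree q \<le> 1" using q by simp
    then obtain a0 q1 where "q = pCons a0 q1" "degree q1 = 0"
      by (cases q) (auto split: if_splits)
    then obtain a1 where "q = [:a0, a1:]" by (metis degree_eq_zeroE)
    then show ?thesis by (simp add: pcompose_pCons pderiv_pCons)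
  next
    case False
    then show ?thesis using Suc.IH[OF q] degree_pCons_le[of 0 ?E] by simp
  qed
  show ?case unfolding e using degree_add_le[OF 2 1] by simp
qed

text \<open>All derivatives at once, in the format of the data consumed by the local correction
  maps: differentiation is an index shift and translation acts on every order alike.\<close>

definition poly_jet :: "real poly \<Rightarrow> nat \<Rightarrow> real \<Rightarrow> real" where
  "poly_jet p j = poly ((pderiv ^^ j) p)"

lemma poly_jet_Suc: "(\<lambda>i. poly_jet p (Suc i)) = poly_jet (pderiv p)"
  by (auto simp: poly_jet_def funpow_Suc_right simp del: funpow.simps)

lemma pderiv_funpow_shift: "(pderiv ^^ j) (pcompose p [:d, 1:]) = pcompose ((pderiv ^^ j) p) [:d, 1 :: real:]"
  by (induction j) (simp_all add: pderiv_pcompose pderiv_pCons)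

lemma poly_jet_shift:
  "(\<lambda>i t. poly_jet p i (t + d)) = poly_jet (pcompose p [:d, 1:])"
  by (intro ext) (simp add: poly_jet_def pderiv_funpow_shift poly_pcompose add.commute)

lemma poly_jet_linear:
  "poly_jet (smult \<alpha> p + q) = (\<lambda>i t. \<alpha> * poly_jet p i t + poly_jet q i t)"
proof -
  have "(pderiv ^^ i) (smult \<alpha> p + q) = smult \<alpha> ((pderiv ^^ i) p) + (pderiv ^^ i) q" for i
    by (induction i) (simp_all add: pderiv_add pderiv_smult)
  then show ?thesis by (intro ext) (simp add: poly_jet_def)
qed

lemma continuous_on_poly_jet [simp, intro]: "cts (poly_jet p j)"
  by (simp add: poly_jet_def)

section \<open>The scaled forms on a cell of length one\<close>

locale reference_cell =
  fixes k :: nat and C :: real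
  assumes k_pos: "k \<ge> 1" and C_pos: "C > 0"
begin

definition mean :: "(real \<Rightarrow> real) \<Rightarrow> real" where
  "mean w = integral {-1/2..1/2} w"

text \<open>The B-form on the reference cell: \<open>w\<close> is the function on the cell itself, \<open>a\<close> and \<open>b\<close> are those
  on the cells centred at \<open>-1/2\<close> and \<open>1/2\<close>, each in its own centred coordinate. The projection form
  arises for \<open>a = b = w\<close>, and \<open>C\<close> is the CFL constant.\<close>

definition BF :: "(real \<Rightarrow> real) \<Rightarrow> (real \<Rightarrow> real) \<Rightarrow> (real \<Rightarrow> real) \<Rightarrow> real poly \<Rightarrow> real" where
  "BF a b w \<phi> =
     (left_int (\<lambda>t. (a (t + 1/2) - w t) * poly \<phi> t)
      + right_int (\<lambda>t. (b (t - 1/2) - w t) * poly \<phi> t)) / C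
     + left_int (\<lambda>t. a (t + 1/2) * poly (pderiv \<phi>) t)
     + right_int (\<lambda>t. b (t - 1/2) * poly (pderiv \<phi>) t)
     - b 0 * poly \<phi> (1/2) + a 0 * poly \<phi> (-1/2)"

abbreviation PF :: "(real \<Rightarrow> real) \<Rightarrow> real poly \<Rightarrow> real" where
  "PF w \<equiv> BF w w w"

lemma mean_linear:
  assumes "cts f" "cts g"
  shows "mean (\<lambda>t. \<alpha> * f t + g t) = \<alpha> * mean f + mean g"
  unfolding mean_def by (rule integral_combine_linear[OF assms])

lemma integral_left_shift:
  assumes "cts f"
  shows "left_int (\<lambda>t. f (t + 1/2)) = right_int (f :: real \<Rightarrow> real)"
  using integral_shift[of "-1/2" "1/2" 0 f] continuous_on_subset[OF assms] by (simp add: o_def)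

lemma integral_right_shift:
  assumes "cts f"
  shows "right_int (\<lambda>t. f (t - 1/2)) = left_int (f :: real \<Rightarrow> real)"
  using integral_shift[of "0" "-1/2" "1/2" f] continuous_on_subset[OF assms] by (simp add: o_def)

lemma integral_halves:
  assumes "cts f"
  shows "integral {-1/2..1/2::real} (f :: real \<Rightarrow> real) = left_int f + right_int f"
  using Henstock_Kurzweil_Integration.integral_combine[of "-1/2" 0 "1/2" f]
    integrable_continuous_real[OF continuous_on_subset[OF assms]] by simp

text \<open>Moves the half shifts from the data to the test polynomial. Each term is then an
  integral of one unshifted function against a polynomial, the form in which linearity and moments
  are read off.\<close>

lemma BF_shifted:
  assumes c: "cts a" "cts b" "cts w"
  shows "BF a b w \<phi> =
     (right_int (\<lambda>t. a t * poly \<phi> (t - 1/2)) - left_int (\<lambda>t. w t * poly \<phi> t)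
      + left_int (\<lambda>t. b t * poly \<phi> (t + 1/2)) - right_int (\<lambda>t. w t * poly \<phi> t)) / C
     + right_int (\<lambda>t. a t * poly (pderiv \<phi>) (t - 1/2))
     + left_int (\<lambda>t. b t * poly (pderiv \<phi>) (t + 1/2))
     - b 0 * poly \<phi> (1/2) + a 0 * poly \<phi> (-1/2)"
proof -
  have l: "left_int (\<lambda>t. a (t + 1/2) * poly p t) = right_int (\<lambda>t. a t * poly p (t - 1/2))" for p
    using integral_left_shift[of "\<lambda>t. a t * poly p (t - 1/2)"] by (simp add: c continuous_intros)
  have r: "right_int (\<lambda>t. b (t - 1/2) * poly p t) = left_int (\<lambda>t. b t * poly p (t + 1/2))" for p
    using integral_right_shift[of "\<lambda>t. b t * poly p (t + 1/2)"] by (simp add: c continuous_intros)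
  have s: "left_int (\<lambda>t. (a (t + 1/2) - w t) * poly \<phi> t)
      = left_int (\<lambda>t. a (t + 1/2) * poly \<phi> t) - left_int (\<lambda>t. w t * poly \<phi> t)"
    "right_int (\<lambda>t. (b (t - 1/2) - w t) * poly \<phi> t)
      = right_int (\<lambda>t. b (t - 1/2) * poly \<phi> t) - right_int (\<lambda>t. w t * poly \<phi> t)"
    unfolding left_diff_distrib
    by (intro integral_diff integrable_on_Icc_continuous_UNIV continuous_intros continuous_on_shift c)+
  show ?thesis unfolding BF_def s l r by simp
qed

lemma integral_linear_mult:
  assumes "cts f" "cts g" "cts \<psi>"
  shows "integral {c..d} (\<lambda>t. (\<alpha> * f t + g t) * \<psi> t) =
    \<alpha> * integral {c..d} (\<lambda>t. f t * \<psi> t) + integral {c..d} (\<lambda>t. g t * \<psi> t :: real)"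
  using integral_combine_linear[of "\<lambda>t. f t * \<psi> t" "\<lambda>t. g t * \<psi> t" c d \<alpha>] assms
  by (simp add: continuous_intros algebra_simps)

lemma BF_linear:
  assumes c: "cts a" "cts b" "cts w"
    "cts a'" "cts b'" "cts w'"
  shows "BF (\<lambda>t. \<alpha> * a t + a' t) (\<lambda>t. \<alpha> * b t + b' t) (\<lambda>t. \<alpha> * w t + w' t) \<phi> =
         \<alpha> * BF a b w \<phi> + BF a' b' w' \<phi>"
proof -
  have p: "cts (\<lambda>t. poly p (t + e))" "cts (\<lambda>t. poly p (t - e))"
    for p and e :: real by (intro continuous_intros)+
  have s: "cts (\<lambda>t. \<alpha> * a t + a' t)" "cts (\<lambda>t. \<alpha> * b t + b' t)"
    "cts (\<lambda>t. \<alpha> * w t + w' t)" by (intro continuous_intros c)+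
  show ?thesis
    unfolding BF_shifted[OF c(1-3)] BF_shifted[OF c(4-6)] BF_shifted[OF s]
    by (simp only: integral_linear_mult c p continuous_on_poly_UNIV)
      (simp add: algebra_simps add_divide_distrib diff_divide_distrib)
qed

lemma integral_mult_linear:
  assumes "cts \<psi>" "cts f" "cts g"
  shows "integral {c..d} (\<lambda>t. \<psi> t * (\<alpha> * f t + g t)) =
    \<alpha> * integral {c..d} (\<lambda>t. \<psi> t * f t) + integral {c..d} (\<lambda>t. \<psi> t * g t :: real)"
  using integral_linear_mult[OF assms(2,3,1), of c d \<alpha>] by (simp only: mult.commute)

lemma BF_linear_test:
  assumes c: "cts a" "cts b" "cts w"
  shows "BF a b w (smult \<alpha> \<phi> + \<psi>) = \<alpha> * BF a b w \<phi> + BF a b w \<psi>"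
proof -
  have p: "cts (\<lambda>t. poly p (t + e))" "cts (\<lambda>t. poly p (t - e))"
    for p and e :: real by (intro continuous_intros)+
  show ?thesis
    unfolding BF_shifted[OF c] pderiv_add pderiv_smult poly_add poly_smult
    by (simp only: integral_mult_linear c p continuous_on_poly_UNIV)
      (simp add: algebra_simps add_divide_distrib diff_divide_distrib)
qed

text \<open>The two half shifts exchange the halves of the cell, so the jump terms cancel. Constants
  carry no information for the projection form; this is why the mean is prescribed as a separate
  condition.\<close>

lemma PF_const:
  assumes c: "cts w"
  shows "PF w [:d:] = 0"
proof -
  have c': "cts (\<lambda>t. w t * d)" using c by (intro continuous_intros)
  have 1: "left_int (\<lambda>t. (w (t + 1/2) - w t) * d)
      = left_int (\<lambda>t. w (t + 1/2) * d) - left_int (\<lambda>t. w t * d)"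
    "right_int (\<lambda>t. (w (t - 1/2) - w t) * d)
      = right_int (\<lambda>t. w (t - 1/2) * d) - right_int (\<lambda>t. w t * d)"
    unfolding left_diff_distrib
    by (intro integral_diff integrable_on_Icc_continuous_UNIV continuous_intros continuous_on_shift c)+
  have 0: "poly [:d:] t = d" "poly (pderiv [:d:]) t = 0" for t
    by (simp_all add: pderiv_pCons)
  have "left_int (\<lambda>t. (w (t + 1/2) - w t) * d) + right_int (\<lambda>t. (w (t - 1/2) - w t) * d) = 0"
    unfolding 1 integral_left_shift[OF c'] integral_right_shift[OF c'] by linarith
  then show ?thesis unfolding BF_def 0 by simp
qed

text \<open>With both halves moved to \<open>[-1/2, 0]\<close>, the derivative terms are the
  derivative of \<open>q(t) q(t + 1/2)\<close>, whose boundary values cancel the point terms. The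
  jump terms combine to minus a square.\<close>

lemma PF_self:
  "PF (poly q) q = - left_int (\<lambda>t. (poly q (t + 1/2) - poly q t)\<^sup>2) / C"
proof -
  let ?q = "poly q" and ?d = "poly (pderiv q)"
  have r1: "right_int (\<lambda>t. (?q (t - 1/2) - ?q t) * ?q t)
    = left_int (\<lambda>t. (?q t - ?q (t + 1/2)) * ?q (t + 1/2))"
    using integral_left_shift[of "\<lambda>t. (?q (t - 1/2) - ?q t) * ?q t"]
    by (simp add: continuous_intros)
  have r2: "right_int (\<lambda>t. ?q (t - 1/2) * ?d t)
    = left_int (\<lambda>t. ?q t * ?d (t + 1/2))"
    using integral_left_shift[of "\<lambda>t. ?q (t - 1/2) * ?d t"]
    by (simp add: continuous_intros)
  have "((\<lambda>t. ?q (t + 1/2) * ?d t + ?q t * ?d (t + 1/2)) has_integral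
      ?q (0 + 1/2) * ?q 0 - ?q (-1/2 + 1/2) * ?q (-1/2)) {-1/2..0}"
    by (rule has_integral_DERIV) (auto intro!: derivative_eq_intros)
  then have d: "left_int (\<lambda>t. ?q (t + 1/2) * ?d t + ?q t * ?d (t + 1/2))
      = ?q (1/2) * ?q 0 - ?q 0 * ?q (-1/2)"
    by (simp add: integral_unique)
  have e: "left_int (\<lambda>t. (?q (t + 1/2) - ?q t) * ?q t)
      + left_int (\<lambda>t. (?q t - ?q (t + 1/2)) * ?q (t + 1/2))
      = - left_int (\<lambda>t. (?q (t + 1/2) - ?q t)\<^sup>2)"
  proof -
    have "(\<lambda>t. 1 * ((?q (t + 1/2) - ?q t) * ?q t) + (?q t - ?q (t + 1/2)) * ?q (t + 1/2))
        = (\<lambda>t. - (?q (t + 1/2) - ?q t)\<^sup>2)"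
      by (auto simp: power2_eq_square algebra_simps)
    then show ?thesis
      using integral_combine_linear[of "\<lambda>t. (?q (t + 1/2) - ?q t) * ?q t"
          "\<lambda>t. (?q t - ?q (t + 1/2)) * ?q (t + 1/2)" "-1/2" 0 1]
      by (simp add: continuous_intros)
  qed
  have d': "left_int (\<lambda>t. ?q (t + 1/2) * ?d t) + left_int (\<lambda>t. ?q t * ?d (t + 1/2))
     = left_int (\<lambda>t. ?q (t + 1/2) * ?d t + ?q t * ?d (t + 1/2))"
    using integral_combine_linear[of "\<lambda>t. ?q (t + 1/2) * ?d t" "\<lambda>t. ?q t * ?d (t + 1/2)" "-1/2" 0 1]
    by (simp add: continuous_intros)
  show ?thesis
    unfolding BF_def r1 r2 e using d' d by (simp add: algebra_simps)
qed

text \<open>The square vanishes only if \<open>q\<close> has period 1/2 on an interval, hence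
  everywhere. A periodic polynomial takes one value infinitely often and is constant, and the mean
  fixes the constant.\<close>

lemma PF_self_zero:
  assumes "PF (poly q) q = 0" "mean (poly q) = 0"
  shows "q = 0"
proof -
  define s where "s = pcompose q [:1/2, 1:] - q"
  have "left_int (\<lambda>t. (poly q (t + 1/2) - poly q t)\<^sup>2) = 0"
    using assms(1) C_pos unfolding PF_self by simp
  then have "\<forall>t\<in>{-1/2..0}. (poly q (t + 1/2) - poly q t)\<^sup>2 = 0"
    by (subst (asm) integral_eq_0_iff) (auto intro!: continuous_intros)
  then have "s = 0"
    by (intro poly_eq_zero_if_zero_on_interval[of "-1/2" 0])
      (auto simp: s_def poly_pcompose add.commute)
  then have shift: "poly q (t + 1/2) = poly q t" for t
  proof -
    have "poly s t = 0" by (simp add: \<open>s = 0\<close>)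
    then show ?thesis by (simp add: s_def poly_pcompose add.commute)
  qed
  have n: "poly q (real n / 2) = poly q 0" for n
  proof (induction n)
    case (Suc n)
    have "real (Suc n) / 2 = real n / 2 + 1/2" by (simp add: field_simps)
    then show ?case using shift[of "real n / 2"] Suc by metis
  qed simp
  have "q - [:poly q 0:] = 0"
  proof (rule ccontr)
    assume "q - [:poly q 0:] \<noteq> 0"
    then have "finite {x. poly (q - [:poly q 0:]) x = 0}" by (rule poly_roots_finite)
    moreover have "range (\<lambda>n. real n / 2) \<subseteq> {x. poly (q - [:poly q 0:]) x = 0}"
      using n by auto
    moreover have "infinite (range (\<lambda>n. real n / 2))"
      by (intro range_inj_infinite injI) auto
    ultimately show False using finite_subset by blast
  qed
  then obtain c where q: "q = [:c:]" by (metis right_minus_eq)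
  have "mean (poly [:c:]) = c" using integral_const_real[of c "-1/2" "1/2"] by (simp add: mean_def cong: integral_cong)
  then show ?thesis using assms(2) q by simp
qed

section \<open>Unisolvence and the solution operator of the local problems\<close>

definition dof :: "nat \<Rightarrow> real poly \<Rightarrow> real" where
  "dof i p = (if i = 0 then mean (poly p) else PF (poly p) (monom 1 i))"

lemma PF_expand:
  assumes "cts w" "degree \<phi> \<le> k"
  shows "PF w \<phi> = (\<Sum>j\<in>{1..k}. coeff \<phi> j * PF w (monom 1 j))"
proof -
  have "PF w \<phi> = (\<Sum>j\<le>k. coeff \<phi> j * PF w (monom 1 j))"
    by (rule linear_functional_poly_expansion[OF BF_linear_test assms(2)]) (rule assms)+
  also have "\<dots> = (\<Sum>j\<in>{1..k}. coeff \<phi> j * PF w (monom 1 j))"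
    using PF_const[OF assms(1), of 1]
    by (intro sum.mono_neutral_right) (auto simp: Suc_le_eq monom_0 one_pCons)
  finally show ?thesis .
qed

text \<open>Vanishing against \<open>t, ..., t^k\<close> permits testing with \<open>p\<close>
  itself, where the form is definite up to constants.\<close>

lemma dof_zero_imp_zero:
  assumes "degree p \<le> k" "\<And>i. i \<le> k \<Longrightarrow> dof i p = 0"
  shows "p = 0"
proof (rule PF_self_zero)
  have "PF (poly p) (monom 1 j) = 0" if "j \<in> {1..k}" for j
    using assms(2)[of j] that by (simp add: dof_def)
  then show "PF (poly p) p = 0"
    by (subst PF_expand) (use assms in auto)
  show "mean (poly p) = 0" using assms(2)[of 0] by (simp add: dof_def)
qed

lemma dof_linear: "dof i (smult \<alpha> p + q) = \<alpha> * dof i p + dof i q"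
proof -
  have e: "poly (smult \<alpha> p + q) = (\<lambda>t. \<alpha> * poly p t + poly q t)" by auto
  show ?thesis unfolding dof_def e by (simp add: mean_linear BF_linear)
qed

lemma dof_sum:
  "finite S \<Longrightarrow> dof i (\<Sum>j\<in>S. smult (c j) (p j)) = (\<Sum>j\<in>S. c j * dof i (p j))"
proof (induction S rule: finite_induct)
  case empty
  show ?case using dof_linear[of i 1 0 0] by simp
next
  case (insert x S)
  then show ?case using dof_linear[of i "c x" "p x"] by simp
qed

text \<open>Existence out of uniqueness: without condition \<open>j\<close> there remain
  \<open>k\<close> homogeneous equations for \<open>k + 1\<close> coefficients. A nonzero solution
  cannot also satisfy condition \<open>j\<close>, so it can be normalised.\<close>

lemma dual_basis_ex:
  "\<exists>g. \<forall>j\<le>k. degree (g j) \<le> k \<and> (\<forall>i\<le>k. dof i (g j) = (if i = j then 1 else 0))"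
proof -
  have "\<exists>p. degree p \<le> k \<and> (\<forall>i\<le>k. dof i p = (if i = j then 1 else 0))" if "j \<le> k" for j
  proof -
    have "card ({..k} - {j}) < card {..k}" using that by (intro psubset_card_mono) auto
    then obtain x where x: "\<exists>m\<in>{..k}. x m \<noteq> 0"
      "\<forall>i\<in>{..k} - {j}. (\<Sum>m\<in>{..k}. dof i (monom 1 m) * x m) = 0"
      using homogeneous_system_nontrivial[of "{..k} - {j}" "{..k}" "\<lambda>i m. dof i (monom 1 m)"]
      by auto
    define p where "p = (\<Sum>m\<in>{..k}. smult (x m) (monom 1 m))"
    have deg: "degree p \<le> k"
      unfolding p_def by (intro degree_sum_le) (auto intro: order.trans[OF degree_smult_le] simp: degree_monom_eq)
    have coeff: "coeff p m = x m" if "m \<le> k" for m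
      using that by (simp add: p_def coeff_sum sum.delta coeff_monom if_distrib cong: if_cong)
    have z: "dof i p = 0" if "i \<le> k" "i \<noteq> j" for i
      using x(2) that unfolding p_def by (subst dof_sum) (auto simp: mult.commute)
    have nz: "dof j p \<noteq> 0"
    proof
      assume "dof j p = 0"
      then have "p = 0" using z deg by (intro dof_zero_imp_zero) metis+
      then show False using x(1) coeff by auto
    qed
    have "dof i (smult (1 / dof j p) p) = (if i = j then 1 else 0)" if "i \<le> k" for i
      using dof_linear[of i "1 / dof j p" p 0] dof_linear[of i 1 0 0] z[OF that] nz by auto
    then show ?thesis
      using deg by (intro exI[of _ "smult (1 / dof j p) p"]) (auto intro: order.trans[OF degree_smult_le])
  qed
  then show ?thesis by metis
qed

definition dual_basis :: "nat \<Rightarrow> real poly" where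
  "dual_basis = (SOME g. \<forall>j\<le>k. degree (g j) \<le> k \<and> (\<forall>i\<le>k. dof i (g j) = (if i = j then 1 else 0)))"

lemma dual_basis:
  "j \<le> k \<Longrightarrow> degree (dual_basis j) \<le> k"
  "j \<le> k \<Longrightarrow> i \<le> k \<Longrightarrow> dof i (dual_basis j) = (if i = j then 1 else 0)"
  using someI_ex[OF dual_basis_ex] unfolding dual_basis_def by blast+

text \<open>Expansion in a basis depending on \<open>k\<close> and \<open>C\<close> alone, which
  makes linearity in the data and bounds independent of \<open>h\<close> immediate. \<open>m\<close>
  prescribes the mean, \<open>F j\<close> the form against \<open>t^j\<close>.\<close>

definition Sol :: "real \<Rightarrow> (nat \<Rightarrow> real) \<Rightarrow> real poly" where
  "Sol m F = (\<Sum>j\<le>k. smult (if j = 0 then m else F j) (dual_basis j))"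

lemma degree_Sol: "degree (Sol m F) \<le> k"
  unfolding Sol_def
  by (intro degree_sum_le) (auto intro: order.trans[OF degree_smult_le] dual_basis)

lemma dof_Sol: "i \<le> k \<Longrightarrow> dof i (Sol m F) = (if i = 0 then m else F i)"
  unfolding Sol_def
proof -
  assume i: "i \<le> k"
  have "(\<Sum>j\<le>k. (if j = 0 then m else F j) * dof i (dual_basis j)) =
    (\<Sum>j\<le>k. if j = i then (if i = 0 then m else F i) else 0)"
    using i by (intro sum.cong) (auto simp: dual_basis)
  then show "dof i (\<Sum>j\<le>k. smult (if j = 0 then m else F j) (dual_basis j)) = (if i = 0 then m else F i)"
    using i by (subst dof_sum) auto
qed

lemma mean_Sol: "mean (poly (Sol m F)) = m"
  using dof_Sol[of 0 m F] by (simp add: dof_def)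

lemma PF_Sol: "j \<in> {1..k} \<Longrightarrow> PF (poly (Sol m F)) (monom 1 j) = F j"
  using dof_Sol[of j m F] by (simp add: dof_def split: if_splits)

lemma Sol_linear: "Sol (\<alpha> * m + m') (\<lambda>j. \<alpha> * F j + F' j) = smult \<alpha> (Sol m F) + Sol m' F'"
proof -
  have "coeff (Sol (\<alpha> * m + m') (\<lambda>j. \<alpha> * F j + F' j)) n =
      (\<Sum>j\<le>k. \<alpha> * ((if j = 0 then m else F j) * coeff (dual_basis j) n)
        + (if j = 0 then m' else F' j) * coeff (dual_basis j) n)" for n
    unfolding Sol_def coeff_sum coeff_smult by (intro sum.cong) (auto simp: distrib_right)
  then have "coeff (Sol (\<alpha> * m + m') (\<lambda>j. \<alpha> * F j + F' j)) n =
      \<alpha> * coeff (Sol m F) n + coeff (Sol m' F') n" for n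
    unfolding Sol_def[of m F] Sol_def[of m' F'] coeff_sum coeff_smult sum_distrib_left sum.distrib[symmetric] .
  then show ?thesis by (intro poly_eqI) simp
qed

lemma Sol_unique:
  assumes "degree p \<le> k" "mean (poly p) = m"
    "\<And>j. j \<in> {1..k} \<Longrightarrow> PF (poly p) (monom 1 j) = F j"
  shows "p = Sol m F"
proof -
  have "smult (-1) (Sol m F) + p = 0"
  proof (rule dof_zero_imp_zero)
    show "degree (smult (-1) (Sol m F) + p) \<le> k"
      using degree_Sol assms(1) by (intro degree_add_le) auto
    fix i assume i: "i \<le> k"
    have "dof i p = (if i = 0 then m else F i)"
      using assms(2) assms(3)[of i] i by (auto simp: dof_def)
    then show "dof i (smult (-1) (Sol m F) + p) = 0"
      unfolding dof_linear dof_Sol[OF i] by simp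
  qed
  then show ?thesis by simp
qed

section \<open>Half-cell moments and the forms tested with 1, t and t^2\<close>

lemma integral_moment1:
  fixes w :: "real \<Rightarrow> real"
  assumes "cts w"
  shows "integral {c..d} (\<lambda>t. w t * (t + \<beta>)) = integral {c..d} (\<lambda>t. w t * t) + \<beta> * integral {c..d} w"
  using integral_combine_linear[of w "\<lambda>t. w t * t" c d \<beta>] assms
  by (simp add: continuous_intros algebra_simps)

lemma integral_moment2:
  fixes w :: "real \<Rightarrow> real"
  assumes "cts w"
  shows "integral {c..d} (\<lambda>t. w t * (t + \<beta>)\<^sup>2) =
    integral {c..d} (\<lambda>t. w t * t\<^sup>2) + 2 * \<beta> * integral {c..d} (\<lambda>t. w t * t) + \<beta>\<^sup>2 * integral {c..d} w"
  using integral_combine_linear[of "\<lambda>t. w t * t" "\<lambda>t. w t * t\<^sup>2" c d "2 * \<beta>"]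
    integral_combine_linear[of w "\<lambda>t. 2 * \<beta> * (w t * t) + w t * t\<^sup>2" c d "\<beta>\<^sup>2"] assms
  by (simp add: continuous_intros algebra_simps power2_eq_square)

text \<open>Against 1 the own piece \<open>w\<close> enters only through its mean, so just the two
  overlapping neighbours remain.\<close>

lemma BF_test_const:
  assumes c: "cts a" "cts b" "cts w" and "mean w = 0"
  shows "BF a b w 1 = (right_int a + left_int b) / C - b 0 + a 0"
  unfolding BF_shifted[OF c] using assms(4) integral_halves[OF c(3)]
  by (simp add: mean_def pderiv_1)

lemma BF_test_id:
  assumes c: "cts a" "cts b" "cts w"
  shows "BF a b w [:0, 1:] =
    (right_int (\<lambda>t. a t * t) - right_int a / 2 - left_int (\<lambda>t. w t * t)
      + left_int (\<lambda>t. b t * t) + left_int b / 2 - right_int (\<lambda>t. w t * t)) / C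
    + right_int a + left_int b - b 0 / 2 - a 0 / 2"
proof -
  have "right_int (\<lambda>t. a t * (t - 1/2)) = right_int (\<lambda>t. a t * t) - right_int a / 2"
    using integral_moment1[OF c(1), of 0 "1/2" "-1/2"] by simp
  moreover have "left_int (\<lambda>t. b t * (t + 1/2)) = left_int (\<lambda>t. b t * t) + left_int b / 2"
    using integral_moment1[OF c(2), of "-1/2" 0 "1/2"] by simp
  ultimately show ?thesis
    unfolding BF_shifted[OF c] by (simp add: pderiv_pCons)
qed

text \<open>First moments cancel between shifted and unshifted integrals. What remains is the
  functional that the B-form against 1 evaluates at both neighbours.\<close>

lemma PF_test_id:
  assumes c: "cts w" and "mean w = 0"
  shows "PF w [:0, 1:] = left_int w / C - w 0"
proof -
  have R: "right_int w = - left_int w"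
    using assms(2) integral_halves[OF c] by (simp add: mean_def)
  show ?thesis unfolding BF_test_id[OF c c c] R by simp
qed

text \<open>Second moments cancel, and so do the point values, as \<open>t^2\<close> agrees at both
  ends of the cell. The surviving terms involve first moments and \<open>left_int w\<close>, the
  same quantities that the B-form against \<open>t\<close> produces for the data \<open>- w\<close>,
  \<open>w\<close>, 0.\<close>

lemma PF_test_square:
  assumes c: "cts w" and "mean w = 0"
  shows "PF w [:0, 0, 1:] =
    (left_int (\<lambda>t. w t * t) - right_int (\<lambda>t. w t * t)) / C
     + 2 * mean (\<lambda>t. w t * t) + 2 * left_int w"
proof -
  have R: "right_int w = - left_int w"
    using assms(2) integral_halves[OF c] by (simp add: mean_def)
  have m: "mean (\<lambda>t. w t * t) = left_int (\<lambda>t. w t * t) + right_int (\<lambda>t. w t * t)"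
    unfolding mean_def by (intro integral_halves continuous_intros c)
  have p: "poly [:0, 0, 1:] t = t\<^sup>2" "poly (pderiv [:0, 0, 1:]) t = 2 * t" for t :: real
    by (simp_all add: pderiv_pCons power2_eq_square)
  have 1: "right_int (\<lambda>t. w t * (t - 1/2)\<^sup>2) = right_int (\<lambda>t. w t * t\<^sup>2)
      - right_int (\<lambda>t. w t * t) + right_int w / 4"
    using integral_moment2[OF c, of 0 "1/2" "-1/2"] by (simp add: power2_eq_square)
  have 2: "left_int (\<lambda>t. w t * (t + 1/2)\<^sup>2) = left_int (\<lambda>t. w t * t\<^sup>2)
      + left_int (\<lambda>t. w t * t) + left_int w / 4"
    using integral_moment2[OF c, of "-1/2" 0 "1/2"] by (simp add: power2_eq_square)
  have 3: "right_int (\<lambda>t. w t * (2 * (t - 1/2))) = 2 * right_int (\<lambda>t. w t * t) - right_int w"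
  proof -
    have "right_int (\<lambda>t. w t * (2 * (t - 1/2))) = right_int (\<lambda>t. 2 * (w t * (t + (-1/2))))"
      by (simp add: algebra_simps)
    also have "\<dots> = 2 * right_int (\<lambda>t. w t * (t + (-1/2)))" by (rule integral_mult_right)
    finally show ?thesis unfolding integral_moment1[OF c] by simp
  qed
  have 4: "left_int (\<lambda>t. w t * (2 * (t + 1/2))) = 2 * left_int (\<lambda>t. w t * t) + left_int w"
  proof -
    have "left_int (\<lambda>t. w t * (2 * (t + 1/2))) = left_int (\<lambda>t. 2 * (w t * (t + 1/2)))"
      by (simp add: algebra_simps)
    also have "\<dots> = 2 * left_int (\<lambda>t. w t * (t + 1/2))" by (rule integral_mult_right)
    finally show ?thesis unfolding integral_moment1[OF c] by simp
  qed
  show ?thesis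
    unfolding BF_shifted[OF c c c] p 1 2 3 4 m R by (simp add: power2_eq_square)
qed

section \<open>The local projection \<open>Q\<close>, which is \<open>PC\<close> and
  \<open>PD\<close> in the reference coordinate, and the local corrections\<close>

definition Q :: "(real \<Rightarrow> real) \<Rightarrow> real poly" where
  "Q \<omega> = Sol (mean \<omega>) (\<lambda>j. PF \<omega> (monom 1 j))"

lemma degree_Q: "degree (Q \<omega>) \<le> k"
  by (simp add: Q_def degree_Sol)

lemma mean_Q: "mean (poly (Q \<omega>)) = mean \<omega>"
  by (simp add: Q_def mean_Sol)

lemma PF_Q:
  assumes "cts \<omega>" "degree \<phi> \<le> k"
  shows "PF (poly (Q \<omega>)) \<phi> = PF \<omega> \<phi>"
proof -
  have "PF (poly (Q \<omega>)) \<phi> = (\<Sum>j\<in>{1..k}. coeff \<phi> j * PF (poly (Q \<omega>)) (monom 1 j))"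
    by (intro PF_expand assms continuous_on_poly_UNIV)
  also have "\<dots> = (\<Sum>j\<in>{1..k}. coeff \<phi> j * PF \<omega> (monom 1 j))"
    by (intro sum.cong refl) (simp add: Q_def PF_Sol)
  also have "\<dots> = PF \<omega> \<phi>" by (rule PF_expand[symmetric]) (rule assms)+
  finally show ?thesis .
qed

lemma Q_unique:
  assumes "degree p \<le> k" "mean (poly p) = mean \<omega>"
    "\<And>\<phi>. degree \<phi> \<le> k \<Longrightarrow> PF (poly p) \<phi> = PF \<omega> \<phi>"
  shows "p = Q \<omega>"
  unfolding Q_def
  by (rule Sol_unique) (use assms in \<open>auto simp: degree_monom_eq\<close>)

lemma Q_poly: "degree p \<le> k \<Longrightarrow> Q (poly p) = p"
  by (rule Q_unique[symmetric]) auto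

lemma Q_linear:
  assumes "cts f" "cts g"
  shows "Q (\<lambda>t. \<alpha> * f t + g t) = smult \<alpha> (Q f) + Q g"
  unfolding Q_def mean_linear[OF assms] BF_linear[OF assms(1) assms(1) assms(1) assms(2) assms(2) assms(2)]
  by (rule Sol_linear)

text \<open>The right-hand side of the equation defining a correction function, for the data
  \<open>w' = R\<^sup>l\<^sup>-\<^sup>1 \<partial>\<^sub>x u\<close> and \<open>w = R\<^sup>l\<^sup>-\<^sup>1 u\<close> on the cell and \<open>a\<close>, \<open>b\<close> on the
  overlapping cells to the left and right.\<close>

definition rhs_form :: "(real \<Rightarrow> real) \<Rightarrow> (real \<Rightarrow> real) \<Rightarrow> (real \<Rightarrow> real) \<Rightarrow> (real \<Rightarrow> real) \<Rightarrow> real poly \<Rightarrow> real" where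
  "rhs_form w' a b w \<phi> = - mean (\<lambda>t. w' t * poly \<phi> t) - BF a b w \<phi> + PF w \<phi>"

text \<open>The correction equations are imposed on mean-free tests only, so \<open>t^j\<close> is
  replaced by its mean-free part. The two differ by a constant, which the projection form cannot
  see.\<close>

definition \<mu> :: "nat \<Rightarrow> real poly" where
  "\<mu> j = monom 1 j - [:mean (poly (monom 1 j)):]"

text \<open>\<open>\<rho> l J\<close> is the local piece of the \<open>l\<close>-th correction function, where \<open>J j\<close> plays the role of the
  \<open>j\<close>-th derivative. Keeping the derivatives as separate data makes \<open>\<rho> l\<close> a linear map that
  needs no differentiability.\<close>

primrec \<rho> :: "nat \<Rightarrow> (nat \<Rightarrow> real \<Rightarrow> real) \<Rightarrow> real \<Rightarrow> real" where
  "\<rho> 0 J = (\<lambda>t. J 0 t - poly (Q (J 0)) t)"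
| "\<rho> (Suc l) J = poly (Sol 0 (\<lambda>j. rhs_form (\<rho> l (\<lambda>i. J (Suc i))) (\<rho> l (\<lambda>i t. J i (t - 1/2)))
      (\<rho> l (\<lambda>i t. J i (t + 1/2))) (\<rho> l J) (\<mu> j)))"

lemma continuous_on_\<rho>:
  "cts (J 0) \<Longrightarrow> cts (\<rho> l J)"
  by (cases l) (auto intro!: continuous_intros)

lemma mean_\<rho>:
  assumes "cts (J 0)"
  shows "mean (\<rho> l J) = 0"
proof (cases l)
  case 0
  have "mean (\<lambda>t. (-1) * poly (Q (J 0)) t + J 0 t) = - mean (poly (Q (J 0))) + mean (J 0)"
    by (subst mean_linear) (use assms in auto)
  then show ?thesis using 0 by (simp add: mean_Q add.commute)
qed (simp add: mean_Sol)

lemma rhs_form_linear: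
  assumes c: "cts w'" "cts a" "cts b" "cts w"
    "cts w1'" "cts a1" "cts b1" "cts w1"
  shows "rhs_form (\<lambda>t. \<alpha> * w' t + w1' t) (\<lambda>t. \<alpha> * a t + a1 t) (\<lambda>t. \<alpha> * b t + b1 t) (\<lambda>t. \<alpha> * w t + w1 t) \<phi> =
     \<alpha> * rhs_form w' a b w \<phi> + rhs_form w1' a1 b1 w1 \<phi>"
proof -
  have "mean (\<lambda>t. (\<alpha> * w' t + w1' t) * poly \<phi> t) = mean (\<lambda>t. \<alpha> * (w' t * poly \<phi> t) + w1' t * poly \<phi> t)"
    by (simp add: algebra_simps)
  also have "\<dots> = \<alpha> * mean (\<lambda>t. w' t * poly \<phi> t) + mean (\<lambda>t. w1' t * poly \<phi> t)"
    by (intro mean_linear continuous_intros c)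
  finally show ?thesis
    unfolding rhs_form_def by (subst (1 2) BF_linear) (use c in \<open>auto simp: algebra_simps\<close>)
qed

lemma \<rho>_linear:
  assumes "\<And>j. j \<le> l \<Longrightarrow> cts (J j)" "\<And>j. j \<le> l \<Longrightarrow> cts (J' j)"
  shows "\<rho> l (\<lambda>j t. \<alpha> * J j t + J' j t) = (\<lambda>t. \<alpha> * \<rho> l J t + \<rho> l J' t)"
  using assms
proof (induction l arbitrary: J J')
  case 0
  then show ?case by (simp add: Q_linear) (simp add: algebra_simps)
next
  case (Suc l)
  let ?S = "\<lambda>J i. J (Suc i)" and ?L = "\<lambda>J i t. J i (t - 1/2)" and ?R = "\<lambda>J i t. J i (t + 1/2)"
  have c: "cts (\<rho> l (?S J))" "cts (\<rho> l (?L J))"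
    "cts (\<rho> l (?R J))" "cts (\<rho> l J)"
    "cts (\<rho> l (?S J'))" "cts (\<rho> l (?L J'))"
    "cts (\<rho> l (?R J'))" "cts (\<rho> l J')"
    by (intro continuous_on_\<rho> continuous_on_shift Suc.prems; simp)+
  have "\<rho> (Suc l) (\<lambda>j t. \<alpha> * J j t + J' j t) = poly (Sol 0 (\<lambda>j.
      \<alpha> * rhs_form (\<rho> l (?S J)) (\<rho> l (?L J)) (\<rho> l (?R J)) (\<rho> l J) (\<mu> j)
       + rhs_form (\<rho> l (?S J')) (\<rho> l (?L J')) (\<rho> l (?R J')) (\<rho> l J') (\<mu> j)))"
    unfolding \<rho>.simps
    using Suc.IH[of "?S J" "?S J'"] Suc.IH[of "?L J" "?L J'"] Suc.IH[of "?R J" "?R J'"] Suc.IH[of J J']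
      Suc.prems
    by (simp add: rhs_form_linear c continuous_on_shift)
  also have "\<dots> = (\<lambda>t. \<alpha> * \<rho> (Suc l) J t + \<rho> (Suc l) J' t)"
    using Sol_linear[of \<alpha> 0 0] by auto
  finally show ?case .
qed

lemma \<rho>_scale:
  assumes "\<And>j. j \<le> l \<Longrightarrow> cts (J j)"
  shows "\<rho> l (\<lambda>j t. \<alpha> * J j t) = (\<lambda>t. \<alpha> * \<rho> l J t)"
proof -
  have z: "\<rho> l (\<lambda>j t. 0) = (\<lambda>t. 0)"
    using \<rho>_linear[of l "\<lambda>j t. 0" "\<lambda>j t. 0" 1] by (auto simp: fun_eq_iff)
  then show ?thesis using \<rho>_linear[of l J "\<lambda>j t. 0" \<alpha>] assms by simp
qed

text \<open>\<open>Sol\<close> prescribes the form against \<open>t^j\<close> by the right-hand side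
  at \<open>\<mu> j\<close>. For a mean-free \<open>\<phi>\<close> the constants subtracted in the
  \<open>\<mu> j\<close> sum to zero with the coefficients of \<open>\<phi>\<close>, so both sides
  agree at \<open>\<phi>\<close> itself.\<close>

lemma PF_\<rho>_Suc:
  assumes c: "\<And>j. j \<le> Suc l \<Longrightarrow> cts (J j)"
    and \<phi>: "degree \<phi> \<le> k" "mean (poly \<phi>) = 0"
  shows "PF (\<rho> (Suc l) J) \<phi> = rhs_form (\<rho> l (\<lambda>i. J (Suc i))) (\<rho> l (\<lambda>i t. J i (t - 1/2)))
      (\<rho> l (\<lambda>i t. J i (t + 1/2))) (\<rho> l J) \<phi>"
proof -
  let ?F = "rhs_form (\<rho> l (\<lambda>i. J (Suc i))) (\<rho> l (\<lambda>i t. J i (t - 1/2))) (\<rho> l (\<lambda>i t. J i (t + 1/2))) (\<rho> l J)"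
  have cc: "cts (\<rho> l (\<lambda>i. J (Suc i)))" "cts (\<rho> l (\<lambda>i t. J i (t - 1/2)))"
    "cts (\<rho> l (\<lambda>i t. J i (t + 1/2)))" "cts (\<rho> l J)"
    by (intro continuous_on_\<rho> continuous_on_shift c; simp)+
  have lin: "?F (smult \<alpha> p + q) = \<alpha> * ?F p + ?F q" for \<alpha> p q
  proof -
    have "mean (\<lambda>t. \<rho> l (\<lambda>i. J (Suc i)) t * poly (smult \<alpha> p + q) t)
      = mean (\<lambda>t. \<alpha> * (\<rho> l (\<lambda>i. J (Suc i)) t * poly p t) + \<rho> l (\<lambda>i. J (Suc i)) t * poly q t)"
      by (simp add: algebra_simps)
    also have "\<dots> = \<alpha> * mean (\<lambda>t. \<rho> l (\<lambda>i. J (Suc i)) t * poly p t) + mean (\<lambda>t. \<rho> l (\<lambda>i. J (Suc i)) t * poly q t)"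
      by (intro mean_linear continuous_intros cc)
    finally show ?thesis
      unfolding rhs_form_def BF_linear_test[OF cc(2,3,4)] BF_linear_test[OF cc(4,4,4)]
      by (simp add: algebra_simps)
  qed
  have mlin: "mean (poly (smult \<alpha> p + q)) = \<alpha> * mean (poly p) + mean (poly q)" for \<alpha> p q
    using dof_linear[of 0 \<alpha> p q] by (simp add: dof_def)
  have "mean (poly \<phi>) = (\<Sum>j\<le>k. coeff \<phi> j * mean (poly (monom 1 j)))"
    by (rule linear_functional_poly_expansion[OF mlin \<phi>(1)])
  then have m0: "(\<Sum>j\<le>k. coeff \<phi> j * mean (poly (monom 1 j))) = 0" using \<phi>(2) by simp
  have F\<mu>: "?F (\<mu> j) = ?F (monom 1 j) - mean (poly (monom 1 j)) * ?F 1" for j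
  proof -
    have "\<mu> j = smult (- mean (poly (monom 1 j))) 1 + monom 1 j" by (simp add: \<mu>_def one_pCons)
    then show ?thesis by (simp only: lin)
  qed
  \<comment> \<open>\<open>\<mu> 0\<close> is zero, which reconciles the sum over all coefficients
    with \<open>PF_expand\<close>, where index 0 is absent.\<close>
  have "mean (poly (monom 1 0)) = 1"
    using integral_const_real[of 1 "-1/2" "1/2"] by (simp add: mean_def monom_0 cong: integral_cong)
  then have F\<mu>0: "?F (\<mu> 0) = 0" unfolding F\<mu> by (simp add: monom_0 one_pCons)
  have "?F \<phi> = (\<Sum>j\<le>k. coeff \<phi> j * ?F (monom 1 j))"
    by (rule linear_functional_poly_expansion[OF lin \<phi>(1)])
  also have "\<dots> = (\<Sum>j\<le>k. coeff \<phi> j * ?F (\<mu> j)) + (\<Sum>j\<le>k. coeff \<phi> j * mean (poly (monom 1 j))) * ?F 1"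
    unfolding F\<mu> sum_distrib_right by (simp add: right_diff_distrib mult.assoc sum_subtractf)
  also have "\<dots> = (\<Sum>j\<le>k. coeff \<phi> j * ?F (\<mu> j))" using m0 by simp
  also have "\<dots> = (\<Sum>j\<in>{1..k}. coeff \<phi> j * ?F (\<mu> j))"
    using F\<mu>0 by (intro sum.mono_neutral_right) (auto simp: Suc_le_eq)
  also have "\<dots> = (\<Sum>j\<in>{1..k}. coeff \<phi> j * PF (\<rho> (Suc l) J) (monom 1 j))"
    by (intro sum.cong refl) (simp add: PF_Sol)
  also have "\<dots> = PF (\<rho> (Suc l) J) \<phi>"
    by (rule PF_expand[symmetric]) (use \<phi> in auto)
  finally show ?thesis by simp
qed

section \<open>Bounds on the local maps, and the polynomials they annihilate\<close>

lemma BF_bound: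
  obtains K where "K \<ge> 0"
    "\<And>a b w eps. cts a \<Longrightarrow> cts b \<Longrightarrow> cts w \<Longrightarrow>
      (\<And>t. \<bar>t\<bar> \<le> 1/2 \<Longrightarrow> \<bar>a t\<bar> \<le> eps \<and> \<bar>b t\<bar> \<le> eps \<and> \<bar>w t\<bar> \<le> eps) \<Longrightarrow> \<bar>BF a b w \<phi>\<bar> \<le> K * eps"
proof -
  obtain M1 where M1: "M1 \<ge> 0" "\<And>t. \<bar>t\<bar> \<le> 1/2 \<Longrightarrow> \<bar>poly \<phi> t\<bar> \<le> M1"
    using poly_bounded_on_cell by blast
  obtain M2 where M2: "M2 \<ge> 0" "\<And>t. \<bar>t\<bar> \<le> 1/2 \<Longrightarrow> \<bar>poly (pderiv \<phi>) t\<bar> \<le> M2"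
    using poly_bounded_on_cell by blast
  show thesis
  \<comment> \<open>Two jump integrals over half cells with integrand at most
    \<open>2 * eps * M1\<close>, two derivative integrals with integrand at most
    \<open>eps * M2\<close>, and two point values of at most \<open>eps * M1\<close>.\<close>
  proof (rule that[of "2 * M1 / C + M2 + 2 * M1"])
    show "0 \<le> 2 * M1 / C + M2 + 2 * M1" using M1 M2 C_pos by simp
    fix a b w :: "real \<Rightarrow> real" and eps
    assume c: "cts a" "cts b" "cts w"
      and bd: "\<And>t. \<bar>t\<bar> \<le> 1/2 \<Longrightarrow> \<bar>a t\<bar> \<le> eps \<and> \<bar>b t\<bar> \<le> eps \<and> \<bar>w t\<bar> \<le> eps"
    have e0: "eps \<ge> 0" using bd[of 0] by auto
    have half: "\<bar>integral {c..c + 1/2} f\<bar> \<le> B * (1/2)"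
      if "cts f" "\<And>t. t \<in> {c..c + 1/2} \<Longrightarrow> \<bar>f t\<bar> \<le> B" for f :: "real \<Rightarrow> real" and c B
      using abs_integral_le[of c "c + 1/2" f B] that by simp
    have i1: "\<bar>left_int (\<lambda>t. (a (t + 1/2) - w t) * poly \<phi> t)\<bar> \<le> 2 * eps * M1 * (1/2)"
    proof -
      have *: "\<bar>(a (t + 1/2) - w t) * poly \<phi> t\<bar> \<le> 2 * eps * M1" if "t \<in> {-1/2..-1/2 + 1/2}" for t
        unfolding abs_mult
        by (intro mult_mono M1) (use bd[of "t + 1/2"] bd[of t] e0 that in \<open>auto simp: abs_le_iff\<close>)
      have c': "cts (\<lambda>t. (a (t + 1/2) - w t) * poly \<phi> t)"
        by (intro continuous_intros continuous_on_shift c)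
      show ?thesis using half[OF c', of "-1/2", OF *] by simp
    qed
    have i2: "\<bar>right_int (\<lambda>t. (b (t - 1/2) - w t) * poly \<phi> t)\<bar> \<le> 2 * eps * M1 * (1/2)"
    proof -
      have *: "\<bar>(b (t - 1/2) - w t) * poly \<phi> t\<bar> \<le> 2 * eps * M1" if "t \<in> {0..0 + 1/2}" for t
        unfolding abs_mult
        by (intro mult_mono M1) (use bd[of "t - 1/2"] bd[of t] e0 that in \<open>auto simp: abs_le_iff\<close>)
      have c': "cts (\<lambda>t. (b (t - 1/2) - w t) * poly \<phi> t)"
        by (intro continuous_intros continuous_on_shift c)
      show ?thesis using half[OF c', of 0, OF *] by simp
    qed
    have i3: "\<bar>left_int (\<lambda>t. a (t + 1/2) * poly (pderiv \<phi>) t)\<bar> \<le> eps * M2 * (1/2)"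
    proof -
      have *: "\<bar>a (t + 1/2) * poly (pderiv \<phi>) t\<bar> \<le> eps * M2" if "t \<in> {-1/2..-1/2 + 1/2}" for t
        unfolding abs_mult
        by (intro mult_mono M2) (use bd[of "t + 1/2"] e0 that in \<open>auto simp: abs_le_iff\<close>)
      have c': "cts (\<lambda>t. a (t + 1/2) * poly (pderiv \<phi>) t)"
        by (intro continuous_intros continuous_on_shift c)
      show ?thesis using half[OF c', of "-1/2", OF *] by simp
    qed
    have i4: "\<bar>right_int (\<lambda>t. b (t - 1/2) * poly (pderiv \<phi>) t)\<bar> \<le> eps * M2 * (1/2)"
    proof -
      have *: "\<bar>b (t - 1/2) * poly (pderiv \<phi>) t\<bar> \<le> eps * M2" if "t \<in> {0..0 + 1/2}" for t
        unfolding abs_mult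
        by (intro mult_mono M2) (use bd[of "t - 1/2"] e0 that in \<open>auto simp: abs_le_iff\<close>)
      have c': "cts (\<lambda>t. b (t - 1/2) * poly (pderiv \<phi>) t)"
        by (intro continuous_intros continuous_on_shift c)
      show ?thesis using half[OF c', of 0, OF *] by simp
    qed
    have i5: "\<bar>b 0 * poly \<phi> (1/2)\<bar> \<le> eps * M1" "\<bar>a 0 * poly \<phi> (-1/2)\<bar> \<le> eps * M1"
      unfolding abs_mult using bd[of 0] e0 by (auto intro!: mult_mono M1)
    define X where "X = left_int (\<lambda>t. (a (t + 1/2) - w t) * poly \<phi> t)
      + right_int (\<lambda>t. (b (t - 1/2) - w t) * poly \<phi> t)"
    have "\<bar>X / C\<bar> \<le> 2 * eps * M1 / C"
      using i1 i2 C_pos e0 M1(1) unfolding X_def abs_divide by (intro frac_le) auto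
    moreover have "(2 * M1 / C + M2 + 2 * M1) * eps =
        2 * eps * M1 / C + eps * M2 * (1/2) + eps * M2 * (1/2) + eps * M1 + eps * M1"
      using C_pos by (simp add: field_simps)
    ultimately show "\<bar>BF a b w \<phi>\<bar> \<le> (2 * M1 / C + M2 + 2 * M1) * eps"
      using i3 i4 i5 unfolding BF_def X_def[symmetric] by linarith
  qed
qed

lemma mean_mult_bound:
  assumes "cts w" "\<And>t. \<bar>t\<bar> \<le> 1/2 \<Longrightarrow> \<bar>w t\<bar> \<le> eps" "\<And>t. \<bar>t\<bar> \<le> 1/2 \<Longrightarrow> \<bar>poly \<phi> t\<bar> \<le> M"
  shows "\<bar>mean (\<lambda>t. w t * poly \<phi> t)\<bar> \<le> M * eps"
proof -
  have "eps \<ge> 0" using assms(2)[of 0] by auto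
  then have "\<bar>w t * poly \<phi> t\<bar> \<le> M * eps" if "t \<in> {-1/2..1/2}" for t
    unfolding abs_mult using assms(2)[of t] assms(3)[of t] that
    by (subst mult.commute[of M]) (intro mult_mono; auto simp: abs_le_iff)
  then show ?thesis
    unfolding mean_def
    using integral_bound[of "-1/2" "1/2" "\<lambda>t. w t * poly \<phi> t" "M * eps"]
    by (simp add: continuous_on_mult continuous_on_subset[OF assms(1)] continuous_on_subset[OF continuous_on_poly_UNIV])
qed

lemma Sol_bound:
  obtains K where "K \<ge> 0"
    "\<And>m F eps t. \<bar>m\<bar> \<le> eps \<Longrightarrow> (\<And>j. j \<in> {1..k} \<Longrightarrow> \<bar>F j\<bar> \<le> eps) \<Longrightarrow> \<bar>t\<bar> \<le> 1/2 \<Longrightarrow> \<bar>poly (Sol m F) t\<bar> \<le> K * eps"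
proof -
  have "\<exists>M\<ge>0. \<forall>t. \<bar>t\<bar> \<le> 1/2 \<longrightarrow> \<bar>poly (dual_basis j) t\<bar> \<le> M" for j
    by (rule poly_bounded_on_cell[of "dual_basis j"]) blast
  then obtain M where M: "\<And>j. M j \<ge> 0" "\<And>j t. \<bar>t\<bar> \<le> 1/2 \<Longrightarrow> \<bar>poly (dual_basis j) t\<bar> \<le> M j"
    by metis
  show thesis
  proof (rule that[of "\<Sum>j\<le>k. M j"])
    show "0 \<le> (\<Sum>j\<le>k. M j)" by (intro sum_nonneg M)
    fix m eps t :: real and F
    assume m: "\<bar>m\<bar> \<le> eps" and F: "\<And>j. j \<in> {1..k} \<Longrightarrow> \<bar>F j\<bar> \<le> eps" and t: "\<bar>t\<bar> \<le> 1/2"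
    have "\<bar>poly (Sol m F) t\<bar> \<le> (\<Sum>j\<le>k. \<bar>(if j = 0 then m else F j) * poly (dual_basis j) t\<bar>)"
      unfolding Sol_def poly_sum poly_smult by (rule sum_abs)
    also have "\<dots> \<le> (\<Sum>j\<le>k. eps * M j)"
      unfolding abs_mult by (intro sum_mono mult_mono M t) (use m F in auto)
    finally show "\<bar>poly (Sol m F) t\<bar> \<le> (\<Sum>j\<le>k. M j) * eps"
      by (simp add: sum_distrib_left mult.commute)
  qed
qed

lemma rhs_form_bound:
  obtains K where "K \<ge> 0"
    "\<And>w' a b w eps. cts w' \<Longrightarrow> cts a \<Longrightarrow> cts b \<Longrightarrow> cts w \<Longrightarrow>
      (\<And>t. \<bar>t\<bar> \<le> 1/2 \<Longrightarrow> \<bar>w' t\<bar> \<le> eps \<and> \<bar>a t\<bar> \<le> eps \<and> \<bar>b t\<bar> \<le> eps \<and> \<bar>w t\<bar> \<le> eps) \<Longrightarrow>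
      \<bar>rhs_form w' a b w \<phi>\<bar> \<le> K * eps"
proof -
  obtain K where K: "K \<ge> 0"
    "\<And>a b w eps. cts a \<Longrightarrow> cts b \<Longrightarrow> cts w \<Longrightarrow>
      (\<And>t. \<bar>t\<bar> \<le> 1/2 \<Longrightarrow> \<bar>a t\<bar> \<le> eps \<and> \<bar>b t\<bar> \<le> eps \<and> \<bar>w t\<bar> \<le> eps) \<Longrightarrow> \<bar>BF a b w \<phi>\<bar> \<le> K * eps"
    using BF_bound by blast
  obtain M where M: "M \<ge> 0" "\<And>t. \<bar>t\<bar> \<le> 1/2 \<Longrightarrow> \<bar>poly \<phi> t\<bar> \<le> M"
    using poly_bounded_on_cell by blast
  show thesis
  proof (rule that[of "M + 2 * K"])
    fix w' a b w :: "real \<Rightarrow> real" and eps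
    assume c: "cts w'" "cts a" "cts b" "cts w"
      and bd: "\<And>t. \<bar>t\<bar> \<le> 1/2 \<Longrightarrow> \<bar>w' t\<bar> \<le> eps \<and> \<bar>a t\<bar> \<le> eps \<and> \<bar>b t\<bar> \<le> eps \<and> \<bar>w t\<bar> \<le> eps"
    have "\<bar>mean (\<lambda>t. w' t * poly \<phi> t)\<bar> \<le> M * eps" by (intro mean_mult_bound c M) (use bd in auto)
    moreover have "\<bar>BF a b w \<phi>\<bar> \<le> K * eps" "\<bar>PF w \<phi>\<bar> \<le> K * eps"
      by (intro K c; use bd in auto)+
    ultimately show "\<bar>rhs_form w' a b w \<phi>\<bar> \<le> (M + 2 * K) * eps"
      unfolding rhs_form_def by (simp add: abs_le_iff algebra_simps)
  qed (use K M in simp)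
qed

text \<open>Each correction consults the pieces centred half a unit to either side and one more
  derivative. Hence the data are needed up to order \<open>l\<close> and on a window that grows by
  1/2 per step, from 1/2 to \<open>(l + 1) / 2\<close>.\<close>

lemma \<rho>_bound:
  "\<exists>K\<ge>0. \<forall>J eps. (\<forall>j\<le>l. cts (J j)) \<longrightarrow>
     (\<forall>j\<le>l. \<forall>t. \<bar>t\<bar> \<le> real (Suc l) / 2 \<longrightarrow> \<bar>J j t\<bar> \<le> eps) \<longrightarrow> (\<forall>t. \<bar>t\<bar> \<le> 1/2 \<longrightarrow> \<bar>\<rho> l J t\<bar> \<le> K * eps)"
proof (induction l)
  case 0
  obtain K where K: "K \<ge> 0"
    "\<And>m F eps t. \<bar>m\<bar> \<le> eps \<Longrightarrow> (\<And>j. j \<in> {1..k} \<Longrightarrow> \<bar>F j\<bar> \<le> eps) \<Longrightarrow> \<bar>t\<bar> \<le> 1/2 \<Longrightarrow> \<bar>poly (Sol m F) t\<bar> \<le> K * eps"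
    using Sol_bound by blast
  have "\<exists>B\<ge>0. \<forall>w eps. cts w \<longrightarrow> (\<forall>t. \<bar>t\<bar> \<le> 1/2 \<longrightarrow> \<bar>w t\<bar> \<le> eps) \<longrightarrow> \<bar>PF w (monom 1 j)\<bar> \<le> B * eps" for j
    by (rule BF_bound[of "monom 1 j"]) blast
  then obtain B where B: "\<And>j. B j \<ge> 0"
    "\<And>j w eps. cts w \<Longrightarrow> (\<forall>t. \<bar>t\<bar> \<le> 1/2 \<longrightarrow> \<bar>w t\<bar> \<le> eps) \<Longrightarrow> \<bar>PF w (monom 1 j)\<bar> \<le> B j * eps"
    by metis
  \<comment> \<open>A common bound for everything \<open>Q\<close> is built from: the 1 covers the
    mean, the sum covers the values \<open>PF (J 0) (monom 1 j)\<close>.\<close>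
  define B' where "B' = 1 + (\<Sum>j\<le>k. B j)"
  have B': "1 \<le> B'" "\<And>j. j \<le> k \<Longrightarrow> B j \<le> B'"
  proof -
    show "1 \<le> B'" unfolding B'_def using sum_nonneg[of "{..k}" B] B(1) by simp
    fix j assume "j \<le> k"
    then show "B j \<le> B'" unfolding B'_def using member_le_sum[of j "{..k}" B] B(1) by simp
  qed
  show ?case
  proof (intro exI[of _ "1 + K * B'"] conjI allI impI)
    show "0 \<le> 1 + K * B'" using K B' by simp
    fix J :: "nat \<Rightarrow> real \<Rightarrow> real" and eps t :: real
    assume c: "\<forall>j\<le>0. cts (J j)" and b: "\<forall>j\<le>0. \<forall>t. \<bar>t\<bar> \<le> real (Suc 0) / 2 \<longrightarrow> \<bar>J j t\<bar> \<le> eps"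
      and t: "\<bar>t\<bar> \<le> 1/2"
    have c: "cts (J 0)" and b: "\<And>t. \<bar>t\<bar> \<le> 1/2 \<Longrightarrow> \<bar>J 0 t\<bar> \<le> eps" using c b by auto
    have e: "eps \<ge> 0" using b[of 0] by auto
    have "\<bar>mean (J 0)\<bar> \<le> 1 * eps"
      using mean_mult_bound[of "J 0" eps 1 1] c b by simp
    also have "\<dots> \<le> B' * eps" using B' e by (intro mult_right_mono) auto
    finally have m: "\<bar>mean (J 0)\<bar> \<le> B' * eps" .
    have "\<bar>PF (J 0) (monom 1 j)\<bar> \<le> B' * eps" if "j \<in> {1..k}" for j
    proof -
      have "\<bar>PF (J 0) (monom 1 j)\<bar> \<le> B j * eps" using B(2) c b by blast
      also have "\<dots> \<le> B' * eps" using B' e that by (intro mult_right_mono) auto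
      finally show ?thesis .
    qed
    then have "\<bar>poly (Q (J 0)) t\<bar> \<le> K * (B' * eps)"
      unfolding Q_def using m t by (intro K) auto
    then show "\<bar>\<rho> 0 J t\<bar> \<le> (1 + K * B') * eps"
      using b[OF t] by (simp add: abs_le_iff algebra_simps)
  qed
next
  case (Suc l)
  then obtain K0 where K0: "K0 \<ge> 0"
    "\<And>J eps t. (\<forall>j\<le>l. cts (J j)) \<Longrightarrow>
     (\<forall>j\<le>l. \<forall>t. \<bar>t\<bar> \<le> real (Suc l) / 2 \<longrightarrow> \<bar>J j t\<bar> \<le> eps) \<Longrightarrow> \<bar>t\<bar> \<le> 1/2 \<Longrightarrow> \<bar>\<rho> l J t\<bar> \<le> K0 * eps"
    by metis
  obtain K where K: "K \<ge> 0"
    "\<And>m F eps t. \<bar>m\<bar> \<le> eps \<Longrightarrow> (\<And>j. j \<in> {1..k} \<Longrightarrow> \<bar>F j\<bar> \<le> eps) \<Longrightarrow> \<bar>t\<bar> \<le> 1/2 \<Longrightarrow> \<bar>poly (Sol m F) t\<bar> \<le> K * eps"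
    using Sol_bound by blast
  have "\<exists>B\<ge>0. \<forall>w' a b w eps. cts w' \<longrightarrow> cts a \<longrightarrow> cts b \<longrightarrow> cts w \<longrightarrow>
      (\<forall>t. \<bar>t\<bar> \<le> 1/2 \<longrightarrow> \<bar>w' t\<bar> \<le> eps \<and> \<bar>a t\<bar> \<le> eps \<and> \<bar>b t\<bar> \<le> eps \<and> \<bar>w t\<bar> \<le> eps) \<longrightarrow>
      \<bar>rhs_form w' a b w (\<mu> j)\<bar> \<le> B * eps" for j
    by (rule rhs_form_bound[of "\<mu> j"]) blast
  then obtain B where B: "\<And>j. B j \<ge> 0"
    "\<And>j w' a b w eps. cts w' \<Longrightarrow> cts a \<Longrightarrow> cts b \<Longrightarrow> cts w \<Longrightarrow>
      (\<forall>t. \<bar>t\<bar> \<le> 1/2 \<longrightarrow> \<bar>w' t\<bar> \<le> eps \<and> \<bar>a t\<bar> \<le> eps \<and> \<bar>b t\<bar> \<le> eps \<and> \<bar>w t\<bar> \<le> eps) \<Longrightarrow>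
      \<bar>rhs_form w' a b w (\<mu> j)\<bar> \<le> B j * eps"
    by metis
  define B' where "B' = (\<Sum>j\<le>k. B j)"
  have B': "0 \<le> B'" "\<And>j. j \<le> k \<Longrightarrow> B j \<le> B'"
    using sum_nonneg[of "{..k}" B] member_le_sum[of _ "{..k}" B] B(1) unfolding B'_def by auto
  show ?case
  proof (intro exI[of _ "K * (B' * K0)"] conjI allI impI)
    show "0 \<le> K * (B' * K0)" using K K0 B' by simp
    fix J :: "nat \<Rightarrow> real \<Rightarrow> real" and eps t :: real
    assume c: "\<forall>j\<le>Suc l. cts (J j)"
      and b: "\<forall>j\<le>Suc l. \<forall>t. \<bar>t\<bar> \<le> real (Suc (Suc l)) / 2 \<longrightarrow> \<bar>J j t\<bar> \<le> eps"
      and t: "\<bar>t\<bar> \<le> 1/2"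
    have e: "eps \<ge> 0" using b[rule_format, of 0 0] by auto
    have cc: "cts (\<rho> l (\<lambda>i. J (Suc i)))" "cts (\<rho> l (\<lambda>i t. J i (t - 1/2)))"
      "cts (\<rho> l (\<lambda>i t. J i (t + 1/2)))" "cts (\<rho> l J)"
      by (intro continuous_on_\<rho> continuous_on_shift c[rule_format]; simp)+
    have "\<bar>\<rho> l (\<lambda>i. J (Suc i)) s\<bar> \<le> K0 * eps \<and> \<bar>\<rho> l (\<lambda>i t. J i (t - 1/2)) s\<bar> \<le> K0 * eps \<and>
        \<bar>\<rho> l (\<lambda>i t. J i (t + 1/2)) s\<bar> \<le> K0 * eps \<and> \<bar>\<rho> l J s\<bar> \<le> K0 * eps" if "\<bar>s\<bar> \<le> 1/2" for s
    proof (intro conjI K0 that allI impI)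
      fix j r assume *: "j \<le> l" "\<bar>r\<bar> \<le> real (Suc l) / 2"
      then have "\<bar>r\<bar> \<le> real (Suc (Suc l)) / 2" "\<bar>r - 1/2\<bar> \<le> real (Suc (Suc l)) / 2" "\<bar>r + 1/2\<bar> \<le> real (Suc (Suc l)) / 2"
        by (auto simp: abs_le_iff field_simps)
      then show "\<bar>J (Suc j) r\<bar> \<le> eps" "\<bar>J j (r - 1/2)\<bar> \<le> eps" "\<bar>J j (r + 1/2)\<bar> \<le> eps" "\<bar>J j r\<bar> \<le> eps"
        using b *(1) by auto
    qed (auto intro!: continuous_on_shift c[rule_format])
    then have *: "\<bar>rhs_form (\<rho> l (\<lambda>i. J (Suc i))) (\<rho> l (\<lambda>i t. J i (t - 1/2)))
      (\<rho> l (\<lambda>i t. J i (t + 1/2))) (\<rho> l J) (\<mu> j)\<bar> \<le> B j * (K0 * eps)" for j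
      using B(2) cc by blast
    have "\<bar>rhs_form (\<rho> l (\<lambda>i. J (Suc i))) (\<rho> l (\<lambda>i t. J i (t - 1/2)))
      (\<rho> l (\<lambda>i t. J i (t + 1/2))) (\<rho> l J) (\<mu> j)\<bar> \<le> B' * (K0 * eps)" if "j \<in> {1..k}" for j
      by (rule order.trans[OF *]) (use B' K0 e that in \<open>auto intro!: mult_right_mono\<close>)
    then have "\<bar>\<rho> (Suc l) J t\<bar> \<le> K * (B' * (K0 * eps))"
      unfolding \<rho>.simps by (intro K) (use B' K0 e t in auto)
    then show "\<bar>\<rho> (Suc l) J t\<bar> \<le> K * (B' * K0) * eps" by (simp add: mult.assoc)
  qed
qed

text \<open>One degree is gained per step. A shift changes \<open>p\<close> by a polynomial of lower
  degree, which step \<open>l\<close> annihilates, so the neighbouring pieces coincide with the own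
  one and the B-form cancels the projection form. The mass term involves \<open>pderiv p\<close> and
  vanishes for the same reason.\<close>

lemma \<rho>_poly_jet_zero: "degree p \<le> k + l \<Longrightarrow> \<rho> l (poly_jet p) = (\<lambda>t. 0)"
proof (induction l arbitrary: p)
  case 0
  then show ?case by (simp add: poly_jet_def Q_poly)
next
  case (Suc l)
  have shift: "\<rho> l (\<lambda>i t. poly_jet p i (t + d)) = \<rho> l (poly_jet p)" for d
  proof -
    have "degree (pcompose p [:d, 1:] - p) \<le> k + l"
      using degree_shift_diff[OF Suc.prems, of d] by simp
    then have "\<rho> l (poly_jet (pcompose p [:d, 1:] - p)) = (\<lambda>t. 0)" by (rule Suc.IH)
    moreover have "(\<lambda>i t. poly_jet p i (t + d)) =
        (\<lambda>i t. 1 * poly_jet (pcompose p [:d, 1:] - p) i t + poly_jet p i t)"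
      unfolding poly_jet_shift poly_jet_linear[symmetric] by simp
    ultimately show ?thesis by (simp only: \<rho>_linear continuous_on_poly_jet) simp
  qed
  have "degree (pderiv p) \<le> k + l" using Suc.prems by (simp add: degree_pderiv)
  then have "\<rho> l (\<lambda>i. poly_jet p (Suc i)) = (\<lambda>t. 0)" unfolding poly_jet_Suc by (rule Suc.IH)
  then have "rhs_form (\<rho> l (\<lambda>i. poly_jet p (Suc i))) (\<rho> l (\<lambda>i t. poly_jet p i (t - 1/2)))
      (\<rho> l (\<lambda>i t. poly_jet p i (t + 1/2))) (\<rho> l (poly_jet p)) (\<mu> j) = 0" for j
    using shift[of "1/2"] shift[of "-1/2"] by (simp add: rhs_form_def mean_def)
  then show ?case by (simp add: Sol_def)
qed

section \<open>The B-form of a correction tested with a constant\<close>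

definition const_form :: "nat \<Rightarrow> (nat \<Rightarrow> real \<Rightarrow> real) \<Rightarrow> real" where
  "const_form l J = BF (\<rho> l (\<lambda>i t. J i (t - 1/2))) (\<rho> l (\<lambda>i t. J i (t + 1/2))) (\<rho> l J) 1"

lemma const_form_linear:
  assumes "\<And>j. j \<le> l \<Longrightarrow> cts (J j)" "\<And>j. j \<le> l \<Longrightarrow> cts (J' j)"
  shows "const_form l (\<lambda>j t. \<alpha> * J j t + J' j t) = \<alpha> * const_form l J + const_form l J'"
proof -
  have 1: "\<rho> l (\<lambda>j t. \<alpha> * J j (t - 1/2) + J' j (t - 1/2)) =
      (\<lambda>t. \<alpha> * \<rho> l (\<lambda>j t. J j (t - 1/2)) t + \<rho> l (\<lambda>j t. J' j (t - 1/2)) t)"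
    by (rule \<rho>_linear) (intro continuous_on_shift assms; assumption)+
  have 2: "\<rho> l (\<lambda>j t. \<alpha> * J j (t + 1/2) + J' j (t + 1/2)) =
      (\<lambda>t. \<alpha> * \<rho> l (\<lambda>j t. J j (t + 1/2)) t + \<rho> l (\<lambda>j t. J' j (t + 1/2)) t)"
    by (rule \<rho>_linear) (intro continuous_on_shift assms; assumption)+
  have 3: "\<rho> l (\<lambda>j t. \<alpha> * J j t + J' j t) = (\<lambda>t. \<alpha> * \<rho> l J t + \<rho> l J' t)"
    by (rule \<rho>_linear) (intro assms; assumption)+
  show ?thesis
    unfolding const_form_def 1 2 3
    by (rule BF_linear) (intro continuous_on_\<rho> continuous_on_shift assms le0)+
qed

text \<open>All pieces are mean-free, so \<open>right_int\<close> of the left neighbour is minus its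
  \<open>left_int\<close>. The form becomes the same functional at the right neighbour minus that at
  the left one, and \<open>PF_test_id\<close> identifies the functional.\<close>

lemma const_form_conv_PF:
  assumes c: "cts (J 0)"
  shows "const_form l J = PF (\<rho> l (\<lambda>i t. J i (t - 1/2))) [:0, 1:] * (-1) + PF (\<rho> l (\<lambda>i t. J i (t + 1/2))) [:0, 1:]"
proof -
  let ?a = "\<rho> l (\<lambda>i t. J i (t - 1/2))" and ?b = "\<rho> l (\<lambda>i t. J i (t + 1/2))"
  have cc: "cts ?a" "cts ?b" "cts (\<rho> l J)"
    by (intro continuous_on_\<rho> continuous_on_shift c; simp)+
  have m: "mean ?a = 0" "mean ?b = 0" "mean (\<rho> l J) = 0"
    by (intro mean_\<rho> continuous_on_shift c)+
  have "right_int ?a = - left_int ?a"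
    using m(1) integral_halves[OF cc(1)] by (simp add: mean_def)
  then show ?thesis
    unfolding const_form_def BF_test_const[OF cc m(3)] PF_test_id[OF cc(1) m(1)] PF_test_id[OF cc(2) m(2)]
    by (simp add: diff_divide_distrib add_divide_distrib)
qed

text \<open>Since \<open>R\<^sup>0\<close> annihilates degree \<open>k\<close>, on degree \<open>k + 2\<close> the neighbouring pieces of \<open>R\<^sup>0 q\<close> differ
  from the central one by \<open>\<plusminus>e/2\<close> with \<open>e = R\<^sup>0 q'\<close>, and the right-hand side tested with \<open>t\<close>
  collapses to \<open>-1/2\<close> times the projection form of \<open>e\<close> against \<open>t\<^sup>2\<close>. This is the extra order
  gained by the first correction when \<open>k \<ge> 2\<close>.\<close>

lemma PF_\<rho>_1_id:
  assumes "k \<ge> 2" "degree q \<le> k + 2"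
  shows "PF (\<rho> 1 (poly_jet q)) [:0, 1:] = 0"
proof -
  define e where "e = \<rho> 0 (poly_jet (pderiv q))"
  define w where "w = \<rho> 0 (poly_jet q)"
  have ce: "cts e" "cts w"
    unfolding e_def w_def by (intro continuous_on_\<rho> continuous_on_poly_jet)+
  have me: "mean e = 0" unfolding e_def by (intro mean_\<rho> continuous_on_poly_jet)
  have shift: "\<rho> 0 (\<lambda>i t. poly_jet q i (t + d)) = (\<lambda>t. d * e t + w t)" for d
  proof -
    \<comment> \<open>The second-order remainder of the translate has degree at most
      \<open>k\<close>, so \<open>\<rho> 0\<close> annihilates it and only the linear term
      \<open>d * e\<close> is left.\<close>
    let ?r = "pcompose q [:d, 1:] - q - smult d (pderiv q)"
    have "degree ?r \<le> k + 0" using degree_shift_diff2[OF assms(2), of d] by simp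
    then have z: "\<rho> 0 (poly_jet ?r) = (\<lambda>t. 0)" by (rule \<rho>_poly_jet_zero)
    have eq: "(\<lambda>i t. poly_jet q i (t + d)) = (\<lambda>i t. 1 * poly_jet ?r i t + (d * poly_jet (pderiv q) i t + poly_jet q i t))"
    proof -
      have 1: "smult 1 ?r + (smult d (pderiv q) + q) = pcompose q [:d, 1:]" by simp
      show ?thesis
        unfolding poly_jet_shift by (subst 1[symmetric]) (simp only: poly_jet_linear)
    qed
    have "\<rho> 0 (\<lambda>i t. 1 * poly_jet ?r i t + (d * poly_jet (pderiv q) i t + poly_jet q i t))
      = (\<lambda>t. 1 * \<rho> 0 (poly_jet ?r) t + \<rho> 0 (\<lambda>i t. d * poly_jet (pderiv q) i t + poly_jet q i t) t)"
      by (rule \<rho>_linear) (intro continuous_intros continuous_on_poly_jet)+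
    also have "\<rho> 0 (\<lambda>i t. d * poly_jet (pderiv q) i t + poly_jet q i t) = (\<lambda>t. d * e t + w t)"
      unfolding e_def w_def by (rule \<rho>_linear) (intro continuous_on_poly_jet)+
    finally show ?thesis unfolding eq z by simp
  qed
  have l: "\<rho> 0 (\<lambda>i t. poly_jet q i (t - 1/2)) = (\<lambda>t. (-1/2) * e t + w t)"
    and r: "\<rho> 0 (\<lambda>i t. poly_jet q i (t + 1/2)) = (\<lambda>t. (1/2) * e t + w t)"
    using shift[of "-1/2"] shift[of "1/2"] by simp_all
  have "mean (poly [:0, 1:]) = 0"
  proof -
    have "((\<lambda>t::real. t) has_integral (1/2)\<^sup>2 / 2 - (-1/2)\<^sup>2 / 2) {-1/2..1/2}"
      by (rule has_integral_DERIV) (auto intro!: derivative_eq_intros)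
    moreover have "poly [:0, 1:] = (\<lambda>t::real. t)" by auto
    ultimately show ?thesis by (simp add: mean_def integral_unique power2_eq_square)
  qed
  then have "PF (\<rho> (Suc 0) (poly_jet q)) [:0, 1:]
      = rhs_form (\<rho> 0 (\<lambda>i. poly_jet q (Suc i))) (\<rho> 0 (\<lambda>i t. poly_jet q i (t - 1/2)))
          (\<rho> 0 (\<lambda>i t. poly_jet q i (t + 1/2))) (\<rho> 0 (poly_jet q)) [:0, 1:]"
    by (intro PF_\<rho>_Suc continuous_on_poly_jet) (use k_pos in simp_all)
  also have "\<dots> = rhs_form e (\<lambda>t. (-1/2) * e t + w t) (\<lambda>t. (1/2) * e t + w t) w [:0, 1:]"
    unfolding l r poly_jet_Suc e_def[symmetric] w_def[symmetric] ..
  also have "\<dots> = - mean (\<lambda>t. e t * t) - (1/2) * BF (\<lambda>t. - e t) e (\<lambda>t. 0) [:0, 1:]"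
  proof -
    have "BF (\<lambda>t. (1/2) * (- e t) + w t) (\<lambda>t. (1/2) * e t + w t) (\<lambda>t. (1/2) * 0 + w t) [:0, 1:]
      = (1/2) * BF (\<lambda>t. - e t) e (\<lambda>t. 0) [:0, 1:] + PF w [:0, 1:]"
      by (rule BF_linear) (intro continuous_intros ce)+
    then show ?thesis unfolding rhs_form_def by simp
  qed
  also have "\<dots> = - (1/2) * PF e [:0, 0, 1:]"
  proof -
    have R: "right_int e = - left_int e"
      using me integral_halves[OF ce(1)] by (simp add: mean_def)
    have c': "cts (\<lambda>t. - e t)" "cts (\<lambda>t. 0 :: real)"
      by (intro continuous_intros ce)+
    have m: "mean (\<lambda>t. e t * t) = left_int (\<lambda>t. e t * t) + right_int (\<lambda>t. e t * t)"
      unfolding mean_def by (intro integral_halves continuous_intros ce)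
    show ?thesis
      unfolding PF_test_square[OF ce(1) me] BF_test_id[OF c'(1) ce(1) c'(2)] m
      by (simp add: R algebra_simps diff_divide_distrib add_divide_distrib)
  qed
  also have "PF e [:0, 0, 1:] = PF (poly_jet (pderiv q) 0) [:0, 0, 1:] - PF (poly (Q (poly_jet (pderiv q) 0))) [:0, 0, 1:]"
  proof -
    let ?v = "poly_jet (pderiv q) 0"
    have "e = (\<lambda>t. (-1) * poly (Q ?v) t + ?v t)" by (simp add: e_def)
    then show ?thesis by (simp only: BF_linear continuous_on_poly_UNIV continuous_on_poly_jet)
  qed
  \<comment> \<open>\<open>e\<close> is an error of the projection, and \<open>k \<ge> 2\<close>
    makes \<open>t^2\<close> a test polynomial against which the projection preserves the
    form.\<close>
  also have "\<dots> = 0" using assms(1) by (subst PF_Q) auto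
  finally show ?thesis by simp
qed

text \<open>Taking the difference of the two neighbours amounts to applying the functional to
  \<open>q(t) = p(t + 1/2) - p(t - 1/2)\<close>, whose degree is one less than that of
  \<open>p\<close>.\<close>

lemma const_form_poly_jet_zero:
  assumes l: "l \<in> {1..min k 2}" and p: "degree p \<le> min (2 * k + 1) (k + 3)"
  shows "const_form l (poly_jet p) = 0"
proof -
  define q where "q = pcompose p [:1/2, 1:] - pcompose p [:-1/2, 1:]"
  have "q = pcompose (pcompose p [:-1/2, 1:]) [:1, 1:] - pcompose p [:-1/2, 1:]"
    unfolding q_def pcompose_assoc[symmetric] by (simp add: pcompose_pCons)
  then have q: "degree q \<le> min (2 * k + 1) (k + 3) - 1"
    using degree_shift_diff[of "pcompose p [:-1/2, 1:]" "min (2 * k + 1) (k + 3)" 1] p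
    by (simp add: degree_pcompose)
  have "const_form l (poly_jet p) = PF (\<rho> l (poly_jet (pcompose p [:1/2, 1:]))) [:0, 1:]
      - PF (\<rho> l (poly_jet (pcompose p [:-1/2, 1:]))) [:0, 1:]"
    using poly_jet_shift[of p "1/2"] poly_jet_shift[of p "-1/2"] by (simp add: const_form_conv_PF)
  also have "\<dots> = PF (\<rho> l (poly_jet q)) [:0, 1:]"
  proof -
    have "poly_jet (pcompose p [:1/2, 1:]) = (\<lambda>i t. 1 * poly_jet q i t + poly_jet (pcompose p [:-1/2, 1:]) i t)"
      unfolding poly_jet_linear[symmetric] q_def by simp
    then have "\<rho> l (poly_jet (pcompose p [:1/2, 1:])) = (\<lambda>t. 1 * \<rho> l (poly_jet q) t + \<rho> l (poly_jet (pcompose p [:-1/2, 1:])) t)"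
      by (simp only: \<rho>_linear continuous_on_poly_jet)
    then show ?thesis by (simp only: BF_linear continuous_on_\<rho> continuous_on_poly_jet)
  qed
  also have "\<dots> = 0"
  proof (cases "l = 1 \<and> k \<ge> 2")
    case True
    then show ?thesis using PF_\<rho>_1_id[of q] q by simp
  next
    \<comment> \<open>Either \<open>l = 2\<close>, where \<open>q\<close> has degree at most
      \<open>k + 2\<close>, or \<open>k = l = 1\<close>, where it has degree at most 2. In both
      cases the correction itself annihilates \<open>q\<close>.\<close>
    case False
    then have "degree q \<le> k + l" using q l by (cases "k = 1") auto
    then show ?thesis by (simp add: \<rho>_poly_jet_zero BF_def)
  qed
  finally show ?thesis .
qed

text \<open>Bramble-Hilbert property of the local form, stated for jets so that \<open>K\<close> is
  independent of the mesh. Orders up to 2 suffice as \<open>l \<le> 2\<close>. The window 2 is the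
  window 3/2 of the second correction plus the half shift to a neighbour.\<close>

definition bounds_const_form :: "nat \<Rightarrow> nat \<Rightarrow> real \<Rightarrow> bool" where
  "bounds_const_form l n K \<longleftrightarrow> K \<ge> 0 \<and> (\<forall>J p eps. (\<forall>j\<le>2. cts (J j)) \<longrightarrow> degree p \<le> n \<longrightarrow>
     (\<forall>j\<le>2. \<forall>t. \<bar>t\<bar> \<le> 2 \<longrightarrow> \<bar>J j t - poly_jet p j t\<bar> \<le> eps) \<longrightarrow> \<bar>const_form l J\<bar> \<le> K * eps)"

lemma bounds_const_form_mono:
  assumes "bounds_const_form l n K" "K \<le> K'"
  shows "bounds_const_form l n K'"
  unfolding bounds_const_form_def
proof (intro conjI allI impI)
  show "K' \<ge> 0" using assms by (simp add: bounds_const_form_def)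
  fix J p eps
  assume J: "\<forall>j\<le>2. cts (J j)" "degree p \<le> n"
    "\<forall>j\<le>2. \<forall>t. \<bar>t\<bar> \<le> 2 \<longrightarrow> \<bar>J j t - poly_jet p j t\<bar> \<le> eps"
  have "\<bar>J 0 0 - poly_jet p 0 0\<bar> \<le> eps" using J(3) by simp
  then have "eps \<ge> 0" by linarith
  have "\<bar>const_form l J\<bar> \<le> K * eps" using assms(1) J unfolding bounds_const_form_def by blast
  also have "\<dots> \<le> K' * eps" using assms(2) \<open>eps \<ge> 0\<close> by (rule mult_right_mono)
  finally show "\<bar>const_form l J\<bar> \<le> K' * eps" .
qed

lemma const_form_remainder_bound:
  assumes l: "l \<in> {1..min k 2}"
  shows "\<exists>K. bounds_const_form l (min (2 * k + 1) (k + 3)) K"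
proof -
  obtain K0 where K0: "K0 \<ge> 0"
    "\<And>J eps t. (\<forall>j\<le>l. cts (J j)) \<Longrightarrow>
     (\<forall>j\<le>l. \<forall>t. \<bar>t\<bar> \<le> real (Suc l) / 2 \<longrightarrow> \<bar>J j t\<bar> \<le> eps) \<Longrightarrow> \<bar>t\<bar> \<le> 1/2 \<Longrightarrow> \<bar>\<rho> l J t\<bar> \<le> K0 * eps"
    using \<rho>_bound[of l] by metis
  obtain K1 where K1: "K1 \<ge> 0"
    "\<And>a b w eps. cts a \<Longrightarrow> cts b \<Longrightarrow> cts w \<Longrightarrow>
      (\<And>t. \<bar>t\<bar> \<le> 1/2 \<Longrightarrow> \<bar>a t\<bar> \<le> eps \<and> \<bar>b t\<bar> \<le> eps \<and> \<bar>w t\<bar> \<le> eps) \<Longrightarrow> \<bar>BF a b w 1\<bar> \<le> K1 * eps"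
    using BF_bound by blast
  show ?thesis
    unfolding bounds_const_form_def
  proof (intro exI[of _ "K1 * K0"] conjI allI impI)
    show "K1 * K0 \<ge> 0" using K0 K1 by simp
    fix J p eps
    assume c: "\<forall>j\<le>2. cts (J j)" and p: "degree p \<le> min (2 * k + 1) (k + 3)"
      and bd: "\<forall>j\<le>2. \<forall>t. \<bar>t\<bar> \<le> 2 \<longrightarrow> \<bar>J j t - poly_jet p j t\<bar> \<le> eps"
    \<comment> \<open>Deviation from the polynomial jet: by linearity and annihilation the form
      takes the same value on it as on \<open>J\<close>.\<close>
    define D where "D j t = (-1) * poly_jet p j t + J j t" for j t
    have l2: "l \<le> 2" "real (Suc l) / 2 \<le> 3/2" using l by auto
    have cD: "cts (D j)" if "j \<le> l" for j
      unfolding D_def using that l2 c by (intro continuous_intros continuous_on_poly_jet) simp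
    have bD: "\<bar>D j t\<bar> \<le> eps" if "j \<le> l" "\<bar>t\<bar> \<le> 2" for j t
      using bd that l2 by (simp add: D_def)
    have "const_form l D = (-1) * const_form l (poly_jet p) + const_form l J"
      unfolding D_def by (rule const_form_linear) (use c l2 in auto)
    then have "const_form l J = const_form l D" using const_form_poly_jet_zero[OF l p] by simp
    also have "\<bar>\<dots>\<bar> \<le> K1 * (K0 * eps)"
      unfolding const_form_def
    proof (intro K1 conjI)
      fix t :: real assume "\<bar>t\<bar> \<le> 1/2"
      then show "\<bar>\<rho> l (\<lambda>i t. D i (t - 1/2)) t\<bar> \<le> K0 * eps" "\<bar>\<rho> l (\<lambda>i t. D i (t + 1/2)) t\<bar> \<le> K0 * eps"
        "\<bar>\<rho> l D t\<bar> \<le> K0 * eps"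
        by (intro K0 allI impI continuous_on_shift cD bD; use l2 in \<open>auto simp: abs_le_iff\<close>)+
    qed (intro continuous_on_\<rho> continuous_on_shift cD; simp)+
    finally show "\<bar>const_form l J\<bar> \<le> K1 * K0 * eps" by (simp add: mult.assoc)
  qed
qed

end

section \<open>Regularity of periodic Sobolev functions\<close>

lemma LBINT_continuous:
  fixes f :: "real \<Rightarrow> real"
  assumes "continuous_on {c..d} f"
  shows "(LBINT x:{c..d}. f x) = integral {c..d} f"
  by (intro set_borel_integral_eq_integral borel_integrable_atLeastAtMost' assms)

lemma L2_fun_set_integrable:
  assumes "g \<in> L2_fun a b"
  shows "set_integrable lborel {a..b} g"
proof -
  have m [measurable]: "g \<in> borel_measurable lborel" and s: "set_integrable lborel {a..b} (\<lambda>x. (g x)\<^sup>2)"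
    using assms by (auto simp: L2_fun_def)
  have "set_integrable lborel {a..b} (\<lambda>x. 1 + (g x)\<^sup>2)"
    by (intro set_integral_add s borel_integrable_atLeastAtMost' continuous_intros)
  then show ?thesis
  proof (rule set_integrable_bound)
    show "set_borel_measurable lborel {a..b} g" unfolding set_borel_measurable_def by measurable
    have "\<bar>g x\<bar> \<le> 1 + (g x)\<^sup>2" for x
    proof -
      have "0 \<le> (\<bar>g x\<bar> - 1)\<^sup>2" by simp
      then have "2 * \<bar>g x\<bar> \<le> 1 + (g x)\<^sup>2" unfolding power2_diff by simp
      then show ?thesis by linarith
    qed
    moreover have "\<bar>1 + (g x)\<^sup>2\<bar> = 1 + (g x)\<^sup>2" for x by (rule abs_of_nonneg) simp
    ultimately show "AE x in lborel. x \<in> {a..b} \<longrightarrow> norm (g x) \<le> norm (1 + (g x)\<^sup>2)" by simp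
  qed
qed

section \<open>Periodic functions, the circle and trigonometric test functions\<close>

locale torus =
  fixes a b :: real
  assumes ab: "a < b"
begin

definition periodic :: "(real \<Rightarrow> real) \<Rightarrow> bool" where
  "periodic f \<longleftrightarrow> (\<forall>x. f (x + (b - a)) = f x)"

lemma periodic_iff: "periodic_fun_simple f (b - a) \<longleftrightarrow> periodic f"
  by (simp add: periodic_fun_simple_def periodic_def)

lemma periodic_of_int: "periodic f \<Longrightarrow> f (x + of_int n * (b - a)) = f x"
proof -
  assume "periodic f"
  then interpret periodic_fun_simple f "b - a" by (simp add: periodic_iff)
  show ?thesis by (rule plus_of_int)
qed

lemma shift_into_period: obtains n :: int where "x + of_int n * (b - a) \<in> {a..b}"
proof
  let ?n = "\<lfloor>(x - a) / (b - a)\<rfloor>"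
  have "of_int ?n * (b - a) \<le> x - a"
    by (subst pos_le_divide_eq[symmetric]) (use ab in linarith)+
  moreover have "x - a \<le> (of_int ?n + 1) * (b - a)"
    by (subst pos_divide_le_eq[symmetric]) (use ab in linarith)+
  ultimately show "x + of_int (- ?n) * (b - a) \<in> {a..b}" by (simp add: algebra_simps)
qed

text \<open>The derivative relations at \<open>x\<close> and at \<open>x + (b - a)\<close> are
  equivalent, so \<open>deriv\<close> selects the same value at both, also where no derivative
  exists.\<close>

lemma periodic_deriv: "periodic f \<Longrightarrow> periodic (deriv f)"
proof -
  assume "periodic f"
  then have "f = (\<lambda>x. f (x + (b - a)))" by (simp add: periodic_def)
  then have "(f has_field_derivative D) (at x) \<longleftrightarrow> (f has_field_derivative D) (at (x + (b - a)))" for D x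
    by (subst DERIV_shift) simp
  then show ?thesis by (simp add: periodic_def deriv_def)
qed

lemma periodic_deriv_funpow: "periodic f \<Longrightarrow> periodic ((deriv ^^ n) f)"
  by (induction n) (simp_all add: periodic_deriv)

text \<open>Winds the line around the unit circle, one turn per period. Real polynomials in
  \<open>\<gamma>\<close> are the trigonometric polynomials, which supply a dense set of test
  functions.\<close>

definition \<gamma> :: "real \<Rightarrow> complex" where
  "\<gamma> x = cis (2 * pi / (b - a) * (x - a))"

lemma \<gamma>_eq_iff: "\<gamma> x = \<gamma> y \<longleftrightarrow> (\<exists>n::int. x = y + of_int n * (b - a))"
proof -
  have "\<gamma> x = \<gamma> y \<longleftrightarrow> (\<exists>n::int. 2 * pi / (b - a) * (x - a) = 2 * pi / (b - a) * (y - a) + 2 * pi * of_int n)"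
    unfolding \<gamma>_def using sin_cos_eq_iff[of "2 * pi / (b - a) * (x - a)" "2 * pi / (b - a) * (y - a)"]
    by (auto simp: complex_eq_iff)
  also have "\<dots> \<longleftrightarrow> (\<exists>n::int. x = y + of_int n * (b - a))"
  proof -
    have "2 * pi / (b - a) * (x - a) = 2 * pi / (b - a) * (y - a) + 2 * pi * of_int n \<longleftrightarrow> x = y + of_int n * (b - a)" for n
    proof -
      have "2 * pi / (b - a) * (x - a) = 2 * pi / (b - a) * (y - a) + 2 * pi * of_int n \<longleftrightarrow>
        2 * pi * (x - a) = 2 * pi * ((y - a) + of_int n * (b - a))"
        using ab by (simp add: field_simps)
      also have "\<dots> \<longleftrightarrow> x - a = (y - a) + of_int n * (b - a)"
        by (subst mult_cancel_left) simp
      finally show ?thesis by (auto simp: algebra_simps)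
    qed
    then show ?thesis by simp
  qed
  finally show ?thesis .
qed

lemma \<gamma>_shift: "\<gamma> (x + (b - a)) = \<gamma> x"
  unfolding \<gamma>_eq_iff by (intro exI[of _ 1]) simp

lemma continuous_on_\<gamma>: "continuous_on S \<gamma>"
  unfolding \<gamma>_def by (intro continuous_intros)

lemma \<gamma>_in_image: "\<gamma> x \<in> \<gamma> ` {a..b}"
proof -
  obtain n where n: "x + of_int n * (b - a) \<in> {a..b}" by (rule shift_into_period)
  have "\<gamma> x = \<gamma> (x + of_int n * (b - a))"
    unfolding \<gamma>_eq_iff by (intro exI[of _ "-n"]) simp
  then show ?thesis using n by blast
qed

text \<open>\<open>\<gamma>\<close> exhibits the circle as the quotient of \<open>[a, b]\<close> identifying the end points.\<close>

lemma factor_through_\<gamma>: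
  fixes H :: "real \<Rightarrow> real"
  assumes H: "continuous_on {a..b} H" "H a = H b"
  obtains f where "continuous_on (\<gamma> ` {a..b}) f" "\<And>x. x \<in> {a..b} \<Longrightarrow> f (\<gamma> x) = H x"
proof -
  have eq: "H x = H y" if "x \<in> {a..b}" "y \<in> {a..b}" "\<gamma> x = \<gamma> y" for x y
  proof -
    obtain n :: int where n: "x = y + of_int n * (b - a)" using \<open>\<gamma> x = \<gamma> y\<close> \<gamma>_eq_iff by auto
    \<comment> \<open>Two points of one closed period with equal image are at most one period apart,
      so the end points are the only distinct points identified.\<close>
    have "\<bar>of_int n * (b - a)\<bar> \<le> 1 * (b - a)" using that n by (auto simp: abs_le_iff)
    then have "\<bar>of_int n :: real\<bar> \<le> 1" using ab by (simp add: abs_mult)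
    then consider "n = 0" | "n = 1" | "n = -1" by linarith
    then show ?thesis
    proof cases
      case 1
      then show ?thesis using n by simp
    next
      case 2
      then have "x = b" "y = a" using n that by auto
      then show ?thesis using H by simp
    next
      case 3
      then have "x = a" "y = b" using n that by auto
      then show ?thesis using H by simp
    qed
  qed
  define f where "f z = H (SOME x. x \<in> {a..b} \<and> \<gamma> x = z)" for z
  have f: "f (\<gamma> x) = H x" if "x \<in> {a..b}" for x
  proof -
    have "(SOME y. y \<in> {a..b} \<and> \<gamma> y = \<gamma> x) \<in> {a..b} \<and> \<gamma> (SOME y. y \<in> {a..b} \<and> \<gamma> y = \<gamma> x) = \<gamma> x"
      by (rule someI[of _ x]) (use that in auto)
    then show ?thesis unfolding f_def using eq that by metis
  qed
  have "continuous_on (\<gamma> ` {a..b}) f"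
    unfolding continuous_openin_preimage_eq
  proof (intro allI impI)
    fix U :: "real set" assume U: "open U"
    let ?T = "\<gamma> ` {a..b}"
    have "{a..b} \<inter> \<gamma> -` (?T \<inter> f -` U) = {a..b} \<inter> H -` U"
      by (intro set_eqI) (auto simp: f \<gamma>_in_image simp del: image_eqI image_iff)
    moreover have "openin (top_of_set {a..b}) ({a..b} \<inter> H -` U)"
      using H(1) U continuous_openin_preimage_eq by blast
    \<comment> \<open>On a compact interval the continuous map \<open>\<gamma>\<close> is a quotient
      map onto its image, so openness may be checked for the preimage in
      \<open>[a, b]\<close>.\<close>
    ultimately show "openin (top_of_set ?T) (?T \<inter> f -` U)"
      using Abstract_Topology_2.continuous_imp_quotient_map[OF continuous_on_\<gamma> refl compact_Icc, of "?T \<inter> f -` U" a b] by simp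
  qed
  then show thesis using f that by blast
qed

lemma periodic_extension:
  fixes H :: "real \<Rightarrow> real"
  assumes "continuous_on {a..b} H" "H a = H b"
  obtains F where "cts F" "periodic F" "\<And>x. x \<in> {a..b} \<Longrightarrow> F x = H x"
proof -
  obtain f where f: "continuous_on (\<gamma> ` {a..b}) f" "\<And>x. x \<in> {a..b} \<Longrightarrow> f (\<gamma> x) = H x"
    using factor_through_\<gamma>[OF assms] by blast
  show thesis
  proof (rule that[of "\<lambda>x. f (\<gamma> x)"])
    show "cts (\<lambda>x. f (\<gamma> x))"
      by (rule continuous_on_compose2[OF f(1) continuous_on_\<gamma>]) (use \<gamma>_in_image in blast)
  qed (auto simp: f periodic_def \<gamma>_shift)
qed

text \<open>The derivative of \<open>\<gamma>\<close> is a constant multiple of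
  \<open>\<gamma>\<close>, hence linear in it. Polynomials in \<open>\<gamma>\<close> are therefore
  closed under differentiation, which gives derivatives of all orders.\<close>

lemma real_polynomial_function_\<gamma>_deriv:
  assumes "real_polynomial_function p"
  shows "\<exists>q. real_polynomial_function q \<and> (\<forall>x. ((\<lambda>x. p (\<gamma> x)) has_real_derivative q (\<gamma> x)) (at x))"
  using assms
proof induction
  case (linear f)
  let ?c = "\<i> * of_real (2 * pi / (b - a))"
  have \<gamma>': "(\<gamma> has_vector_derivative ?c * \<gamma> x) (at x)" for x
  proof -
    have "((\<lambda>z. exp (\<i> * (of_real (2 * pi / (b - a)) * (z - of_real a)))) has_field_derivative
        ?c * exp (\<i> * (of_real (2 * pi / (b - a)) * (of_real x - of_real a)))) (at (of_real x))"
      using ab by (auto intro!: derivative_eq_intros)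
    from has_vector_derivative_real_field[OF this] show ?thesis
      by (simp add: \<gamma>_def[abs_def] cis_conv_exp)
  qed
  have "((\<lambda>x. f (\<gamma> x)) has_real_derivative f (?c * \<gamma> x)) (at x)" for x
    using bounded_linear.has_vector_derivative[OF linear \<gamma>'[of x]]
    by (simp add: has_real_derivative_iff_has_vector_derivative)
  moreover have "real_polynomial_function (\<lambda>z. f (?c * z))"
    by (intro real_polynomial_function.intros(1) bounded_linear_compose[OF linear] bounded_linear_mult_right)
  ultimately show ?case by blast
next
  case (const c)
  show ?case by (intro exI[of _ "\<lambda>_. 0"]) auto
next
  case (add f g)
  then obtain f' g' where *: "real_polynomial_function f'" "real_polynomial_function g'"
    "\<And>x. ((\<lambda>x. f (\<gamma> x)) has_real_derivative f' (\<gamma> x)) (at x)"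
    "\<And>x. ((\<lambda>x. g (\<gamma> x)) has_real_derivative g' (\<gamma> x)) (at x)" by blast
  show ?case
    by (intro exI[of _ "\<lambda>z. f' z + g' z"] conjI allI real_polynomial_function.intros(3) *(1,2) DERIV_add *(3,4))
next
  case (mult f g)
  then obtain f' g' where *: "real_polynomial_function f'" "real_polynomial_function g'"
    "\<And>x. ((\<lambda>x. f (\<gamma> x)) has_real_derivative f' (\<gamma> x)) (at x)"
    "\<And>x. ((\<lambda>x. g (\<gamma> x)) has_real_derivative g' (\<gamma> x)) (at x)" by blast
  show ?case
    by (intro exI[of _ "\<lambda>z. f' z * g z + g' z * f z"] conjI allI real_polynomial_function.intros(3)
        real_polynomial_function.intros(4) *(1,2) mult DERIV_mult *(3,4))
qed

lemma real_polynomial_function_\<gamma>_test: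
  assumes "real_polynomial_function p"
  shows "(\<lambda>x. p (\<gamma> x)) \<in> periodic_test_funs a b"
proof -
  have "\<exists>q. real_polynomial_function q \<and> (deriv ^^ n) (\<lambda>x. p (\<gamma> x)) = (\<lambda>x. q (\<gamma> x))" for n
  proof (induction n)
    case (Suc n)
    then obtain q where q: "real_polynomial_function q" "(deriv ^^ n) (\<lambda>x. p (\<gamma> x)) = (\<lambda>x. q (\<gamma> x))" by blast
    obtain r where r: "real_polynomial_function r" "\<And>x. ((\<lambda>x. q (\<gamma> x)) has_real_derivative r (\<gamma> x)) (at x)"
      using real_polynomial_function_\<gamma>_deriv[OF q(1)] by blast
    then have "deriv (\<lambda>x. q (\<gamma> x)) = (\<lambda>x. r (\<gamma> x))" using DERIV_imp_deriv by blast
    then show ?case using q r by auto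
  qed (use assms in auto)
  then have "(deriv ^^ n) (\<lambda>x. p (\<gamma> x)) differentiable_on UNIV" for n
    using real_polynomial_function_\<gamma>_deriv
    by (metis differentiable_on_def differentiable_at_withinI real_differentiable_def)
  then show ?thesis by (simp add: periodic_test_funs_def periodic_iff periodic_def \<gamma>_shift)
qed

lemma test_funs_D:
  assumes "\<psi> \<in> periodic_test_funs a b"
  shows "periodic \<psi>" "\<And>n x. ((deriv ^^ n) \<psi> has_real_derivative (deriv ^^ Suc n) \<psi> x) (at x)"
    "\<And>n. continuous_on S ((deriv ^^ n) \<psi>)" "deriv \<psi> \<in> periodic_test_funs a b"
proof -
  show p: "periodic \<psi>" using assms by (simp add: periodic_test_funs_def periodic_iff)
  have d: "(deriv ^^ n) \<psi> differentiable_on UNIV" for n using assms by (simp add: periodic_test_funs_def)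
  show "((deriv ^^ n) \<psi> has_real_derivative (deriv ^^ Suc n) \<psi> x) (at x)" for n x
    using d[of n] by (simp add: differentiable_on_def DERIV_deriv_iff_real_differentiable)
  show "continuous_on S ((deriv ^^ n) \<psi>)" for n
    using differentiable_imp_continuous_on[OF d] continuous_on_subset by blast
  show "deriv \<psi> \<in> periodic_test_funs a b"
    using periodic_deriv[OF p] d[of "Suc n" for n]
    by (simp add: periodic_test_funs_def periodic_iff funpow_Suc_right del: funpow.simps)
qed

lemma test_funs_I:
  assumes "periodic \<psi>" "\<And>x. (\<psi> has_real_derivative \<psi>' x) (at x)" "\<psi>' \<in> periodic_test_funs a b"
  shows "\<psi> \<in> periodic_test_funs a b"
proof -
  have d: "deriv \<psi> = \<psi>'" using assms(2) DERIV_imp_deriv by blast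
  have "(deriv ^^ n) \<psi> differentiable_on UNIV" for n
  proof (cases n)
    case 0
    then show ?thesis using assms(2)
      by (auto simp: differentiable_on_def real_differentiable_def intro: differentiable_at_withinI)
  next
    case (Suc m)
    then have "(deriv ^^ n) \<psi> = (deriv ^^ m) \<psi>'" using d by (simp add: funpow_Suc_right del: funpow.simps)
    then show ?thesis using assms(3) by (simp add: periodic_test_funs_def)
  qed
  then show ?thesis using assms(1) by (simp add: periodic_test_funs_def periodic_iff)
qed

section \<open>Periodic primitives and the classical form of a Sobolev function\<close>

lemma periodic_primitive:
  assumes c: "cts f" and p: "periodic f" and i: "integral {a..b} f = 0"
  obtains F where "\<And>x. (F has_real_derivative f x) (at x)" "periodic F" "integral {a..b} F = 0"
proof -
  have "\<exists>F. \<forall>x::real. -\<infinity> < ereal x \<longrightarrow> ereal x < \<infinity> \<longrightarrow> (F has_vector_derivative f x) (at x)"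
    by (rule einterval_antiderivative) (use c in \<open>auto simp: continuous_on_eq_continuous_at\<close>)
  then obtain F0 where F0: "\<And>x. (F0 has_real_derivative f x) (at x)"
    by (auto simp: has_real_derivative_iff_has_vector_derivative)
  have cF: "continuous_on S F0" for S
    by (rule DERIV_imp_continuous_on[OF F0])
  have "((\<lambda>x. F0 (x + (b - a)) - F0 x) has_real_derivative 0) (at x)" for x
  proof -
    have "((\<lambda>x. F0 (x + (b - a))) has_real_derivative f (x + (b - a))) (at x)"
      using F0 by (simp flip: DERIV_shift)
    from DERIV_diff[OF this F0[of x]] show ?thesis using p by (simp add: periodic_def)
  qed
  then have const: "F0 (x + (b - a)) - F0 x = F0 (a + (b - a)) - F0 a" for x
    using DERIV_isconst_all by blast
  have "(f has_integral F0 b - F0 a) {a..b}"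
    using ab F0 by (intro has_integral_DERIV) auto
  then have "F0 b = F0 a" using i by (simp add: integral_unique)
  then have per: "F0 (x + (b - a)) = F0 x" for x using const[of x] by simp
  show thesis
  \<comment> \<open>Subtracting the mean keeps the primitive periodic and makes it again a function
    with a periodic primitive, so the construction can be iterated.\<close>
  proof (rule that[of "\<lambda>x. F0 x - integral {a..b} F0 / (b - a)"])
    show "((\<lambda>x. F0 x - integral {a..b} F0 / (b - a)) has_real_derivative f x) (at x)" for x
      using DERIV_diff[OF F0[of x] DERIV_const] by simp
    show "periodic (\<lambda>x. F0 x - integral {a..b} F0 / (b - a))" using per by (simp add: periodic_def)
    show "integral {a..b} (\<lambda>x. F0 x - integral {a..b} F0 / (b - a)) = 0"
      using ab integral_const_real[of "integral {a..b} F0 / (b - a)" a b]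
      by (subst integral_diff) (auto intro!: integrable_continuous_real cF)
  qed
qed

lemma integral_by_parts_periodic:
  assumes "\<And>x. (F has_real_derivative f x) (at x)" "\<And>x. (G has_real_derivative g x) (at x)"
    "periodic F" "periodic G" "continuous_on {a..b} f" "continuous_on {a..b} g"
  shows "integral {a..b} (\<lambda>x. F x * g x) = - integral {a..b} (\<lambda>x. f x * G x)"
proof -
  have c: "continuous_on {a..b} F" "continuous_on {a..b} G"
    using assms(1,2) DERIV_imp_continuous_on by blast+
  have "((\<lambda>x. f x * G x + F x * g x) has_integral F b * G b - F a * G a) {a..b}"
    using ab by (intro has_integral_DERIV) (auto intro!: derivative_eq_intros assms(1,2))
  moreover have "F b = F a" "G b = G a"
    using assms(3,4) by (auto simp: periodic_def dest: spec[of _ a])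
  ultimately have "integral {a..b} (\<lambda>x. f x * G x + F x * g x) = 0" by (simp add: integral_unique)
  then show ?thesis
    by (subst (asm) integral_add) (auto intro!: integrable_continuous_real continuous_intros c assms)
qed

text \<open>A nonzero mean is the only obstruction to a periodic primitive. Thus the weak identity,
  stated for derivatives of test functions, reaches every mean-free test function.\<close>

lemma test_fun_iterated_primitive:
  assumes "\<eta> \<in> periodic_test_funs a b" "integral {a..b} \<eta> = 0"
  shows "\<exists>\<psi> \<in> periodic_test_funs a b. (deriv ^^ n) \<psi> = \<eta> \<and> integral {a..b} \<psi> = 0"
proof (induction n)
  case 0
  then show ?case using assms by auto
next
  case (Suc n)
  then obtain \<psi> where \<psi>: "\<psi> \<in> periodic_test_funs a b" "(deriv ^^ n) \<psi> = \<eta>" "integral {a..b} \<psi> = 0" by blast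
  obtain F where F: "\<And>x. (F has_real_derivative \<psi> x) (at x)" "periodic F" "integral {a..b} F = 0"
    by (rule periodic_primitive[of \<psi>]) (use test_funs_D[OF \<psi>(1)] test_funs_D(3)[OF \<psi>(1), of _ 0] \<psi>(3) in auto)
  have "deriv F = \<psi>" using F(1) DERIV_imp_deriv by blast
  then have "(deriv ^^ Suc n) F = \<eta>" using \<psi>(2) by (simp add: funpow_Suc_right del: funpow.simps)
  then show ?case using test_funs_I[OF F(2,1) \<psi>(1)] F(3) by blast
qed

text \<open>Carries the weak identity along with the classical derivatives, because boundary terms
  vanish by periodicity. It builds the classical candidate with which a Sobolev function is
  compared.\<close>

lemma iterated_primitive:
  assumes "cts f" "periodic f" "integral {a..b} f = 0"
  shows "\<exists>G. cts G \<and> periodic G \<and> integral {a..b} G = 0 \<and>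
    (\<forall>j<n. \<forall>x. ((deriv ^^ j) G has_real_derivative (deriv ^^ Suc j) G x) (at x)) \<and> (deriv ^^ n) G = f \<and>
    (\<forall>\<psi> \<in> periodic_test_funs a b.
       integral {a..b} (\<lambda>x. G x * (deriv ^^ n) \<psi> x) = (-1) ^ n * integral {a..b} (\<lambda>x. f x * \<psi> x))"
proof (induction n)
  case 0
  then show ?case using assms by auto
next
  case (Suc n)
  then obtain G where G: "cts G" "periodic G" "integral {a..b} G = 0"
    "\<And>j x. j < n \<Longrightarrow> ((deriv ^^ j) G has_real_derivative (deriv ^^ Suc j) G x) (at x)" "(deriv ^^ n) G = f"
    "\<And>\<psi>. \<psi> \<in> periodic_test_funs a b \<Longrightarrow>
       integral {a..b} (\<lambda>x. G x * (deriv ^^ n) \<psi> x) = (-1) ^ n * integral {a..b} (\<lambda>x. f x * \<psi> x)"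
    by blast
  obtain F where F: "\<And>x. (F has_real_derivative G x) (at x)" "periodic F" "integral {a..b} F = 0"
    using periodic_primitive[OF G(1-3)] by blast
  have dF: "deriv F = G" using F(1) DERIV_imp_deriv by blast
  have dF': "(deriv ^^ Suc j) F = (deriv ^^ j) G" for j
    using dF by (simp add: funpow_Suc_right del: funpow.simps)
  have "((deriv ^^ j) F has_real_derivative (deriv ^^ Suc j) F x) (at x)" if "j < Suc n" for j x
  proof (cases j)
    case 0
    then show ?thesis using F(1) dF by simp
  next
    case (Suc i)
    then show ?thesis using G(4)[of i x] that unfolding Suc dF' by simp
  qed
  moreover have "integral {a..b} (\<lambda>x. F x * (deriv ^^ Suc n) \<psi> x) = (-1) ^ Suc n * integral {a..b} (\<lambda>x. f x * \<psi> x)"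
    if "\<psi> \<in> periodic_test_funs a b" for \<psi>
  proof -
    have "integral {a..b} (\<lambda>x. F x * (deriv ^^ Suc n) \<psi> x) = - integral {a..b} (\<lambda>x. G x * (deriv ^^ n) \<psi> x)"
      by (intro integral_by_parts_periodic F test_funs_D[OF that] continuous_on_subset[OF G(1)]
          periodic_deriv_funpow) auto
    then show ?thesis using G(6)[OF that] by simp
  qed
  moreover have "cts F" by (rule DERIV_imp_continuous_on[OF F(1)])
  ultimately show ?case using F dF' G(5) by (intro exI[of _ F]) blast
qed

text \<open>A periodic du Bois-Reymond lemma. The mean-free part \<open>e0\<close> of
  \<open>e\<close> is uniformly close to a trigonometric polynomial by Stone-Weierstrass, and
  orthogonality replaces the integral of \<open>e0^2\<close> by that of \<open>e0\<close> times the
  approximation error.\<close>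

lemma orthogonal_to_test_funs_imp_const:
  assumes c: "cts e" and p: "periodic e"
    and orth: "\<And>\<eta>. \<eta> \<in> periodic_test_funs a b \<Longrightarrow> integral {a..b} \<eta> = 0 \<Longrightarrow> integral {a..b} (\<lambda>x. e x * \<eta> x) = 0"
  obtains c where "\<And>x. e x = c"
proof -
  define L where "L = b - a"
  have L: "L > 0" using ab by (simp add: L_def)
  define m where "m = integral {a..b} e / L"
  define e0 where "e0 x = e x - m" for x
  have c0: "cts e0" unfolding e0_def by (intro continuous_intros c)
  have p0: "periodic e0" using p by (simp add: periodic_def e0_def)
  have i: "f integrable_on {a..b}" if "cts f" for f :: "real \<Rightarrow> real"
    by (intro integrable_continuous_real continuous_on_subset[OF that]) auto
  obtain M where M: "\<And>x. x \<in> {a..b} \<Longrightarrow> \<bar>e0 x\<bar> \<le> M"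
  proof -
    have "bounded (e0 ` {a..b})"
      by (intro compact_imp_bounded compact_continuous_image continuous_on_subset[OF c0]) auto
    then obtain M where "\<forall>y\<in>e0 ` {a..b}. norm y \<le> M" unfolding bounded_iff by blast
    then show thesis using that[of M] by auto
  qed
  have M0: "M \<ge> 0" using M[of a] ab by auto
  have mean0: "integral {a..b} e0 = 0"
    using L integral_const_real[of m a b] ab unfolding e0_def
    by (subst integral_diff) (auto intro!: i c simp: m_def L_def)
  have approx: "integral {a..b} (\<lambda>x. (e0 x)\<^sup>2) \<le> 2 * M * L * \<delta>" if \<delta>: "\<delta> > 0" for \<delta>
  proof -
    obtain f where f: "continuous_on (\<gamma> ` {a..b}) f" "\<And>x. x \<in> {a..b} \<Longrightarrow> f (\<gamma> x) = e0 x"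
      using factor_through_\<gamma>[of e0] continuous_on_subset[OF c0] spec[OF p0[unfolded periodic_def], of a]
      by (metis add_diff_cancel_left' diff_add_cancel add.commute subset_UNIV)
    obtain g where g: "real_polynomial_function g" "\<And>z. z \<in> \<gamma> ` {a..b} \<Longrightarrow> \<bar>f z - g z\<bar> < \<delta>"
      using Stone_Weierstrass_real_polynomial_function[OF _ f(1) \<delta>] compact_continuous_image[OF continuous_on_\<gamma> compact_Icc]
      by blast
    have cg: "cts (\<lambda>x. g (\<gamma> x))"
      using test_funs_D(3)[OF real_polynomial_function_\<gamma>_test[OF g(1)], of _ 0] by simp
    define r where "r = integral {a..b} (\<lambda>x. g (\<gamma> x)) / L"
    \<comment> \<open>Orthogonality is available for mean-free test functions only. Centring the
      approximant moves it by at most another \<open>\<delta>\<close>, since \<open>e0\<close> is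
      itself mean-free.\<close>
    define \<eta> where "\<eta> x = g (\<gamma> x) + (- r)" for x
    have \<eta>: "\<eta> \<in> periodic_test_funs a b"
      unfolding \<eta>_def by (rule real_polynomial_function_\<gamma>_test) (intro real_polynomial_function.intros g)
    have c\<eta>: "cts \<eta>" unfolding \<eta>_def by (intro continuous_intros cg)
    have \<eta>0: "integral {a..b} \<eta> = 0"
      using L integral_const_real[of "-r" a b] ab unfolding \<eta>_def
      by (subst integral_add) (auto intro!: i cg simp: r_def L_def)
    have close: "\<bar>e0 x - g (\<gamma> x)\<bar> \<le> \<delta>" if "x \<in> {a..b}" for x
      using g(2)[of "\<gamma> x"] f(2)[OF that] that by (simp add: less_imp_le)
    have "\<bar>integral {a..b} (\<lambda>x. e0 x - g (\<gamma> x))\<bar> \<le> \<delta> * L"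
      unfolding L_def using ab close by (intro abs_integral_le continuous_intros c0 cg) auto
    also have "integral {a..b} (\<lambda>x. e0 x - g (\<gamma> x)) = - (r * L)"
      using L mean0 by (subst integral_diff) (auto intro!: i c0 cg simp: r_def)
    finally have "\<bar>r\<bar> \<le> \<delta>" using L by (simp add: abs_mult)
    then have close': "\<bar>e0 x - \<eta> x\<bar> \<le> 2 * \<delta>" if "x \<in> {a..b}" for x
      using close[OF that] by (simp add: \<eta>_def)
    have o: "integral {a..b} (\<lambda>x. e0 x * \<eta> x) = 0"
    proof -
      have "integral {a..b} (\<lambda>x. e0 x * \<eta> x) = integral {a..b} (\<lambda>x. e x * \<eta> x - m * \<eta> x)"
        by (simp add: e0_def algebra_simps)
      also have "\<dots> = integral {a..b} (\<lambda>x. e x * \<eta> x) - integral {a..b} (\<lambda>x. m * \<eta> x)"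
        by (intro integral_diff i continuous_intros c c\<eta>)
      finally show ?thesis using orth[OF \<eta> \<eta>0] \<eta>0 by simp
    qed
    have "integral {a..b} (\<lambda>x. (e0 x)\<^sup>2) = integral {a..b} (\<lambda>x. e0 x * (e0 x - \<eta> x)) + integral {a..b} (\<lambda>x. e0 x * \<eta> x)"
      by (subst integral_add[symmetric])
        (auto intro!: i continuous_intros c0 c\<eta> simp: power2_eq_square algebra_simps)
    also have "\<dots> \<le> M * (2 * \<delta>) * L"
    proof -
      have "\<bar>e0 x * (e0 x - \<eta> x)\<bar> \<le> M * (2 * \<delta>)" if "x \<in> {a..b}" for x
        unfolding abs_mult using M[OF that] close'[OF that] M0 by (intro mult_mono) auto
      then have "\<bar>integral {a..b} (\<lambda>x. e0 x * (e0 x - \<eta> x))\<bar> \<le> M * (2 * \<delta>) * L"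
        unfolding L_def using ab by (intro abs_integral_le continuous_intros c0 c\<eta>) auto
      then show ?thesis using o by linarith
    qed
    finally show ?thesis by (simp add: algebra_simps)
  qed
  have "integral {a..b} (\<lambda>x. (e0 x)\<^sup>2) \<le> 0"
  proof (rule field_le_epsilon)
    fix eps :: real assume "eps > 0"
    \<comment> \<open>The added 1 keeps the denominator positive when \<open>M = 0\<close>.\<close>
    have "2 * M * L * (eps / (2 * M * L + 1)) \<le> eps"
    proof -
      have "0 < 2 * M * L + 1" using M0 L by (simp add: add_nonneg_pos)
      then have "2 * M * L / (2 * M * L + 1) \<le> 1" by (subst pos_divide_le_eq) auto
      then have "eps * (2 * M * L / (2 * M * L + 1)) \<le> eps * 1"
        using \<open>eps > 0\<close> by (intro mult_left_mono) auto
      then show ?thesis by (simp add: mult.commute)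
    qed
    moreover have "eps / (2 * M * L + 1) > 0" using M0 L \<open>eps > 0\<close> by (simp add: add_nonneg_pos)
    ultimately show "integral {a..b} (\<lambda>x. (e0 x)\<^sup>2) \<le> 0 + eps" using approx by fastforce
  qed
  moreover have "integral {a..b} (\<lambda>x. (e0 x)\<^sup>2) \<ge> 0"
    by (intro integral_nonneg i continuous_intros c0) auto
  ultimately have "integral {a..b} (\<lambda>x. (e0 x)\<^sup>2) = 0" by simp
  then have z: "\<forall>x\<in>{a..b}. (e0 x)\<^sup>2 = 0"
    by (subst (asm) integral_eq_0_iff) (auto intro!: continuous_intros continuous_on_subset[OF c0] simp: ab)
  have "e x = m" for x
  proof -
    obtain n :: int where "x + of_int n * (b - a) \<in> {a..b}" by (rule shift_into_period)
    then have "e0 (x + of_int n * (b - a)) = 0" using z by simp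
    then show ?thesis using periodic_of_int[OF p0] by (simp add: e0_def)
  qed
  then show thesis by (rule that)
qed

text \<open>The density \<open>g\<close> is merely integrable, so integration by parts is done by
  Fubini on the triangle \<open>t \<le> x\<close>. The inner integral of \<open>\<psi>'\<close> is
  \<open>\<psi> b - \<psi> t\<close>, and the term with \<open>\<psi> b\<close> drops out because
  \<open>g\<close> has mean zero.\<close>

lemma indefinite_integral_by_parts:
  assumes g: "set_integrable lborel {a..b} g" and g0: "(LBINT x:{a..b}. g x) = 0"
    and \<psi>: "\<And>x. (\<psi> has_real_derivative \<psi>' x) (at x)" and c: "cts \<psi>'"
  shows "(LBINT x:{a..b}. integral {a..x} g * \<psi>' x) = - (LBINT x:{a..b}. g x * \<psi> x)"
proof -
  have sub: "set_integrable lborel {c..d} g" if "a \<le> c" "d \<le> b" for c d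
    by (rule set_integrable_subset[OF g]) (use that in auto)
  define f where "f t x = indicator {a..b} x * indicator {a..b} t * (if t \<le> x then g t * \<psi>' x else 0)" for t x :: real
  define G where "G t = indicator {a..b} t * g t" for t
  have Gi: "integrable lborel G" using g by (simp add: set_integrable_def G_def[abs_def])
  define P where "P x = indicator {a..b} x * \<psi>' x" for x
  have Pi: "integrable lborel P"
    using borel_integrable_atLeastAtMost'[OF continuous_on_subset[OF c], of a b]
    by (simp add: set_integrable_def P_def[abs_def])
  have f_eq: "f t x = (if t \<le> x then G t * P x else 0)" for t x by (simp add: f_def G_def P_def)
  have [measurable]: "G \<in> borel_measurable lborel" "P \<in> borel_measurable lborel"
    using Gi Pi by auto
  have int: "integrable (lborel \<Otimes>\<^sub>M lborel) (\<lambda>(t, x). f t x)"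
  \<comment> \<open>Restriction to the triangle is dominated by the product \<open>G t * P x\<close>
    of two integrable functions.\<close>
  proof (rule Bochner_Integration.integrable_bound)
    show "integrable (lborel \<Otimes>\<^sub>M lborel) (\<lambda>(t, x). G t * P x)"
    proof (rule lborel_pair.Fubini_integrable)
      have "integrable lborel (\<lambda>t. \<bar>G t\<bar> * (LBINT x. \<bar>P x\<bar>))"
        using Gi by (intro integrable_mult_left integrable_abs)
      then show "integrable lborel (\<lambda>t. LBINT x. norm (case (t, x) of (t, x) \<Rightarrow> G t * P x))"
        by (simp add: abs_mult)
    qed (use Pi in auto)
  qed (auto simp: f_eq)
  have left: "(LBINT t. f t x) = indicator {a..b} x * (integral {a..x} g * \<psi>' x)" for x
  proof (cases "x \<in> {a..b}")
    case True
    have "(LBINT t. f t x) = (LBINT t. (indicator {a..x} t *\<^sub>R g t) * \<psi>' x)"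
      using True by (intro Bochner_Integration.integral_cong) (auto simp: f_def split: split_indicator)
    also have "\<dots> = (LBINT t:{a..x}. g t) * \<psi>' x" by (simp add: set_lebesgue_integral_def)
    also have "(LBINT t:{a..x}. g t) = integral {a..x} g"
      using True by (intro set_borel_integral_eq_integral sub) auto
    finally show ?thesis using True by simp
  qed (simp add: f_def)
  have right: "(LBINT x. f t x) = indicator {a..b} t * (g t * (\<psi> b - \<psi> t))" for t
  proof (cases "t \<in> {a..b}")
    case True
    have "(LBINT x. f t x) = (LBINT x. g t * (indicator {t..b} x *\<^sub>R \<psi>' x))"
      using True by (intro Bochner_Integration.integral_cong) (auto simp: f_def split: split_indicator)
    also have "\<dots> = g t * (LBINT x:{t..b}. \<psi>' x)" by (simp add: set_lebesgue_integral_def)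
    also have "(LBINT x:{t..b}. \<psi>' x) = integral {t..b} \<psi>'"
      by (intro LBINT_continuous continuous_on_subset[OF c]) auto
    also have "\<dots> = \<psi> b - \<psi> t"
      using True \<psi> by (intro integral_unique has_integral_DERIV) auto
    finally show ?thesis using True by simp
  qed (simp add: f_def)
  have "(LBINT x:{a..b}. integral {a..x} g * \<psi>' x) = (LBINT x. LBINT t. f t x)"
    by (simp add: left set_lebesgue_integral_def)
  also have "\<dots> = (LBINT t. LBINT x. f t x)"
    by (rule lborel_pair.Fubini_integral[OF int])
  also have "\<dots> = (LBINT t:{a..b}. g t * (\<psi> b - \<psi> t))"
    by (simp add: right set_lebesgue_integral_def)
  also have "\<dots> = (LBINT t:{a..b}. \<psi> b * g t - g t * \<psi> t)"
    by (simp add: algebra_simps)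
  also have "\<dots> = (LBINT t:{a..b}. \<psi> b * g t) - (LBINT t:{a..b}. g t * \<psi> t)"
  proof (intro set_integral_diff)
    show "set_integrable lborel {a..b} (\<lambda>t. \<psi> b * g t)" using g by simp
    have c\<psi>: "continuous_on {a..b} \<psi>"
      by (rule DERIV_imp_continuous_on[OF \<psi>])
    obtain K where K: "\<forall>y\<in>\<psi> ` {a..b}. norm y \<le> K"
      using compact_imp_bounded[OF compact_continuous_image[OF c\<psi> compact_Icc]] unfolding bounded_iff by blast
    have m\<psi>: "set_borel_measurable lborel {a..b} \<psi>"
      using borel_integrable_atLeastAtMost'[OF c\<psi>] by (auto simp: set_integrable_def set_borel_measurable_def)
    show "set_integrable lborel {a..b} (\<lambda>t. g t * \<psi> t)"
    proof (rule set_integrable_bound)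
      show "set_integrable lborel {a..b} (\<lambda>t. K * g t)" using g by simp
      have "(\<lambda>x. G x * (indicator {a..b} x *\<^sub>R \<psi> x)) \<in> borel_measurable lborel"
        using m\<psi> unfolding set_borel_measurable_def by (intro borel_measurable_times) auto
      then show "set_borel_measurable lborel {a..b} (\<lambda>t. g t * \<psi> t)"
        unfolding set_borel_measurable_def
        by (rule measurable_cong[THEN iffD1, rotated]) (auto simp: G_def split: split_indicator)
      show "AE x in lborel. x \<in> {a..b} \<longrightarrow> norm (g x * \<psi> x) \<le> norm (K * g x)"
      proof (intro always_eventually allI impI)
        fix x assume "x \<in> {a..b}"
        then have "\<bar>\<psi> x\<bar> \<le> \<bar>K\<bar>" using K by force
        then show "norm (g x * \<psi> x) \<le> norm (K * g x)"
          unfolding real_norm_def abs_mult by (subst mult.commute) (rule mult_right_mono, simp_all)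
      qed
    qed
  qed
  finally show ?thesis using g0 by simp
qed

text \<open>The weak derivative \<open>g\<close> of order \<open>s + 1\<close> is integrated to a
  periodic continuous function and that one \<open>s\<close> more times. The result \<open>G\<close>
  satisfies the same weak identity as \<open>u\<close>, so \<open>u - G\<close> is orthogonal to all
  mean-free test functions and hence constant; continuity of \<open>u\<close> makes this hold at
  every point.\<close>

theorem sobolev_space_regularity:
  assumes u: "u \<in> sobolev_space a b (Suc s)" and cu: "cts u"
  obtains g where "g \<in> L2_fun a b" "L2_norm a b g \<le> sobolev_norm a b (Suc s) u"
    "\<And>j x. j < s \<Longrightarrow> ((deriv ^^ j) u has_real_derivative (deriv ^^ Suc j) u x) (at x)"
    "cts ((deriv ^^ s) u)"
    "\<And>x y. a \<le> x \<Longrightarrow> x \<le> y \<Longrightarrow> y \<le> b \<Longrightarrow> (deriv ^^ s) u y - (deriv ^^ s) u x = (LBINT t:{x..y}. g t)"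
proof -
  \<comment> \<open>The same choice as in \<open>sobolev_norm\<close>, so the norm of
    \<open>g\<close> is literally one of its summands.\<close>
  define w where "w j = (SOME g. g \<in> L2_fun a b \<and> weak_derivative a b j u g)" for j
  have w: "w j \<in> L2_fun a b \<and> weak_derivative a b j u (w j)" if "j \<le> Suc s" for j
  proof -
    have "\<exists>g. g \<in> L2_fun a b \<and> weak_derivative a b j u g"
      using u that by (auto simp: sobolev_space_def)
    from someI_ex[OF this] show ?thesis by (simp add: w_def)
  qed
  define g where "g = w (Suc s)"
  have g: "g \<in> L2_fun a b" "weak_derivative a b (Suc s) u g" using w[of "Suc s"] by (auto simp: g_def)
  have gi: "set_integrable lborel {a..b} g" by (rule L2_fun_set_integrable[OF g(1)])
  have gn: "L2_norm a b g \<le> sobolev_norm a b (Suc s) u"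
  proof -
    have "(L2_norm a b g)\<^sup>2 \<le> (\<Sum>j\<le>Suc s. (L2_norm a b (w j))\<^sup>2)"
      unfolding g_def by (rule member_le_sum) auto
    then show ?thesis unfolding sobolev_norm_def w_def[symmetric] by (rule real_le_rsqrt)
  qed
  have weak: "(LBINT x:{a..b}. u x * (deriv ^^ Suc s) \<psi> x) = (-1) ^ Suc s * (LBINT x:{a..b}. g x * \<psi> x)"
    if "\<psi> \<in> periodic_test_funs a b" for \<psi>
    using g(2) that by (auto simp: weak_derivative_def)
  have pu: "periodic u" using u by (simp add: sobolev_space_def periodic_iff)
  \<comment> \<open>Testing with 1 shows that \<open>g\<close> has mean zero; this closes up its
    indefinite integral \<open>H\<close> at the end points.\<close>
  have one: "(\<lambda>x. 1) \<in> periodic_test_funs a b"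
    using real_polynomial_function_\<gamma>_test[OF real_polynomial_function.intros(2)[of 1]] .
  have g0: "(LBINT x:{a..b}. g x) = 0"
  proof -
    have "deriv (\<lambda>x. 1) = (\<lambda>x::real. 0::real)" by auto
    moreover have "(deriv ^^ j) (\<lambda>x. 0) = (\<lambda>x::real. 0::real)" for j by (induction j) auto
    ultimately have "(deriv ^^ Suc s) (\<lambda>x. 1) = (\<lambda>x::real. 0::real)"
      by (simp add: funpow_Suc_right del: funpow.simps)
    then show ?thesis using weak[OF one] by simp
  qed
  define H where "H x = integral {a..x} g" for x
  have gHK: "g integrable_on {a..b}" by (rule set_borel_integral_eq_integral(1)[OF gi])
  have cH: "continuous_on {a..b} H" unfolding H_def by (rule indefinite_integral_continuous_1[OF gHK])
  have "H a = H b" using g0 set_borel_integral_eq_integral(2)[OF gi] by (simp add: H_def)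
  then obtain F where F: "cts F" "periodic F" "\<And>x. x \<in> {a..b} \<Longrightarrow> F x = H x"
    using periodic_extension[OF cH] by blast
  \<comment> \<open>\<open>F\<close> is determined up to a constant; centring it admits further
    periodic primitives.\<close>
  define m where "m = integral {a..b} F / (b - a)"
  define F1 where "F1 x = F x - m" for x
  have F1: "cts F1" "periodic F1" "integral {a..b} F1 = 0"
  proof -
    show "cts F1" unfolding F1_def by (intro continuous_intros F)
    show "periodic F1" using F(2) by (simp add: F1_def periodic_def)
    show "integral {a..b} F1 = 0"
      using ab integral_const_real[of m a b] unfolding F1_def
      by (subst integral_diff) (auto intro!: integrable_continuous_real continuous_on_subset[OF F(1)] simp: m_def)
  qed
  obtain G where G: "cts G" "periodic G"
    "\<And>j x. j < s \<Longrightarrow> ((deriv ^^ j) G has_real_derivative (deriv ^^ Suc j) G x) (at x)" "(deriv ^^ s) G = F1"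
    "\<And>\<psi>. \<psi> \<in> periodic_test_funs a b \<Longrightarrow>
       integral {a..b} (\<lambda>x. G x * (deriv ^^ s) \<psi> x) = (-1) ^ s * integral {a..b} (\<lambda>x. F1 x * \<psi> x)"
    using iterated_primitive[OF F1, of s] by blast
  have F1_weak: "integral {a..b} (\<lambda>x. F1 x * deriv \<psi> x) = - (LBINT x:{a..b}. g x * \<psi> x)"
    if \<psi>: "\<psi> \<in> periodic_test_funs a b" for \<psi>
  proof -
    note D = test_funs_D(2)[OF \<psi>, of 0, simplified] and C = test_funs_D(3)[OF \<psi>, of _ 1, simplified]
    have "(deriv \<psi> has_integral \<psi> b - \<psi> a) {a..b}"
      using ab D by (intro has_integral_DERIV) auto
    moreover have "\<psi> b = \<psi> a" using test_funs_D(1)[OF \<psi>] by (auto simp: periodic_def dest: spec[of _ a])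
    ultimately have d0: "integral {a..b} (deriv \<psi>) = 0" by (simp add: integral_unique)
    have "integral {a..b} (\<lambda>x. F1 x * deriv \<psi> x) = integral {a..b} (\<lambda>x. F x * deriv \<psi> x - m * deriv \<psi> x)"
      by (simp add: F1_def algebra_simps)
    also have "\<dots> = integral {a..b} (\<lambda>x. F x * deriv \<psi> x) - integral {a..b} (\<lambda>x. m * deriv \<psi> x)"
      by (intro integral_diff integrable_continuous_real continuous_intros continuous_on_subset[OF F(1)] C) auto
    also have "\<dots> = integral {a..b} (\<lambda>x. H x * deriv \<psi> x)"
    proof -
      have "integral {a..b} (\<lambda>x. F x * deriv \<psi> x) = integral {a..b} (\<lambda>x. H x * deriv \<psi> x)"
        by (rule integral_cong) (simp add: F(3))
      then show ?thesis using d0 by simp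
    qed
    also have "\<dots> = (LBINT x:{a..b}. H x * deriv \<psi> x)"
      by (intro LBINT_continuous[symmetric] continuous_intros cH C)
    also have "\<dots> = - (LBINT x:{a..b}. g x * \<psi> x)"
      unfolding H_def by (rule indefinite_integral_by_parts[OF gi g0 D C])
    finally show ?thesis .
  qed
  have orth: "integral {a..b} (\<lambda>x. (u x - G x) * \<eta> x) = 0"
    if \<eta>: "\<eta> \<in> periodic_test_funs a b" "integral {a..b} \<eta> = 0" for \<eta>
  proof -
    obtain \<psi> where \<psi>: "\<psi> \<in> periodic_test_funs a b" "(deriv ^^ Suc s) \<psi> = \<eta>"
      using test_fun_iterated_primitive[OF \<eta>, of "Suc s"] by blast
    have c\<eta>: "continuous_on {a..b} \<eta>" using test_funs_D(3)[OF \<eta>(1), of _ 0] by simp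
    have "integral {a..b} (\<lambda>x. u x * \<eta> x) = (-1) ^ Suc s * (LBINT x:{a..b}. g x * \<psi> x)"
    proof -
      have "(LBINT x:{a..b}. u x * \<eta> x) = integral {a..b} (\<lambda>x. u x * \<eta> x)"
        by (intro LBINT_continuous continuous_intros continuous_on_subset[OF cu] c\<eta>) auto
      then show ?thesis using weak[OF \<psi>(1)] unfolding \<psi>(2) by simp
    qed
    moreover have "integral {a..b} (\<lambda>x. G x * \<eta> x) = (-1) ^ Suc s * (LBINT x:{a..b}. g x * \<psi> x)"
      using G(5)[OF test_funs_D(4)[OF \<psi>(1)]] F1_weak[OF \<psi>(1)] \<psi>(2)
      by (simp add: funpow_Suc_right del: funpow.simps)
    moreover have "integral {a..b} (\<lambda>x. (u x - G x) * \<eta> x) = integral {a..b} (\<lambda>x. u x * \<eta> x) - integral {a..b} (\<lambda>x. G x * \<eta> x)"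
      unfolding left_diff_distrib
      by (intro integral_diff integrable_continuous_real continuous_intros continuous_on_subset[OF cu]
          continuous_on_subset[OF G(1)] c\<eta>) auto
    ultimately show ?thesis by simp
  qed
  obtain c where c: "\<And>x. u x - G x = c"
    by (rule orthogonal_to_test_funs_imp_const[of "\<lambda>x. u x - G x"])
      (use orth pu G(1,2) cu in \<open>auto intro!: continuous_intros simp: periodic_def\<close>)
  \<comment> \<open>The constant \<open>c\<close> is visible at order 0 and disappears after one
    differentiation.\<close>
  have du: "(deriv ^^ j) u = (\<lambda>x. (deriv ^^ j) G x + (if j = 0 then c else 0))" if "j \<le> s" for j
    using that
  proof (induction j)
    case 0
    then show ?case using c by (auto simp: algebra_simps)
  next
    case (Suc j)
    have "((deriv ^^ j) u has_real_derivative (deriv ^^ Suc j) G x) (at x)" for x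
      using DERIV_add[OF G(3)[of j x] DERIV_const] Suc by simp
    then show ?case using DERIV_imp_deriv by fastforce
  qed
  show thesis
  proof (rule that[OF g(1) gn])
    fix j x assume "j < s"
    then show "((deriv ^^ j) u has_real_derivative (deriv ^^ Suc j) u x) (at x)"
      using DERIV_add[OF G(3)[of j x] DERIV_const] du[of j] du[of "Suc j"] by simp
  next
    show "cts ((deriv ^^ s) u)"
      using du[of s] G(4) F1(1) by (auto intro!: continuous_intros)
  next
    fix x y assume xy: "a \<le> x" "x \<le> y" "y \<le> b"
    have "(deriv ^^ s) u y - (deriv ^^ s) u x = H y - H x"
      using du[of s] G(4) F(3) xy by (simp add: F1_def)
    also have "\<dots> = integral {x..y} g"
      using xy Henstock_Kurzweil_Integration.integral_combine[of a x y g] integrable_on_subinterval[OF gHK, of a y]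
      by (simp add: H_def)
    also have "\<dots> = (LBINT t:{x..y}. g t)"
      by (intro set_borel_integral_eq_integral(2)[symmetric] set_integrable_subset[OF gi]) (use xy in auto)
    finally show "(deriv ^^ s) u y - (deriv ^^ s) u x = (LBINT t:{x..y}. g t)" .
  qed
qed

end

section \<open>Transport to the mesh\<close>

lemma poly_with_jet: "\<exists>p :: real poly. degree p \<le> n \<and> (\<forall>j\<le>n. poly_jet p j 0 = y j)"
proof -
  define p where "p = (\<Sum>i\<le>n. monom (y i / fact i) i)"
  have "degree p \<le> n"
    unfolding p_def by (intro degree_sum_le) (auto intro: order.trans[OF degree_monom_le])
  moreover have "poly_jet p j 0 = y j" if "j \<le> n" for j
  proof -
    have "coeff p j = y j / fact j"
      using that by (simp add: p_def coeff_sum coeff_monom sum.delta)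
    moreover have "poly_jet p j 0 = fact j * coeff p j"
      using coeff_higher_pderiv[of j p 0] by (simp add: poly_jet_def poly_0_coeff_0 pochhammer_fact)
    ultimately show ?thesis by simp
  qed
  ultimately show ?thesis by blast
qed

lemma poly_jet_degree_const:
  assumes "degree p \<le> n"
  shows "poly_jet p n t = poly_jet p n 0"
proof -
  have "degree ((pderiv ^^ n) p) = 0" using assms by (simp add: degree_higher_pderiv)
  then obtain c where "(pderiv ^^ n) p = [:c:]" by (rule degree_eq_zeroE)
  then show ?thesis by (simp add: poly_jet_def)
qed

text \<open>The mean value inequality on \<open>[-2, 2]\<close>, applied from order \<open>n\<close>
  downwards. Each order costs a factor 2, the distance from the centre to the ends of the
  window.\<close>

lemma vanishing_jet_bound:
  fixes D :: "nat \<Rightarrow> real \<Rightarrow> real"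
  assumes d: "\<And>j t. j < n \<Longrightarrow> (D j has_real_derivative D (Suc j) t) (at t)"
    and z: "\<And>j. j < n \<Longrightarrow> D j 0 = 0"
    and top: "\<And>t. \<bar>t\<bar> \<le> 2 \<Longrightarrow> \<bar>D n t\<bar> \<le> eps"
    and "j \<le> n" "\<bar>t\<bar> \<le> 2"
  shows "\<bar>D j t\<bar> \<le> 2 ^ n * eps"
proof -
  have e: "0 \<le> eps" using top[of 0] by auto
  have "\<forall>t. \<bar>t\<bar> \<le> 2 \<longrightarrow> \<bar>D j t\<bar> \<le> 2 ^ (n - j) * eps"
    using \<open>j \<le> n\<close>
  proof (induction j rule: inc_induct)
    case base
    then show ?case using top by simp
  next
    case (step j)
    show ?case
    proof (intro allI impI)
      fix t :: real assume t: "\<bar>t\<bar> \<le> 2"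
      have "norm (D j t - D j 0) \<le> 2 ^ (n - Suc j) * eps * norm (t - 0)"
      proof (rule field_differentiable_bound[of "{-2..2}"])
        show "(D j has_field_derivative D (Suc j) s) (at s within {-2..2})" for s
          using d[OF step(2)] by (rule has_field_derivative_at_within)
        show "norm (D (Suc j) s) \<le> 2 ^ (n - Suc j) * eps" if "s \<in> {-2..2}" for s
          using step.IH that by (auto simp: abs_le_iff)
      qed (use t in \<open>auto simp: abs_le_iff\<close>)
      also have "\<dots> \<le> 2 ^ (n - Suc j) * eps * 2"
        using t e by (intro mult_left_mono) auto
      also have "\<dots> = 2 ^ (n - j) * eps"
        using step(2) by (simp add: Suc_diff_Suc[symmetric])
      finally show "\<bar>D j t\<bar> \<le> 2 ^ (n - j) * eps" using z[OF step(2)] by simp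
    qed
  qed
  then have "\<bar>D j t\<bar> \<le> 2 ^ (n - j) * eps" using \<open>\<bar>t\<bar> \<le> 2\<close> by blast
  also have "\<dots> \<le> 2 ^ n * eps" using e by (intro mult_right_mono power_increasing) auto
  finally show ?thesis .
qed

lemma set_integral_abs_squared_le:
  fixes g :: "real \<Rightarrow> real"
  assumes g: "set_integrable lborel {c..d} g" "set_integrable lborel {c..d} (\<lambda>x. (g x)\<^sup>2)" and "c < d"
  shows "(LBINT x:{c..d}. \<bar>g x\<bar>)\<^sup>2 \<le> (d - c) * (LBINT x:{c..d}. (g x)\<^sup>2)"
proof -
  define I where "I = (LBINT x:{c..d}. \<bar>g x\<bar>)"
  \<comment> \<open>The average of \<open>\<bar>g\<bar>\<close> minimises the integral of
    \<open>(\<bar>g\<bar> - m)^2\<close>; its nonnegativity at this \<open>m\<close> is the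
    Cauchy-Schwarz inequality against 1.\<close>
  define m where "m = I / (d - c)"
  have i: "set_integrable lborel {c..d} (\<lambda>x. \<bar>g x\<bar>)" by (rule set_integrable_abs[OF g(1)])
  have k: "set_integrable lborel {c..d} (\<lambda>x. m\<^sup>2)" by (intro borel_integrable_atLeastAtMost' continuous_intros)
  have "0 \<le> (LBINT x:{c..d}. (\<bar>g x\<bar> - m)\<^sup>2)"
    unfolding set_lebesgue_integral_def by (intro Bochner_Integration.integral_nonneg) auto
  also have "(\<lambda>x. (\<bar>g x\<bar> - m)\<^sup>2) = (\<lambda>x. ((g x)\<^sup>2 - (2 * m) * \<bar>g x\<bar>) + m\<^sup>2)"
    by (auto simp: power2_diff)
  also have "(LBINT x:{c..d}. ((g x)\<^sup>2 - (2 * m) * \<bar>g x\<bar>) + m\<^sup>2)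
    = ((LBINT x:{c..d}. (g x)\<^sup>2) - (2 * m) * I) + (LBINT x:{c..d}. m\<^sup>2)"
    unfolding I_def using g i k by (subst set_integral_add(2) set_integral_diff(2); simp)+
  also have "(LBINT x:{c..d}. m\<^sup>2) = m\<^sup>2 * (d - c)"
    using LBINT_continuous[of c d "\<lambda>x. m\<^sup>2"] \<open>c < d\<close> by (simp add: mult.commute)
  finally have *: "0 \<le> (LBINT x:{c..d}. (g x)\<^sup>2) - 2 * m * I + m\<^sup>2 * (d - c)" .
  have "m * (d - c) = I" using \<open>c < d\<close> by (simp add: m_def)
  then have "0 \<le> (d - c) * (LBINT x:{c..d}. (g x)\<^sup>2) - I\<^sup>2"
    using mult_left_mono[OF *, of "d - c"] \<open>c < d\<close> by (simp add: algebra_simps power2_eq_square)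
  then show ?thesis by (simp add: I_def)
qed

lemma sum_int_shift_periodic:
  fixes f :: "int \<Rightarrow> real"
  assumes "\<And>i. f (i + int N) = f i"
  shows "(\<Sum>i = 1..int N. f (i + d)) = (\<Sum>i = 1..int N. f i)"
proof -
  have step: "(\<Sum>i = 1..int N. f (i + (d + 1))) = (\<Sum>i = 1..int N. f (i + d))" for d
  proof -
    have "(\<Sum>i = 1..int N. f (i + (d + 1))) = (\<Sum>i = 2..int N + 1. f (i + d))"
      by (rule sum.reindex_bij_witness[of _ "\<lambda>i. i - 1" "\<lambda>i. i + 1"]) (auto simp: algebra_simps)
    also have "\<dots> = (\<Sum>i = 1..int N. f (i + d))"
    proof (cases "N = 0")
      case False
      then have 1: "{2..int N + 1} = insert (int N + 1) {2..int N}" "{1..int N} = insert 1 {2..int N}" by auto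
      have "f (int N + 1 + d) = f (1 + d)" using assms[of "1 + d"] by (simp add: algebra_simps)
      then show ?thesis unfolding 1 by simp
    qed simp
    finally show ?thesis .
  qed
  show ?thesis
  proof (induction d rule: int_induct[of _ 0])
    case (step1 d)
    then show ?case using step[of d] by simp
  next
    case (step2 d)
    then show ?case using step[of "d - 1"] by simp
  qed simp
qed

section \<open>Mesh geometry and functions in local coordinates\<close>

locale cdg_mesh = cdg a b N k CFL + torus a b + reference_cell k CFL
  for a b :: real and N k :: nat and CFL :: real +
  assumes N_pos: "N \<ge> 1"
begin

declare \<rho>.simps(2) [simp del]

lemma h_pos: "h > 0"
  using ab N_pos by (simp add: h_def)

lemma N_h: "real N * h = b - a"
  using N_pos by (simp add: h_def)

lemma node_add: "node (r + d) = node r + h * d"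
  by (simp add: node_def algebra_simps)

lemma node_diff: "node (r - d) = node r + h * (- d)"
  by (simp add: node_def algebra_simps)

lemma node_half: "node (1/2) = a"
  by (simp add: node_def)

lemma node_period: "node (r + real N) = node r + (b - a)"
  using N_h by (simp add: node_add mult.commute)

lemma node_period':
  "node (of_int (i + int N) + s) + y = (node (of_int i + s) + y) + (b - a)"
  using node_period[of "of_int i + s"] by (simp add: algebra_simps)

lemma h_mult_le_iff: "h * s \<le> h * t \<longleftrightarrow> s \<le> t" and h_mult_less_iff: "h * s < h * t \<longleftrightarrow> s < t"
  using h_pos by simp_all

lemma in_cell_iff:
  "node r + h * t \<in> cell r \<longleftrightarrow> -1/2 \<le> t \<and> t \<le> 1/2"
  "node r + h * t \<in> {node (r - 1/2)..<node (r + 1/2)} \<longleftrightarrow> -1/2 \<le> t \<and> t < 1/2"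
  "node r + h * t \<in> {node (r - 1/2)<..<node (r + 1/2)} \<longleftrightarrow> -1/2 < t \<and> t < 1/2"
  unfolding cell_def atLeastAtMost_iff atLeastLessThan_iff greaterThanLessThan_iff node_add[of r "1/2"] node_diff
    add_le_cancel_left add_less_cancel_left h_mult_le_iff h_mult_less_iff by auto

text \<open>\<open>rep f r F\<close>: in the reference coordinate \<open>t = (x - x\<^sub>r)/h\<close>, \<open>f\<close> is given by \<open>F\<close> on the
  half-open cell with centre \<open>x\<^sub>r\<close>.\<close>

definition rep :: "(real \<Rightarrow> real) \<Rightarrow> real \<Rightarrow> (real \<Rightarrow> real) \<Rightarrow> bool" where
  "rep f r F \<longleftrightarrow> (\<forall>t. -1/2 \<le> t \<and> t < 1/2 \<longrightarrow> f (node r + h * t) = F t)"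

lemma repD: "rep f r F \<Longrightarrow> -1/2 \<le> t \<Longrightarrow> t < 1/2 \<Longrightarrow> f (node r + h * t) = F t"
  by (simp add: rep_def)

lemma cell_cover:
  obtains i :: int and t where "-1/2 \<le> t" "t < 1/2" "x = node (of_int i + s) + h * t"
proof (rule that)
  let ?i = "\<lfloor>(x - node (s - 1/2)) / h\<rfloor>"
  let ?t = "(x - node (s - 1/2)) / h - of_int ?i - 1/2"
  show "-1/2 \<le> ?t" "?t < 1/2" by linarith+
  show "x = node (of_int ?i + s) + h * ?t"
    using h_pos by (simp add: node_def field_simps)
qed

text \<open>The half-open cells of one mesh cover the line, so local pieces determine every value,
  including those at interfaces. This is the uniqueness that the definite descriptions in
  \<open>PC\<close>, \<open>PD\<close> and \<open>R\<close> require.\<close>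

lemma rep_unique:
  assumes "\<And>i. rep f (of_int i + s) (F i)" "\<And>i. rep g (of_int i + s) (F i)"
  shows "f = g"
proof
  fix x
  obtain i t where "-1/2 \<le> t" "t < 1/2" "x = node (of_int i + s) + h * t" by (rule cell_cover)
  then show "f x = g x" using repD[OF assms(1)] repD[OF assms(2)] by simp
qed

text \<open>The function with prescribed local pieces. The floor assigns an interface to the cell on
  its right, matching the right-continuous representatives in \<open>pw_poly\<close>.\<close>

definition glue :: "real \<Rightarrow> (int \<Rightarrow> real \<Rightarrow> real) \<Rightarrow> real \<Rightarrow> real" where
  "glue s F x = (let i = \<lfloor>(x - node (s - 1/2)) / h\<rfloor> in F i ((x - node (of_int i + s)) / h))"

lemma rep_glue: "rep (glue s F) (of_int i + s) (F i)"
  unfolding rep_def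
proof (intro allI impI)
  fix t :: real assume t: "-1/2 \<le> t \<and> t < 1/2"
  have "(node (of_int i + s) + h * t - node (s - 1/2)) / h = of_int i + (t + 1/2)"
    using h_pos by (simp add: node_def field_simps)
  then have "\<lfloor>(node (of_int i + s) + h * t - node (s - 1/2)) / h\<rfloor> = i"
    using t by (simp add: floor_eq_iff)
  then show "glue s F (node (of_int i + s) + h * t) = F i t"
    using h_pos by (simp add: glue_def Let_def)
qed

lemma periodic_glue:
  assumes "\<And>i. F (i + int N) = F i"
  shows "periodic (glue s F)"
  unfolding periodic_def
proof
  fix x
  obtain i t where x: "-1/2 \<le> t" "t < 1/2" "x = node (of_int i + s) + h * t" by (rule cell_cover)
  have "glue s F (x + (b - a)) = F (i + int N) t"
    unfolding x(3) node_period'[symmetric] by (rule repD[OF rep_glue x(1,2)])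
  moreover have "glue s F x = F i t"
    unfolding x(3) by (rule repD[OF rep_glue x(1,2)])
  ultimately show "glue s F (x + (b - a)) = glue s F x" using assms by simp
qed

lemma pw_poly_iff:
  "v \<in> pw_poly s n \<longleftrightarrow> periodic v \<and> (\<forall>i. \<exists>p. degree p \<le> n \<and> rep v (of_int i + s) (poly p))"
proof -
  have "(\<exists>p. degree p \<le> n \<and> (\<forall>x \<in> {node (r - 1/2)..<node (r + 1/2)}. v x = poly p x)) \<longleftrightarrow>
    (\<exists>p. degree p \<le> n \<and> rep v r (poly p))" (is "?A \<longleftrightarrow> ?B") for r
  proof
    assume ?A
    then obtain p where p: "degree p \<le> n" "\<forall>x \<in> {node (r - 1/2)..<node (r + 1/2)}. v x = poly p x" by blast
    have "v (node r + h * t) = poly (pcompose p [:node r, h:]) t" if "-1/2 \<le> t" "t < 1/2" for t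
    proof -
      have "node r + h * t \<in> {node (r - 1/2)..<node (r + 1/2)}"
        using that by (subst in_cell_iff) simp
      then show ?thesis using p(2) by (simp add: poly_pcompose mult.commute)
    qed
    moreover have "degree (pcompose p [:node r, h:]) \<le> n" using p(1) h_pos by (simp add: degree_pcompose)
    ultimately show ?B by (intro exI[of _ "pcompose p [:node r, h:]"]) (simp add: rep_def)
  next
    assume ?B
    then obtain p where p: "degree p \<le> n" "rep v r (poly p)" by blast
    have "v x = poly (pcompose p [:- node r / h, 1 / h:]) x" if "x \<in> {node (r - 1/2)..<node (r + 1/2)}" for x
    proof -
      define t where "t = (x - node r) / h"
      have x: "x = node r + h * t" using h_pos by (simp add: t_def)
      have "-1/2 \<le> t" "t < 1/2"
        using that unfolding x in_cell_iff by simp_all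
      then have "v x = poly p t" unfolding x by (rule repD[OF p(2)])
      then show ?thesis using h_pos by (simp add: poly_pcompose t_def field_simps)
    qed
    moreover have "degree (pcompose p [:- node r / h, 1 / h:]) \<le> n" using p(1) h_pos by (simp add: degree_pcompose)
    ultimately show ?A by blast
  qed
  then show ?thesis by (simp add: pw_poly_def periodic_iff)
qed

text \<open>Agreement inside the open interval is enough because end points are null sets, so
  half-open representations and derivatives inside a cell can be integrated over the closed
  cell.\<close>

lemma LBINT_transport:
  assumes c: "cts F"
    and eq: "\<And>t. \<alpha> < t \<Longrightarrow> t < \<beta> \<Longrightarrow> f (y + h * t) = F t"
  shows "(LBINT x:{y + h * \<alpha>..y + h * \<beta>}. f x) = h * integral {\<alpha>..\<beta>} F"
proof -
  have "(LBINT x:{y + h * \<alpha>..y + h * \<beta>}. f x) =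
      h * (LBINT t. indicator {y + h * \<alpha>..y + h * \<beta>} (y + h * t) * f (y + h * t))"
    unfolding set_lebesgue_integral_def
    using h_pos by (subst lborel_integral_real_affine[where c = h and t = y]) auto
  also have "(LBINT t. indicator {y + h * \<alpha>..y + h * \<beta>} (y + h * t) * f (y + h * t)) = (LBINT t. indicator {\<alpha>..\<beta>} t * F t)"
  proof (rule integral_discrete_difference[of "{\<alpha>, \<beta>}"])
    fix t assume "t \<notin> {\<alpha>, \<beta>}"
    then show "indicator {y + h * \<alpha>..y + h * \<beta>} (y + h * t) * f (y + h * t) = indicator {\<alpha>..\<beta>} t * F t"
      using eq[of t] h_pos by (auto simp: indicator_def mult_le_cancel_left_pos)
  qed auto
  also have "\<dots> = integral {\<alpha>..\<beta>} F"
    using LBINT_continuous[OF continuous_on_subset[OF c]] by (simp add: set_lebesgue_integral_def)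
  finally show ?thesis .
qed

text \<open>A function of the opposite mesh breaks at the cell centre. This is why the two halves
  carry separate continuous pieces.\<close>

lemma LBINT_cell:
  assumes c: "cts F" "cts G"
    and F: "\<And>t. -1/2 < t \<Longrightarrow> t < 0 \<Longrightarrow> f (node r + h * t) = F t"
    and G: "\<And>t. 0 < t \<Longrightarrow> t < 1/2 \<Longrightarrow> f (node r + h * t) = G t"
  shows "set_integrable lborel (cell r) f"
    "(LBINT x:cell r. f x) = h * (left_int F + right_int G)"
proof -
  define E where "E t = indicator {-1/2..0} t * F t + indicator {0..1/2} t * G t" for t :: real
  have i: "integrable lborel (\<lambda>t. indicator {-1/2..0} t * F t)" "integrable lborel (\<lambda>t. indicator {0..1/2} t * G t)"
    using borel_integrable_atLeastAtMost'[OF continuous_on_subset[OF c(1)], of "-1/2" 0]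
      borel_integrable_atLeastAtMost'[OF continuous_on_subset[OF c(2)], of 0 "1/2"]
    by (simp_all add: set_integrable_def)
  have E: "integrable lborel E" unfolding E_def using i by (rule Bochner_Integration.integrable_add)
  let ?f = "\<lambda>t. indicator (cell r) (node r + h * t) * f (node r + h * t)"
  have eq: "?f t = E t" if "t \<notin> {-1/2, 0, 1/2}" for t
  proof -
    show ?thesis using in_cell_iff(1)[of r t] that F[of t] G[of t] by (auto simp: indicator_def E_def)
  qed
  have f: "integrable lborel ?f \<longleftrightarrow> integrable lborel E"
    by (rule integrable_discrete_difference[of "{-1/2, 0, 1/2}"]) (use eq in auto)
  have "integrable lborel (\<lambda>x. indicator (cell r) x * f x)"
    using lborel_integrable_real_affine_iff[of h "\<lambda>x. indicator (cell r) x * f x" "node r"] f E h_pos by simp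
  then show "set_integrable lborel (cell r) f" by (simp add: set_integrable_def)
  have "(LBINT x:cell r. f x) = h * (LBINT t. ?f t)"
    unfolding set_lebesgue_integral_def
    using h_pos by (subst lborel_integral_real_affine[where c = h and t = "node r"]) auto
  also have "(LBINT t. ?f t) = (LBINT t. E t)"
    by (rule integral_discrete_difference[of "{-1/2, 0, 1/2}"]) (use eq in auto)
  also have "\<dots> = (LBINT t. indicator {-1/2..0} t * F t) + (LBINT t. indicator {0..1/2} t * G t)"
    unfolding E_def by (rule Bochner_Integration.integral_add[OF i])
  also have "\<dots> = left_int F + right_int G"
    using LBINT_continuous[OF continuous_on_subset[OF c(1)], of "-1/2" 0]
      LBINT_continuous[OF continuous_on_subset[OF c(2)], of 0 "1/2"]
    by (simp add: set_lebesgue_integral_def)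
  finally show "(LBINT x:cell r. f x) = h * (left_int F + right_int G)" .
qed

lemma LBINT_cell_rep:
  assumes "cts F" "rep f r F"
  shows "(LBINT x:cell r. f x) = h * mean F"
  using LBINT_cell(2)[OF assms(1) assms(1), of f r] repD[OF assms(2)] integral_halves[OF assms(1)]
  by (simp add: mean_def)

lemma rep_mult: "rep f r F \<Longrightarrow> rep g r G \<Longrightarrow> rep (\<lambda>x. f x * g x) r (\<lambda>t. F t * G t)"
  by (simp add: rep_def)

lemma rep_poly_deriv:
  assumes "rep \<phi> r (poly p)" "-1/2 < t" "t < 1/2"
  shows "deriv \<phi> (node r + h * t) = poly (pderiv p) t / h"
proof (rule DERIV_imp_deriv, rule has_field_derivative_transform_within_open)
  let ?S = "{node (r - 1/2)<..<node (r + 1/2)}"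
  show "((\<lambda>x. poly p ((x - node r) / h)) has_field_derivative poly (pderiv p) t / h) (at (node r + h * t))"
    using h_pos by (auto intro!: derivative_eq_intros)
  show "open ?S" by simp
  show "node r + h * t \<in> ?S" using assms(2,3) unfolding in_cell_iff by simp
  fix x assume x: "x \<in> ?S"
  define t' where "t' = (x - node r) / h"
  have x': "x = node r + h * t'" using h_pos by (simp add: t'_def)
  have "-1/2 \<le> t'" "t' < 1/2" using x unfolding x' in_cell_iff by simp_all
  then show "poly p ((x - node r) / h) = \<phi> x"
    using repD[OF assms(1)] x' h_pos by simp
qed

lemma rep_poly_Lim:
  assumes "rep \<phi> r (poly p)"
  shows "Lim (at_left (node (r + 1/2))) \<phi> = poly p (1/2)"
    "Lim (at_right (node (r - 1/2))) \<phi> = poly p (-1/2)"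
proof -
  let ?g = "\<lambda>x. poly p ((x - node r) / h)"
  have eq: "?g x = \<phi> x" if "x \<in> {node (r - 1/2)<..<node (r + 1/2)}" for x
  proof -
    define t where "t = (x - node r) / h"
    have x: "x = node r + h * t" using h_pos by (simp add: t_def)
    have "-1/2 \<le> t" "t < 1/2" using that unfolding x in_cell_iff by simp_all
    then show ?thesis using repD[OF assms] x h_pos by simp
  qed
  have lt: "node (r - 1/2) < node (r + 1/2)" using h_pos unfolding node_add node_diff by simp
  have "isCont ?g y" for y using h_pos by (intro continuous_intros) auto
  then have lim: "(?g \<longlongrightarrow> ?g y) (at y within S)" for y S
    unfolding continuous_at by (rule tendsto_within_subset) simp
  have "(\<phi> \<longlongrightarrow> ?g (node (r + 1/2))) (at_left (node (r + 1/2)))"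
    by (rule Lim_transform_eventually[OF lim])
      (use eq lt in \<open>auto simp: eventually_at_left intro!: exI[of _ "node (r - 1/2)"]\<close>)
  then show "Lim (at_left (node (r + 1/2))) \<phi> = poly p (1/2)"
    using h_pos by (subst tendsto_Lim) (auto simp: node_add)
  have "(\<phi> \<longlongrightarrow> ?g (node (r - 1/2))) (at_right (node (r - 1/2)))"
    by (rule Lim_transform_eventually[OF lim])
      (use eq lt in \<open>auto simp: eventually_at_right intro!: exI[of _ "node (r + 1/2)"]\<close>)
  then show "Lim (at_right (node (r - 1/2))) \<phi> = poly p (-1/2)"
    using h_pos by (subst tendsto_Lim) (auto simp: node_diff)
qed

text \<open>Scaling: \<open>\<tau>max\<close> and the derivative each contribute a factor
  \<open>1 / h\<close>, which cancels the factor \<open>h\<close> of the integral. Of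
  \<open>\<tau>max\<close> only \<open>CFL\<close> is left.\<close>

lemma P_form_rep:
  assumes c: "cts \<Omega>" and \<omega>: "rep \<omega> r \<Omega>" and \<phi>: "rep \<phi> r (poly p)"
  shows "P_form r \<omega> \<phi> = PF \<Omega> p"
proof -
  note [simp] = repD[OF \<phi>] rep_poly_deriv[OF \<phi>]
  have sl: "\<omega> (node r + h * t + h / 2) = \<Omega> (t + 1/2)" if "-1/2 < t" "t < 0" for t
    using repD[OF \<omega>, of "t + 1/2"] that by (simp add: algebra_simps)
  have sr: "\<omega> (node r + h * t - h / 2) = \<Omega> (t - 1/2)" if "0 < t" "t < 1/2" for t
    using repD[OF \<omega>, of "t - 1/2"] that by (simp add: algebra_simps)
  have dom: "{node (r - 1/2)..node r} = {node r + h * (-1/2)..node r + h * 0}"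
    "{node r..node (r + 1/2)} = {node r + h * 0..node r + h * (1/2)}"
    by (simp_all only: node_add node_diff) simp_all
  have 1: "(LBINT x:{node (r - 1/2)..node r}. (\<omega> (x + h/2) - \<omega> x) * \<phi> x)
      = h * left_int (\<lambda>t. (\<Omega> (t + 1/2) - \<Omega> t) * poly p t)"
    unfolding dom by (rule LBINT_transport)
      (auto intro!: continuous_intros continuous_on_shift c simp: sl repD[OF \<omega>])
  have 2: "(LBINT x:{node r..node (r + 1/2)}. (\<omega> (x - h/2) - \<omega> x) * \<phi> x)
      = h * right_int (\<lambda>t. (\<Omega> (t - 1/2) - \<Omega> t) * poly p t)"
    unfolding dom by (rule LBINT_transport)
      (auto intro!: continuous_intros continuous_on_shift c simp: sr repD[OF \<omega>])
  have 3: "(LBINT x:{node (r - 1/2)..node r}. \<omega> (x + h/2) * deriv \<phi> x)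
      = h * left_int (\<lambda>t. \<Omega> (t + 1/2) * poly (pderiv p) t / h)"
    unfolding dom by (rule LBINT_transport)
      (use h_pos in \<open>auto intro!: continuous_intros continuous_on_shift c simp: sl\<close>)
  have 4: "(LBINT x:{node r..node (r + 1/2)}. \<omega> (x - h/2) * deriv \<phi> x)
      = h * right_int (\<lambda>t. \<Omega> (t - 1/2) * poly (pderiv p) t / h)"
    unfolding dom by (rule LBINT_transport)
      (use h_pos in \<open>auto intro!: continuous_intros continuous_on_shift c simp: sr\<close>)
  have 5: "\<omega> (node r) = \<Omega> 0" using repD[OF \<omega>, of 0] by simp
  show ?thesis
    unfolding P_form_def 1 2 3 4 5 rep_poly_Lim[OF \<phi>] BF_def \<tau>max_def
    using h_pos C_pos by (simp add: field_simps)
qed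

text \<open>Common shape of \<open>Bhat\<close> and \<open>Btilde\<close>: \<open>v\<close> lives on
  the mesh of the cell, \<open>w\<close> on the opposite mesh. One local argument then serves
  both.\<close>

definition B_form :: "real \<Rightarrow> (real \<Rightarrow> real) \<Rightarrow> (real \<Rightarrow> real) \<Rightarrow> (real \<Rightarrow> real) \<Rightarrow> real" where
  "B_form r v w \<phi> = 1 / \<tau>max * (LBINT x:cell r. (w x - v x) * \<phi> x) + (LBINT x:cell r. w x * deriv \<phi> x)
     - w (node (r + 1/2)) * Lim (at_left (node (r + 1/2))) \<phi>
     + w (node (r - 1/2)) * Lim (at_right (node (r - 1/2))) \<phi>"

lemma Bhat_eq: "Bhat i w = B_form (of_int i) (fst w) (snd w)"
  by (simp add: fun_eq_iff Bhat_def B_form_def Let_def)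

lemma Btilde_eq: "Btilde i w = B_form (of_int i + 1/2) (snd w) (fst w)"
  by (simp add: fun_eq_iff Btilde_def B_form_def Let_def add.commute)

text \<open>The interfaces of the cell are the centres of the overlapping cells, so the flux values
  of \<open>w\<close> are \<open>A 0\<close> and \<open>B 0\<close>; the powers of \<open>h\<close>
  cancel as for the projection form.\<close>

lemma B_form_rep:
  assumes c: "cts A" "cts B" "cts \<Omega>"
    and A: "rep w (r - 1/2) A" and B: "rep w (r + 1/2) B" and \<Omega>: "rep v r \<Omega>" and \<phi>: "rep \<phi> r (poly p)"
  shows "B_form r v w \<phi> = BF A B \<Omega> p"
proof -
  note [simp] = repD[OF \<phi>] rep_poly_deriv[OF \<phi>] repD[OF \<Omega>]
  have sl: "w (node r + h * t) = A (t + 1/2)" if "-1/2 < t" "t < 0" for t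
    using repD[OF A, of "t + 1/2"] that by (simp add: node_diff algebra_simps)
  have sr: "w (node r + h * t) = B (t - 1/2)" if "0 < t" "t < 1/2" for t
    using repD[OF B, of "t - 1/2"] that by (simp add: node_add algebra_simps)
  have 1: "(LBINT x:cell r. (w x - v x) * \<phi> x) = h * (left_int (\<lambda>t. (A (t + 1/2) - \<Omega> t) * poly p t)
      + right_int (\<lambda>t. (B (t - 1/2) - \<Omega> t) * poly p t))"
    by (rule LBINT_cell(2)) (auto intro!: continuous_intros continuous_on_shift c simp: sl sr)
  have 2: "(LBINT x:cell r. w x * deriv \<phi> x) = h * (left_int (\<lambda>t. A (t + 1/2) * poly (pderiv p) t / h)
      + right_int (\<lambda>t. B (t - 1/2) * poly (pderiv p) t / h))"
    by (rule LBINT_cell(2)) (use h_pos in \<open>auto intro!: continuous_intros continuous_on_shift c simp: sl sr\<close>)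
  have 3: "w (node (r + 1/2)) = B 0" "w (node (r - 1/2)) = A 0"
    using repD[OF B, of 0] repD[OF A, of 0] by simp_all
  show ?thesis
    unfolding B_form_def 1 2 3 rep_poly_Lim[OF \<phi>] BF_def \<tau>max_def
    using h_pos C_pos by (simp add: field_simps)
qed

section \<open>Global projections and corrections in local form\<close>

lemma rep_poly: "rep (poly q) r (poly (pcompose q [:node r, h:]))"
  by (simp add: rep_def poly_pcompose mult.commute)

text \<open>An equivalence with one explicit function yields existence and uniqueness together, as a
  definite description needs. The global conditions decouple into one local problem per
  cell.\<close>

lemma projection_iff:
  assumes c: "cts \<omega>" and per: "periodic \<omega>"
  shows "v \<in> pw_poly s k \<and> (\<forall>i. (LBINT x:cell (of_int i + s). v x) = (LBINT x:cell (of_int i + s). \<omega> x) \<and>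
      (\<forall>p. degree p \<le> k \<longrightarrow> P_form (of_int i + s) v (poly p) = P_form (of_int i + s) \<omega> (poly p)))
    \<longleftrightarrow> v = glue s (\<lambda>i. poly (Q (\<lambda>t. \<omega> (node (of_int i + s) + h * t))))"
    (is "?L \<longleftrightarrow> v = ?g")
proof -
  have cw: "cts (\<lambda>t. \<omega> (node r + h * t))" for r
    by (intro continuous_on_compose2[OF c] continuous_intros) auto
  have rw: "rep \<omega> r (\<lambda>t. \<omega> (node r + h * t))" for r by (simp add: rep_def)
  have P: "P_form r w (poly q) = PF W (pcompose q [:node r, h:])" if "cts W" "rep w r W" for w W r q
    by (rule P_form_rep[OF that rep_poly])
  show ?thesis
  proof
    assume L: ?L
    have "rep v (of_int i + s) (poly (Q (\<lambda>t. \<omega> (node (of_int i + s) + h * t))))" for i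
    proof -
      let ?r = "of_int i + s"
      obtain p where p: "degree p \<le> k" "rep v ?r (poly p)" using L pw_poly_iff by blast
      have "p = Q (\<lambda>t. \<omega> (node ?r + h * t))"
      proof (rule Q_unique[OF p(1)])
        show "mean (poly p) = mean (\<lambda>t. \<omega> (node ?r + h * t))"
          using L LBINT_cell_rep[OF _ p(2)] LBINT_cell_rep[OF cw rw, of ?r] h_pos by simp
        fix \<phi> :: "real poly" assume \<phi>: "degree \<phi> \<le> k"
        \<comment> \<open>The definition tests with polynomials in \<open>x\<close>; the affine
          change of variable turns them into arbitrary test polynomials in \<open>t\<close> of the
          same degree.\<close>
        let ?q = "pcompose \<phi> [:- node ?r / h, 1 / h:]"
        have "pcompose ?q [:node ?r, h:] = \<phi>"
          unfolding pcompose_assoc[symmetric] using h_pos by (simp add: pcompose_pCons)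
        moreover have "degree ?q \<le> k" using \<phi> h_pos by (simp add: degree_pcompose)
        ultimately show "PF (poly p) \<phi> = PF (\<lambda>t. \<omega> (node ?r + h * t)) \<phi>"
          using L P[OF continuous_on_poly_UNIV p(2), of ?q] P[OF cw rw, of ?r ?q] by metis
      qed
      then show ?thesis using p(2) by simp
    qed
    then show "v = ?g" using rep_glue by (rule rep_unique)
  next
    assume v: "v = ?g"
    have rv: "rep v (of_int i + s) (poly (Q (\<lambda>t. \<omega> (node (of_int i + s) + h * t))))" for i
      unfolding v by (rule rep_glue)
    have "periodic v"
      unfolding v
    proof (rule periodic_glue)
      fix i
      have "\<omega> (node (of_int (i + int N) + s) + h * t) = \<omega> (node (of_int i + s) + h * t)" for t
        unfolding node_period' using per by (simp only: periodic_def)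
      then show "poly (Q (\<lambda>t. \<omega> (node (of_int (i + int N) + s) + h * t)))
        = poly (Q (\<lambda>t. \<omega> (node (of_int i + s) + h * t)))" by simp
    qed
    then have "v \<in> pw_poly s k" unfolding pw_poly_iff using rv degree_Q by blast
    moreover have "(LBINT x:cell (of_int i + s). v x) = (LBINT x:cell (of_int i + s). \<omega> x)" for i
      using LBINT_cell_rep[OF continuous_on_poly_UNIV rv[of i]] LBINT_cell_rep[OF cw rw, of "of_int i + s"] mean_Q by simp
    moreover have "P_form (of_int i + s) v (poly p) = P_form (of_int i + s) \<omega> (poly p)" if "degree p \<le> k" for i p
      unfolding P[OF continuous_on_poly_UNIV rv[of i]] P[OF cw rw]
      by (rule PF_Q[OF cw]) (use that h_pos in \<open>simp add: degree_pcompose\<close>)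
    ultimately show ?L by blast
  qed
qed

text \<open>Derivatives of \<open>u\<close> in the local coordinate, with the chain rule factor
  \<open>h ^ j\<close>. All powers of \<open>h\<close> in the final rate come from here.\<close>

definition jet :: "(real \<Rightarrow> real) \<Rightarrow> real \<Rightarrow> nat \<Rightarrow> real \<Rightarrow> real" where
  "jet u r j t = h ^ j * (deriv ^^ j) u (node r + h * t)"

lemma continuous_on_jet:
  assumes "cts ((deriv ^^ j) u)"
  shows "cts (jet u r j)"
proof -
  have "cts (\<lambda>t. (deriv ^^ j) u (node r + h * t))"
    by (rule continuous_on_compose2[OF assms]) (auto intro!: continuous_intros)
  then show ?thesis unfolding jet_def by (intro continuous_on_mult continuous_on_const)
qed

lemma jet_shift: "jet u (r + d) = (\<lambda>j t. jet u r j (t + d))"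
  and jet_shift': "jet u (r - d) = (\<lambda>j t. jet u r j (t - d))"
proof -
  have "node (r + d) + h * t = node r + h * (t + d)" "node (r - d) + h * t = node r + h * (t - d)" for t
    by (simp_all add: node_def algebra_simps)
  then show "jet u (r + d) = (\<lambda>j t. jet u r j (t + d))" "jet u (r - d) = (\<lambda>j t. jet u r j (t - d))"
    unfolding fun_eq_iff by (simp_all only: jet_def) simp_all
qed

lemma jet_deriv: "(\<lambda>j. jet u r (Suc j)) = (\<lambda>j t. h * jet (deriv u) r j t)"
  unfolding jet_def funpow_Suc_right o_apply by (intro ext) (simp only: power_Suc mult.assoc)

lemma jet_period:
  assumes "periodic u"
  shows "jet u (r + real N) = jet u r"
proof -
  have "node (r + real N) + y = (node r + y) + (b - a)" for y
    using node_period[of r] by simp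
  then show ?thesis
    using periodic_deriv_funpow[OF assms] by (simp only: fun_eq_iff jet_def periodic_def) simp
qed

definition mean_free :: "real \<Rightarrow> (real \<Rightarrow> real) set" where
  "mean_free s = {v \<in> pw_poly s k. \<forall>i::int. (LBINT x:cell (of_int i + s). v x) = 0}"

lemma V0_eq: "V0 = mean_free 0" and W0_eq: "W0 = mean_free (1/2)"
  by (simp_all add: V0_def W0_def mean_free_def V_def W_def)

lemma mean_free_glue_poly:
  assumes "degree \<phi> \<le> k" "mean (poly \<phi>) = 0"
  shows "glue s (\<lambda>i. poly \<phi>) \<in> mean_free s"
proof -
  have "periodic (glue s (\<lambda>i. poly \<phi>))" by (rule periodic_glue) simp
  moreover have r: "rep (glue s (\<lambda>i. poly \<phi>)) (of_int i + s) (poly \<phi>)" for i by (rule rep_glue)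
  ultimately have "glue s (\<lambda>i. poly \<phi>) \<in> pw_poly s k" unfolding pw_poly_iff using assms by blast
  then show ?thesis unfolding mean_free_def using LBINT_cell_rep[OF continuous_on_poly_UNIV r] assms by simp
qed

lemma mean_freeD:
  assumes "v \<in> mean_free s"
  obtains p where "degree p \<le> k" "mean (poly p) = 0" "rep v (of_int i + s) (poly p)"
proof -
  obtain p where p: "degree p \<le> k" "rep v (of_int i + s) (poly p)"
    using assms unfolding mean_free_def pw_poly_iff by blast
  have "(LBINT x:cell (of_int i + s). v x) = 0" using assms by (simp add: mean_free_def)
  then have "mean (poly p) = 0" using LBINT_cell_rep[OF continuous_on_poly_UNIV p(2)] h_pos by simp
  then show thesis using that p by blast
qed

text \<open>One correction step for either mesh: \<open>vo\<close>, \<open>vd\<close> are on the own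
  mesh, \<open>wo\<close> is on the opposite one. Uniqueness follows by testing with the difference
  of two local pieces and applying \<open>PF_self_zero\<close>.\<close>

lemma correction_iff:
  assumes c: "\<And>j. j \<le> Suc l \<Longrightarrow> cts ((deriv ^^ j) u)" and per: "periodic u"
    and own: "\<And>i. rep vo (of_int i + s) (\<rho> l (jet u (of_int i + s)))"
    and own': "\<And>i. rep vd (of_int i + s) (\<rho> l (jet (deriv u) (of_int i + s)))"
    and left: "\<And>i. rep wo (of_int i + s - 1/2) (\<rho> l (jet u (of_int i + s - 1/2)))"
    and right: "\<And>i. rep wo (of_int i + s + 1/2) (\<rho> l (jet u (of_int i + s + 1/2)))"
  shows "v \<in> mean_free s \<and> (\<forall>\<phi> \<in> mean_free s. \<forall>i. P_form (of_int i + s) v \<phi> = - (LBINT x:cell (of_int i + s). vd x * \<phi> x)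
        - B_form (of_int i + s) vo wo \<phi> + P_form (of_int i + s) vo \<phi>)
    \<longleftrightarrow> v = glue s (\<lambda>i. \<rho> (Suc l) (jet u (of_int i + s)))"
    (is "?L \<longleftrightarrow> v = ?g")
proof -
  have cj: "cts (jet u r j)" if "j \<le> Suc l" for r j
    by (intro continuous_on_jet c that)
  have cj': "cts (jet (deriv u) r j)" if "j \<le> l" for r j
    using c[of "Suc j"] that by (intro continuous_on_jet) (simp add: funpow_Suc_right del: funpow.simps)
  have c\<rho>: "cts (\<rho> m (jet u r))" "cts (\<rho> l (jet (deriv u) r))" for r m
    by (intro continuous_on_\<rho> cj cj'; simp)+
  have rhs: "- (LBINT x:cell (of_int i + s). vd x * \<phi> x) - B_form (of_int i + s) vo wo \<phi> + P_form (of_int i + s) vo \<phi>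
      = PF (\<rho> (Suc l) (jet u (of_int i + s))) p"
    if p: "degree p \<le> k" "mean (poly p) = 0" "rep \<phi> (of_int i + s) (poly p)" for \<phi> p i
  proof -
    let ?r = "of_int i + s"
    have "(LBINT x:cell ?r. vd x * \<phi> x) = h * mean (\<lambda>t. \<rho> l (jet (deriv u) ?r) t * poly p t)"
      by (intro LBINT_cell_rep rep_mult own' p continuous_intros c\<rho>)
    \<comment> \<open>The mass term has no \<open>1 / \<tau>max\<close>, so a factor
      \<open>h\<close> survives. By \<open>jet_deriv\<close> it turns the jet of
      \<open>deriv u\<close> into the index-shifted jet of \<open>u\<close>.\<close>
    also have "\<dots> = mean (\<lambda>t. h * (\<rho> l (jet (deriv u) ?r) t * poly p t) + 0)"
      by (subst mean_linear) (auto intro!: continuous_intros c\<rho> simp: mean_def)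
    also have "\<dots> = mean (\<lambda>t. \<rho> l (\<lambda>j. jet u ?r (Suc j)) t * poly p t)"
      unfolding jet_deriv by (subst \<rho>_scale) (auto intro!: cj' simp: mult.assoc)
    finally have 1: "(LBINT x:cell ?r. vd x * \<phi> x) = mean (\<lambda>t. \<rho> l (\<lambda>j. jet u ?r (Suc j)) t * poly p t)" .
    have 2: "B_form ?r vo wo \<phi> = BF (\<rho> l (jet u (?r - 1/2))) (\<rho> l (jet u (?r + 1/2))) (\<rho> l (jet u ?r)) p"
      by (intro B_form_rep c\<rho> left right own p)
    have 3: "P_form ?r vo \<phi> = PF (\<rho> l (jet u ?r)) p"
      by (intro P_form_rep c\<rho> own p)
    have "PF (\<rho> (Suc l) (jet u ?r)) p = rhs_form (\<rho> l (\<lambda>j. jet u ?r (Suc j))) (\<rho> l (jet u (?r - 1/2)))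
        (\<rho> l (jet u (?r + 1/2))) (\<rho> l (jet u ?r)) p"
      unfolding jet_shift[of u ?r "1/2"] jet_shift'[of u ?r "1/2"] by (rule PF_\<rho>_Suc[OF cj p(1,2)])
    then show ?thesis unfolding 1 2 3 rhs_form_def by (simp only:)
  qed
  have \<rho>_poly: "\<exists>q. degree q \<le> k \<and> mean (poly q) = 0 \<and> \<rho> (Suc l) (jet u r) = poly q" for r
    using degree_Sol mean_Sol unfolding \<rho>.simps by blast
  show ?thesis
  proof
    assume L: ?L
    have "rep v (of_int i + s) (\<rho> (Suc l) (jet u (of_int i + s)))" for i
    proof -
      let ?r = "of_int i + s"
      obtain p where p: "degree p \<le> k" "mean (poly p) = 0" "rep v ?r (poly p)" using L mean_freeD by blast
      obtain q where q: "degree q \<le> k" "mean (poly q) = 0" "\<rho> (Suc l) (jet u ?r) = poly q" using \<rho>_poly by blast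
      let ?d = "smult (-1) q + p"
      have d: "degree ?d \<le> k" using p q by (intro degree_add_le) auto
      have dm: "mean (poly ?d) = 0"
        using dof_linear[of 0 "-1" q p] p(2) q(2) by (simp add: dof_def)
      \<comment> \<open>Repeating the local difference on every cell gives a periodic member of the
        global test space.\<close>
      let ?\<phi> = "glue s (\<lambda>i. poly ?d)"
      have "P_form ?r v ?\<phi> = - (LBINT x:cell ?r. vd x * ?\<phi> x) - B_form ?r vo wo ?\<phi> + P_form ?r vo ?\<phi>"
        using L mean_free_glue_poly[OF d dm] by blast
      also have "\<dots> = PF (poly q) ?d"
        unfolding q(3)[symmetric] by (rule rhs[OF d dm rep_glue])
      finally have "P_form ?r v (glue s (\<lambda>i. poly ?d)) = PF (poly q) ?d" .
      moreover have "P_form ?r v (glue s (\<lambda>i. poly ?d)) = PF (poly p) ?d"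
        by (intro P_form_rep continuous_on_poly_UNIV p rep_glue)
      moreover have "PF (poly ?d) ?d = (-1) * PF (poly q) ?d + PF (poly p) ?d"
      proof -
        have "poly ?d = (\<lambda>t. (-1) * poly q t + poly p t)" by auto
        then show ?thesis by (simp only: BF_linear continuous_on_poly_UNIV)
      qed
      ultimately have "PF (poly ?d) ?d = 0" by simp
      then have "?d = 0" using dm by (rule PF_self_zero)
      then have "p = q" by simp
      then show ?thesis using p q by simp
    qed
    then show "v = ?g" using rep_glue by (rule rep_unique)
  next
    assume v: "v = ?g"
    have rv: "rep v (of_int i + s) (\<rho> (Suc l) (jet u (of_int i + s)))" for i
      unfolding v by (rule rep_glue)
    have "periodic v"
      unfolding v
    proof (rule periodic_glue)
      fix i
      show "\<rho> (Suc l) (jet u (of_int (i + int N) + s)) = \<rho> (Suc l) (jet u (of_int i + s))"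
        using jet_period[OF per, of "of_int i + s"] by (simp add: algebra_simps)
    qed
    moreover have "\<exists>p. degree p \<le> k \<and> rep v (of_int i + s) (poly p)" for i
      using rv[of i] \<rho>_poly by metis
    ultimately have "v \<in> pw_poly s k" unfolding pw_poly_iff by blast
    moreover have "(LBINT x:cell (of_int i + s). v x) = 0" for i
      using LBINT_cell_rep[OF c\<rho>(1) rv[of i]] mean_\<rho>[of "jet u (of_int i + s)"] cj by simp
    ultimately have "v \<in> mean_free s" by (simp add: mean_free_def)
    moreover have "P_form (of_int i + s) v \<phi> = - (LBINT x:cell (of_int i + s). vd x * \<phi> x)
        - B_form (of_int i + s) vo wo \<phi> + P_form (of_int i + s) vo \<phi>" if \<phi>: "\<phi> \<in> mean_free s" for \<phi> i
    proof -
      obtain p where p: "degree p \<le> k" "mean (poly p) = 0" "rep \<phi> (of_int i + s) (poly p)"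
        using mean_freeD[OF \<phi>] by blast
      show ?thesis unfolding rhs[OF p] by (intro P_form_rep c\<rho> rv p)
    qed
    ultimately show ?L by blast
  qed
qed

text \<open>Both components are treated in one induction because each B-form couples the meshes, and
  for all \<open>u\<close> at once because \<open>R\<close> recurses through
  \<open>deriv u\<close>.\<close>

lemma R_rep:
  assumes "\<And>j. j \<le> l \<Longrightarrow> cts ((deriv ^^ j) u)" "periodic u"
  shows "rep (fst (R l u)) (of_int i) (\<rho> l (jet u (of_int i)))"
    "rep (snd (R l u)) (of_int i + 1/2) (\<rho> l (jet u (of_int i + 1/2)))"
proof -
  have "(\<forall>i::int. rep (fst (R l u)) (of_int i) (\<rho> l (jet u (of_int i)))) \<and>
    (\<forall>i::int. rep (snd (R l u)) (of_int i + 1/2) (\<rho> l (jet u (of_int i + 1/2))))"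
    using assms
  proof (induction l arbitrary: u)
    case 0
    have c: "cts u" using 0(1)[of 0] by simp
    have PC: "PC u = glue 0 (\<lambda>i. poly (Q (\<lambda>t. u (node (of_int i + 0) + h * t))))"
      unfolding PC_def Phat_def V_def using projection_iff[OF c 0(2), of _ 0] by (simp add: the_equality)
    have PD: "PD u = glue (1/2) (\<lambda>i. poly (Q (\<lambda>t. u (node (of_int i + 1/2) + h * t))))"
      unfolding PD_def Ptilde_def W_def using projection_iff[OF c 0(2), of _ "1/2"] by (simp add: the_equality)
    have j: "jet u r 0 = (\<lambda>t. u (node r + h * t))" for r by (simp add: fun_eq_iff jet_def)
    show ?case
    proof (intro conjI allI)
      fix i :: int
      have "rep (PC u) (of_int i) (poly (Q (jet u (of_int i) 0)))"
        using rep_glue[of 0 "\<lambda>i. poly (Q (\<lambda>t. u (node (of_int i + 0) + h * t)))" i] unfolding PC j by simp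
      then show "rep (fst (R 0 u)) (of_int i) (\<rho> 0 (jet u (of_int i)))"
        by (simp add: rep_def j)
      have "rep (PD u) (of_int i + 1/2) (poly (Q (jet u (of_int i + 1/2) 0)))"
        unfolding PD j by (rule rep_glue)
      then show "rep (snd (R 0 u)) (of_int i + 1/2) (\<rho> 0 (jet u (of_int i + 1/2)))"
        by (simp add: rep_def j)
    qed
  next
    case (Suc l)
    have IH: "rep (fst (R l u)) (of_int i) (\<rho> l (jet u (of_int i)))"
      "rep (snd (R l u)) (of_int i + 1/2) (\<rho> l (jet u (of_int i + 1/2)))" for i
      using Suc.IH[of u] Suc.prems by auto
    have IH': "rep (fst (R l (deriv u))) (of_int i) (\<rho> l (jet (deriv u) (of_int i)))"
      "rep (snd (R l (deriv u))) (of_int i + 1/2) (\<rho> l (jet (deriv u) (of_int i + 1/2)))" for i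
    proof -
      have "cts ((deriv ^^ j) (deriv u))" if "j \<le> l" for j
        using Suc.prems(1)[of "Suc j"] that by (simp add: funpow_Suc_right del: funpow.simps)
      then show "rep (fst (R l (deriv u))) (of_int i) (\<rho> l (jet (deriv u) (of_int i)))"
        "rep (snd (R l (deriv u))) (of_int i + 1/2) (\<rho> l (jet (deriv u) (of_int i + 1/2)))"
        using Suc.IH[of "deriv u"] periodic_deriv[OF Suc.prems(2)] by auto
    qed
    have opp: "rep (snd (R l u)) (of_int i + 0 - 1/2) (\<rho> l (jet u (of_int i + 0 - 1/2)))"
      "rep (snd (R l u)) (of_int i + 0 + 1/2) (\<rho> l (jet u (of_int i + 0 + 1/2)))"
      "rep (fst (R l u)) (of_int i + 1/2 - 1/2) (\<rho> l (jet u (of_int i + 1/2 - 1/2)))"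
      "rep (fst (R l u)) (of_int i + 1/2 + 1/2) (\<rho> l (jet u (of_int i + 1/2 + 1/2)))" for i
    proof -
      \<comment> \<open>The dual cell with index \<open>i\<close> lies to the right of
        \<open>node i\<close>; left of it is dual cell \<open>i - 1\<close>, and right of a dual
        cell is primal cell \<open>i + 1\<close>.\<close>
      have e: "of_int (i - 1) + 1/2 = (of_int i + 0 - 1/2 :: real)" "of_int (i + 1) = (of_int i + 1/2 + 1/2 :: real)"
        by simp_all
      show "rep (snd (R l u)) (of_int i + 0 - 1/2) (\<rho> l (jet u (of_int i + 0 - 1/2)))"
        using IH(2)[of "i - 1"] unfolding e .
      show "rep (fst (R l u)) (of_int i + 1/2 + 1/2) (\<rho> l (jet u (of_int i + 1/2 + 1/2)))"
        using IH(1)[of "i + 1"] unfolding e .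
    qed (use IH in simp_all)
    have own0: "rep (fst (R l u)) (of_int i + 0) (\<rho> l (jet u (of_int i + 0)))"
      "rep (fst (R l (deriv u))) (of_int i + 0) (\<rho> l (jet (deriv u) (of_int i + 0)))" for i
      using IH(1) IH'(1) by simp_all
    have C: "v \<in> V0 \<and> (\<forall>\<phi> \<in> V0. \<forall>i. Phat i v \<phi> = - (LBINT x:cell (of_int i). fst (R l (deriv u)) x * \<phi> x)
        - Bhat i (R l u) \<phi> + Phat i (fst (R l u)) \<phi>)
      \<longleftrightarrow> v = glue 0 (\<lambda>i. \<rho> (Suc l) (jet u (of_int i)))" for v
      using correction_iff[OF Suc.prems own0 opp(1,2), of v] by (simp add: V0_eq Phat_def Bhat_eq)
    have D: "v \<in> W0 \<and> (\<forall>\<phi> \<in> W0. \<forall>i. Ptilde i v \<phi> = - (LBINT x:cell (of_int i + 1/2). snd (R l (deriv u)) x * \<phi> x)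
        - Btilde i (R l u) \<phi> + Ptilde i (snd (R l u)) \<phi>)
      \<longleftrightarrow> v = glue (1/2) (\<lambda>i. \<rho> (Suc l) (jet u (of_int i + 1/2)))" for v
      using correction_iff[OF Suc.prems IH(2) IH'(2) opp(3,4), of v] by (simp add: W0_eq Ptilde_def Btilde_eq)
    \<comment> \<open>\<open>R\<close> quantifies over pairs of test functions. Splitting this into
      one condition per component requires both test spaces to be inhabited.\<close>
    have "glue s (\<lambda>i. poly 0) \<in> mean_free s" for s
      by (rule mean_free_glue_poly) (use dof_linear[of 0 1 0 0] in \<open>simp_all add: dof_def\<close>)
    then have ne: "\<exists>\<phi>. \<phi> \<in> V0" "\<exists>\<phi>. \<phi> \<in> W0" unfolding V0_eq W0_eq by blast+
    define g0 where "g0 = glue 0 (\<lambda>i. \<rho> (Suc l) (jet u (of_int i)))"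
    define g1 where "g1 = glue (1/2) (\<lambda>i. \<rho> (Suc l) (jet u (of_int i + 1/2)))"
    note C = C[folded g0_def] and D = D[folded g1_def]
    have "R (Suc l) u = (g0, g1)"
      unfolding R.simps
    proof (rule the_equality)
      show "(g0, g1) \<in> V0 \<times> W0 \<and> (\<forall>\<phi>1 \<in> V0. \<forall>\<phi>2 \<in> W0. \<forall>i.
        Phat i (fst (g0, g1)) \<phi>1 = - (LBINT x:cell (of_int i). fst (R l (deriv u)) x * \<phi>1 x)
          - Bhat i (R l u) \<phi>1 + Phat i (fst (R l u)) \<phi>1 \<and>
        Ptilde i (snd (g0, g1)) \<phi>2 = - (LBINT x:cell (of_int i + 1/2). snd (R l (deriv u)) x * \<phi>2 x)
          - Btilde i (R l u) \<phi>2 + Ptilde i (snd (R l u)) \<phi>2)"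
        using C[THEN iffD2, OF refl] D[THEN iffD2, OF refl] unfolding fst_conv snd_conv mem_Times_iff by blast
    next
      fix w assume w: "w \<in> V0 \<times> W0 \<and> (\<forall>\<phi>1 \<in> V0. \<forall>\<phi>2 \<in> W0. \<forall>i.
        Phat i (fst w) \<phi>1 = - (LBINT x:cell (of_int i). fst (R l (deriv u)) x * \<phi>1 x)
          - Bhat i (R l u) \<phi>1 + Phat i (fst (R l u)) \<phi>1 \<and>
        Ptilde i (snd w) \<phi>2 = - (LBINT x:cell (of_int i + 1/2). snd (R l (deriv u)) x * \<phi>2 x)
          - Btilde i (R l u) \<phi>2 + Ptilde i (snd (R l u)) \<phi>2)"
      have "fst w = g0" by (rule C[THEN iffD1]) (use w ne in \<open>unfold mem_Times_iff, blast\<close>)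
      moreover have "snd w = g1" by (rule D[THEN iffD1]) (use w ne in \<open>unfold mem_Times_iff, blast\<close>)
      ultimately show "w = (g0, g1)" by (simp add: prod_eq_iff)
    qed
    moreover have "rep g0 (of_int i) (\<rho> (Suc l) (jet u (of_int i)))" for i
      using rep_glue[of 0 "\<lambda>i. \<rho> (Suc l) (jet u (of_int i))" i] by (simp add: g0_def)
    moreover have "rep g1 (of_int i + 1/2) (\<rho> (Suc l) (jet u (of_int i + 1/2)))" for i
      unfolding g1_def by (rule rep_glue)
    ultimately show ?case by (simp only: fst_conv snd_conv) blast
  qed
  then show "rep (fst (R l u)) (of_int i) (\<rho> l (jet u (of_int i)))"
    "rep (snd (R l u)) (of_int i + 1/2) (\<rho> l (jet u (of_int i + 1/2)))" by blast+
qed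

subsection \<open>The error estimate\<close>

text \<open>Adjacent closed cells share an end point, so additivity over their union uses
  disjointness almost everywhere.\<close>

lemma cells_sum:
  fixes f :: "real \<Rightarrow> real"
  assumes "\<And>i. 1 \<le> i \<Longrightarrow> i \<le> int n \<Longrightarrow> set_integrable lborel (cell (of_int i)) f"
  shows "set_integrable lborel {node (1/2)..node (real n + 1/2)} f \<and>
    (LBINT x:{node (1/2)..node (real n + 1/2)}. f x) = (\<Sum>i = 1..int n. LBINT x:cell (of_int i). f x)"
  using assms
proof (induction n)
  case 0
  have "(\<lambda>x. indicator {node (1/2)} x *\<^sub>R f x) = (\<lambda>x. indicator {node (1/2)} x * f (node (1/2)))"
    by (auto simp: indicator_def)
  then have "set_integrable lborel {node (1/2)} f" "(LBINT x:{node (1/2)}. f x) = 0"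
    by (simp_all add: set_integrable_def set_lebesgue_integral_def)
  then show ?case by simp
next
  case (Suc n)
  have le: "node (1/2) \<le> node (real n + 1/2)" "node (real n + 1/2) \<le> node (real (Suc n) + 1/2)"
    using h_pos by (simp_all add: node_def mult_right_mono)
  have cell: "cell (of_int (int n + 1)) = {node (real n + 1/2)..node (real (Suc n) + 1/2)}"
    by (simp add: cell_def algebra_simps)
  have U: "{node (1/2)..node (real (Suc n) + 1/2)} = {node (1/2)..node (real n + 1/2)} \<union> cell (of_int (int n + 1))"
    unfolding cell using le by auto
  have IH: "set_integrable lborel {node (1/2)..node (real n + 1/2)} f"
    "(LBINT x:{node (1/2)..node (real n + 1/2)}. f x) = (\<Sum>i = 1..int n. LBINT x:cell (of_int i). f x)"
    using Suc by auto
  have i: "set_integrable lborel (cell (of_int (int n + 1))) f" by (rule Suc.prems) auto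
  have ms: "cell r \<in> sets lborel" for r by (simp add: cell_def)
  have "AE x in lborel. x \<noteq> node (real n + 1/2)" by (rule AE_lborel_singleton)
  then have "AE x in lborel. \<not> (x \<in> {node (1/2)..node (real n + 1/2)} \<and> x \<in> cell (of_int (int n + 1)))"
    unfolding cell by eventually_elim auto
  then have "(LBINT x:{node (1/2)..node (real (Suc n) + 1/2)}. f x)
      = (\<Sum>i = 1..int n. LBINT x:cell (of_int i). f x) + (LBINT x:cell (of_int (int n + 1)). f x)"
    unfolding U IH(2)[symmetric] by (intro set_integral_Un_AE IH(1) i ms) auto
  also have "\<dots> = (\<Sum>i = 1..int (Suc n). LBINT x:cell (of_int i). f x)"
  proof -
    have "{1..int (Suc n)} = insert (int n + 1) {1..int n}" by auto
    then show ?thesis by simp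
  qed
  finally show ?case unfolding U using set_integrable_Un[OF IH(1) i _ ms] by simp
qed

lemma node_end: "node (real N + 1/2) = b"
  using node_period[of "1/2"] node_half by (simp add: add.commute)

lemma LBINT_period_cells:
  fixes f :: "real \<Rightarrow> real"
  assumes "\<And>i. 1 \<le> i \<Longrightarrow> i \<le> int N \<Longrightarrow> set_integrable lborel (cell (of_int i)) f"
  shows "(LBINT x:{a..b}. f x) = (\<Sum>i = 1..int N. LBINT x:cell (of_int i). f x)"
  using cells_sum[of N f] assms unfolding node_half node_end by simp

lemma cell_subset:
  assumes "1 \<le> i" "i \<le> int N"
  shows "cell (of_int i) \<subseteq> {a..b}"
proof -
  have "node (1/2) \<le> node (of_int i - 1/2)" "node (of_int i + 1/2) \<le> node (real N + 1/2)"
    unfolding node_def using h_pos assms by (auto intro!: mult_right_mono)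
  then show ?thesis unfolding cell_def node_half node_end by auto
qed

lemma pw_const:
  assumes "\<phi> \<in> pw_poly s 0"
  shows "rep \<phi> (of_int i + s) (poly [:\<phi> (node (of_int i + s)):])"
proof -
  obtain p where p: "degree p \<le> 0" "rep \<phi> (of_int i + s) (poly p)" using assms unfolding pw_poly_iff by blast
  then obtain c where c: "p = [:c:]" by (metis degree_eq_zeroE le_zero_eq)
  have "\<phi> (node (of_int i + s)) = c" using repD[OF p(2), of 0] c by simp
  then show ?thesis using p(2) c by simp
qed

lemma pw_const_periodic:
  assumes "\<phi> \<in> pw_poly s 0"
  shows "\<phi> (node (of_int (i + int N) + s)) = \<phi> (node (of_int i + s))"
  using assms node_period'[of i s 0] by (simp add: pw_poly_iff periodic_def)

lemma L2_norm_nonneg: "L2_norm a b f \<ge> 0"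
  unfolding L2_norm_def set_lebesgue_integral_def
  by (intro real_sqrt_ge_zero Bochner_Integration.integral_nonneg) auto

text \<open>Dual cells do not tile \<open>[a, b]\<close>: half a cell sticks out at each end.
  Integration therefore runs over primal cells with two constant halves, and periodicity reassembles
  the halves.\<close>

lemma L2_norm_pw_const:
  assumes \<phi>: "\<phi> \<in> pw_poly s 0" and s: "s = 0 \<or> s = 1/2"
  shows "(L2_norm a b \<phi>)\<^sup>2 = h * (\<Sum>i = 1..int N. (\<phi> (node (of_int i + s)))\<^sup>2)"
proof -
  define c where "c i = \<phi> (node (of_int i + s))" for i :: int
  have cp: "c (i + int N) = c i" for i unfolding c_def by (rule pw_const_periodic[OF \<phi>])
  have r: "\<phi> (node (of_int i + s) + h * t) = c i" if "-1/2 \<le> t" "t < 1/2" for i t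
    using repD[OF pw_const[OF \<phi>] that] by (simp add: c_def)
  \<comment> \<open>The value on the left half of primal cell \<open>i\<close>; in the dual case
    this half lies in dual cell \<open>i - 1\<close>.\<close>
  define l where "l i = (if s = 0 then c i else c (i - 1))" for i :: int
  have left: "\<phi> (node (of_int i) + h * t) = l i" if "-1/2 < t" "t < 0" for i :: int and t
  proof (cases "s = 0")
    case True
    then show ?thesis using r[of t i] that by (simp add: l_def)
  next
    case False
    then have s': "s = 1/2" using s by simp
    have e: "node (of_int (i - 1) + 1/2) + h * (t + 1/2) = node (of_int i) + h * t"
      by (simp add: node_def algebra_simps)
    have "\<phi> (node (of_int (i - 1) + s) + h * (t + 1/2)) = c (i - 1)" by (rule r) (use that in auto)
    then show ?thesis unfolding s' e by (simp add: l_def s')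
  qed
  have right: "\<phi> (node (of_int i) + h * t) = c i" if "0 < t" "t < 1/2" for i :: int and t
  proof (cases "s = 0")
    case True
    then show ?thesis using r[of t i] that by simp
  next
    case False
    then have s': "s = 1/2" using s by simp
    have e: "node (of_int i + 1/2) + h * (t - 1/2) = node (of_int i) + h * t"
      by (simp add: node_def algebra_simps)
    have "\<phi> (node (of_int i + s) + h * (t - 1/2)) = c i" by (rule r) (use that in auto)
    then show ?thesis unfolding s' e .
  qed
  have cell: "set_integrable lborel (cell (of_int i)) (\<lambda>x. (\<phi> x)\<^sup>2)"
    "(LBINT x:cell (of_int i). (\<phi> x)\<^sup>2) = h * ((l i)\<^sup>2 / 2 + (c i)\<^sup>2 / 2)" for i :: int
    using LBINT_cell[of "\<lambda>t. (l i)\<^sup>2" "\<lambda>t. (c i)\<^sup>2" "\<lambda>x. (\<phi> x)\<^sup>2" "of_int i"] left right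
    by (auto simp: continuous_on_const)
  have "(L2_norm a b \<phi>)\<^sup>2 = (LBINT x:{a..b}. (\<phi> x)\<^sup>2)"
    unfolding L2_norm_def set_lebesgue_integral_def
    by (intro real_sqrt_pow2 Bochner_Integration.integral_nonneg) auto
  also have "\<dots> = (\<Sum>i = 1..int N. h * ((l i)\<^sup>2 / 2 + (c i)\<^sup>2 / 2))"
    unfolding cell(2)[symmetric] by (rule LBINT_period_cells) (rule cell(1))
  also have "\<dots> = h * ((\<Sum>i = 1..int N. (l i)\<^sup>2) / 2 + (\<Sum>i = 1..int N. (c i)\<^sup>2) / 2)"
    unfolding sum_divide_distrib sum.distrib[symmetric] sum_distrib_left ..
  also have "(\<Sum>i = 1..int N. (l i)\<^sup>2) = (\<Sum>i = 1..int N. (c i)\<^sup>2)"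
    using sum_int_shift_periodic[of "\<lambda>i. (c i)\<^sup>2" N "-1"] cp by (cases "s = 0") (simp_all add: l_def)
  finally show ?thesis by (simp add: c_def)
qed

lemma B_form_pw_const:
  assumes u: "\<And>j. j \<le> l \<Longrightarrow> cts ((deriv ^^ j) u)"
    and \<phi>: "\<phi> \<in> pw_poly s 0"
    and own: "rep v (of_int i + s) (\<rho> l (jet u (of_int i + s)))"
    and left: "rep w (of_int i + s - 1/2) (\<rho> l (jet u (of_int i + s - 1/2)))"
    and right: "rep w (of_int i + s + 1/2) (\<rho> l (jet u (of_int i + s + 1/2)))"
  shows "B_form (of_int i + s) v w \<phi> = \<phi> (node (of_int i + s)) * const_form l (jet u (of_int i + s))"
proof -
  let ?r = "of_int i + s" and ?c = "\<phi> (node (of_int i + s))"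
  have c: "cts (\<rho> l (jet u r))" for r
    by (intro continuous_on_\<rho> continuous_on_jet u) simp
  have "B_form ?r v w \<phi> = BF (\<rho> l (jet u (?r - 1/2))) (\<rho> l (jet u (?r + 1/2))) (\<rho> l (jet u ?r)) [:?c:]"
    by (intro B_form_rep c left right own pw_const \<phi>)
  also have "\<dots> = ?c * const_form l (jet u ?r)"
  proof -
    let ?B = "BF (\<rho> l (jet u (?r - 1/2))) (\<rho> l (jet u (?r + 1/2))) (\<rho> l (jet u ?r))"
    have "?B (smult ?c 1 + 0) = ?c * ?B 1 + ?B 0" by (intro BF_linear_test c)
    moreover have "?B 0 = 0" by (simp add: BF_def)
    ultimately show ?thesis
      by (simp add: const_form_def one_pCons jet_shift[of u ?r "1/2"] jet_shift'[of u ?r "1/2"])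
  qed
  finally show ?thesis .
qed

text \<open>Comparison with the Taylor polynomial of degree \<open>\<sigma>\<close> at the cell
  centre. Measuring the remainder by the oscillation of the top derivative avoids a pointwise
  derivative of order \<open>\<sigma> + 1\<close>.\<close>

lemma const_form_jet_bound:
  assumes K: "bounds_const_form l \<sigma> K"
    and \<sigma>: "\<sigma> \<ge> 2"
    and d: "\<And>j x. j < \<sigma> \<Longrightarrow> ((deriv ^^ j) u has_real_derivative (deriv ^^ Suc j) u x) (at x)"
    and c: "\<And>j. j \<le> \<sigma> \<Longrightarrow> cts ((deriv ^^ j) u)"
    and osc: "\<And>t. \<bar>t\<bar> \<le> 2 \<Longrightarrow> \<bar>(deriv ^^ \<sigma>) u (node r + h * t) - (deriv ^^ \<sigma>) u (node r)\<bar> \<le> \<delta>"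
  shows "\<bar>const_form l (jet u r)\<bar> \<le> K * (2 ^ \<sigma> * (h ^ \<sigma> * \<delta>))"
proof -
  obtain p where p: "degree p \<le> \<sigma>" "\<And>j. j \<le> \<sigma> \<Longrightarrow> poly_jet p j 0 = jet u r j 0"
    using poly_with_jet[of \<sigma> "\<lambda>j. jet u r j 0"] by blast
  define D where "D j t = jet u r j t - poly_jet p j t" for j t
  have "\<bar>D j t\<bar> \<le> 2 ^ \<sigma> * (h ^ \<sigma> * \<delta>)" if "j \<le> \<sigma>" "\<bar>t\<bar> \<le> 2" for j t
  proof (rule vanishing_jet_bound[OF _ _ _ that])
    fix j t assume j: "j < \<sigma>"
    have "((\<lambda>t. (deriv ^^ j) u (node r + h * t)) has_real_derivative (deriv ^^ Suc j) u (node r + h * t) * h) (at t)"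
      by (rule DERIV_chain2[OF d[OF j]]) (auto intro!: derivative_eq_intros)
    from DERIV_cmult[OF this, of "h ^ j"]
    have "(jet u r j has_real_derivative jet u r (Suc j) t) (at t)"
      by (simp add: jet_def[abs_def] ac_simps)
    moreover have "(poly_jet p j has_real_derivative poly_jet p (Suc j) t) (at t)"
      unfolding poly_jet_def by (auto intro!: poly_DERIV)
    ultimately show "(D j has_real_derivative D (Suc j) t) (at t)"
      unfolding D_def[abs_def] by (rule DERIV_diff)
  next
    fix t :: real assume t: "\<bar>t\<bar> \<le> 2"
    \<comment> \<open>The top derivative of the Taylor polynomial is constant, equal to its value at
      the centre.\<close>
    have "D \<sigma> t = jet u r \<sigma> t - jet u r \<sigma> 0"
      using p(2)[of \<sigma>] poly_jet_degree_const[OF p(1), of t] by (simp add: D_def)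
    also have "\<dots> = h ^ \<sigma> * ((deriv ^^ \<sigma>) u (node r + h * t) - (deriv ^^ \<sigma>) u (node r))"
      by (simp add: jet_def right_diff_distrib)
    also have "\<bar>\<dots>\<bar> \<le> h ^ \<sigma> * \<delta>"
      unfolding abs_mult using osc[OF t] h_pos by (simp add: mult_left_mono)
    finally show "\<bar>D \<sigma> t\<bar> \<le> h ^ \<sigma> * \<delta>" .
  qed (use p(2) in \<open>simp_all add: D_def\<close>)
  then have "\<forall>j\<le>2. \<forall>t. \<bar>t\<bar> \<le> 2 \<longrightarrow> \<bar>jet u r j t - poly_jet p j t\<bar> \<le> 2 ^ \<sigma> * (h ^ \<sigma> * \<delta>)"
    using \<sigma> by (simp add: D_def)
  moreover have "\<forall>j\<le>2. cts (jet u r j)"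
    by (intro allI impI continuous_on_jet c) (use \<sigma> in simp)
  ultimately show ?thesis using K p(1) unfolding bounds_const_form_def by blast
qed

text \<open>Bounds the variation of a primitive of \<open>g\<close> over a cell. The index is
  reduced to \<open>1, ..., N\<close> because \<open>g\<close> represents the weak derivative on
  \<open>[a, b]\<close> only, while neighbouring cells may leave that interval.\<close>

definition cell_variation :: "(real \<Rightarrow> real) \<Rightarrow> int \<Rightarrow> real" where
  "cell_variation g i = (LBINT t:cell (of_int ((i - 1) mod int N + 1)). \<bar>g t\<bar>)"

lemma cell_variation_nonneg: "cell_variation g i \<ge> 0"
  unfolding cell_variation_def set_lebesgue_integral_def by (intro Bochner_Integration.integral_nonneg) auto

lemma cell_variation_periodic: "cell_variation g (i + int N) = cell_variation g i"
proof -
  have "(i + int N - 1) mod int N = (i - 1) mod int N" by (metis add_diff_eq diff_add_eq mod_add_self2)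
  then show ?thesis by (simp add: cell_variation_def)
qed

lemma reduced_index: "1 \<le> (i - 1) mod int N + 1" "(i - 1) mod int N + 1 \<le> int N"
proof -
  have "int N > 0" using N_pos by simp
  from pos_mod_sign[OF this, of "i - 1"] pos_mod_bound[OF this, of "i - 1"]
  show "1 \<le> (i - 1) mod int N + 1" "(i - 1) mod int N + 1 \<le> int N" by linarith+
qed

text \<open>Translating by \<open>m\<close> whole periods moves the cell into \<open>[a, b]\<close>,
  where increments of \<open>v\<close> are integrals of \<open>g\<close>, and leaves
  \<open>v\<close> unchanged.\<close>

lemma oscillation_cell:
  assumes per: "periodic v" and g: "set_integrable lborel {a..b} g"
    and incr: "\<And>x y. a \<le> x \<Longrightarrow> x \<le> y \<Longrightarrow> y \<le> b \<Longrightarrow> v y - v x = (LBINT t:{x..y}. g t)"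
    and xy: "x \<in> cell (of_int i)" "y \<in> cell (of_int i)"
  shows "\<bar>v y - v x\<bar> \<le> cell_variation g i"
proof -
  define j where "j = (i - 1) mod int N + 1"
  define m where "m = (i - 1) div int N"
  have i: "i = j + m * int N" using div_mult_mod_eq[of "i - 1" "int N"] by (simp add: j_def m_def)
  have "node (of_int i + d) = node (of_int j + d) + of_int m * (b - a)" for d
  proof -
    have "node (of_int i + d) = node (of_int j + d) + of_int m * (real N * h)"
      by (simp add: i node_def algebra_simps)
    then show ?thesis by (simp only: N_h)
  qed
  from this[of "1/2"] this[of "-1/2"]
  have sh: "z + of_int (- m) * (b - a) \<in> cell (of_int j)" if "z \<in> cell (of_int i)" for z
    using that by (simp add: cell_def)
  have sub: "cell (of_int j) \<subseteq> {a..b}" using reduced_index[of i] by (intro cell_subset) (auto simp: j_def)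
  have main: "\<bar>v y - v x\<bar> \<le> cell_variation g i" if x: "x \<in> cell (of_int j)" and y: "y \<in> cell (of_int j)" and "x \<le> y" for x y
  proof -
    have s: "{x..y} \<subseteq> cell (of_int j)" using x y by (auto simp: cell_def)
    have gi: "set_integrable lborel {x..y} g"
      by (rule set_integrable_subset[OF g]) (use order.trans[OF s sub] in auto)
    have gc: "set_integrable lborel (cell (of_int j)) g"
      by (rule set_integrable_subset[OF g]) (use sub in \<open>auto simp: cell_def\<close>)
    have "v y - v x = (LBINT t:{x..y}. g t)" using subsetD[OF sub x] subsetD[OF sub y] \<open>x \<le> y\<close> by (intro incr) auto
    also have "\<bar>\<dots>\<bar> \<le> (LBINT t:{x..y}. \<bar>g t\<bar>)" using set_integral_norm_bound[OF gi] by simp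
    also have "\<dots> \<le> (LBINT t:cell (of_int j). \<bar>g t\<bar>)"
      unfolding set_lebesgue_integral_def
    proof (rule integral_mono)
      show "integrable lborel (\<lambda>t. indicator {x..y} t *\<^sub>R \<bar>g t\<bar>)"
        using set_integrable_abs[OF gi] by (simp add: set_integrable_def)
      show "integrable lborel (\<lambda>t. indicator (cell (of_int j)) t *\<^sub>R \<bar>g t\<bar>)"
        using set_integrable_abs[OF gc] by (simp add: set_integrable_def)
    qed (use s in \<open>auto simp: indicator_def\<close>)
    finally show ?thesis by (simp add: cell_variation_def j_def)
  qed
  have vm: "v (z + of_int (- m) * (b - a)) = v z" for z by (rule periodic_of_int[OF per])
  show ?thesis
  proof (cases "x \<le> y")
    case True
    then show ?thesis using main[OF sh[OF xy(1)] sh[OF xy(2)]] unfolding vm by simp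
  next
    case False
    then show ?thesis using main[OF sh[OF xy(2)] sh[OF xy(1)]] unfolding vm by (simp add: abs_minus_commute)
  qed
qed

lemma oscillation_chain:
  fixes i :: int
  assumes osc: "\<And>i x y. x \<in> cell (of_int i) \<Longrightarrow> y \<in> cell (of_int i) \<Longrightarrow> \<bar>v y - v x\<bar> \<le> cell_variation g i"
    and "x \<in> cell (of_int i)" "y \<in> cell (of_int (i + int n))"
  shows "\<bar>v y - v x\<bar> \<le> (\<Sum>j = i..i + int n. cell_variation g j)"
  using assms(3)
proof (induction n arbitrary: y)
  case 0
  then show ?case using osc[OF assms(2)] by simp
next
  case (Suc n)
  \<comment> \<open>The interface shared by two consecutive cells links their oscillations.\<close>
  let ?z = "node (of_int (i + int n) + 1/2)"
  have z: "?z \<in> cell (of_int (i + int n))" "?z \<in> cell (of_int (i + int (Suc n)))"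
    using h_pos by (auto simp: cell_def node_def algebra_simps)
  have "{i..i + int (Suc n)} = insert (i + int (Suc n)) {i..i + int n}" by auto
  then have "(\<Sum>j = i..i + int (Suc n). cell_variation g j) = cell_variation g (i + int (Suc n)) + (\<Sum>j = i..i + int n. cell_variation g j)" by simp
  then show ?case using Suc.IH[OF z(1)] osc[OF z(2) Suc.prems] by linarith
qed

lemma oscillation:
  assumes osc: "\<And>i x y. x \<in> cell (of_int i) \<Longrightarrow> y \<in> cell (of_int i) \<Longrightarrow> \<bar>v y - v x\<bar> \<le> cell_variation g i"
    and s: "s = 0 \<or> s = 1/2" and t: "\<bar>t\<bar> \<le> 2"
  shows "\<bar>v (node (of_int i + s) + h * t) - v (node (of_int i + s))\<bar> \<le> (\<Sum>j = i - 2..i + 3. cell_variation g j)"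
proof -
  let ?x = "node (of_int i + s)" and ?y = "node (of_int i + s) + h * t"
  have x: "?x \<in> cell (of_int i)" using s h_pos by (auto simp: cell_def node_def algebra_simps)
  obtain m :: int and t' where m: "-1/2 \<le> t'" "t' < 1/2" "?y = node (of_int m + 0) + h * t'" by (rule cell_cover)
  have y: "?y \<in> cell (of_int m)" unfolding m(3) using m(1,2) by (simp add: in_cell_iff)
  have "h * (of_int i + s + t) = h * (of_int m + t')"
    using m(3) by (simp add: node_def algebra_simps)
  then have "of_int i + s + t = of_int m + t'" using h_pos by simp
  \<comment> \<open>The position \<open>i + s + t\<close> lies between \<open>i - 2\<close> and
    \<open>i + 5/2\<close>, so rounding to a cell index gives \<open>i - 2, ..., i + 3\<close>: six
    cells, the origin of the constant 6.\<close>
  then have "of_int m - of_int i \<le> (3 :: real)" "of_int m - of_int i > (-3 :: real)" using s t m(1,2) by (auto simp: abs_le_iff)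
  then have mi: "m \<le> i + 3" "m \<ge> i - 2" by linarith+
  show ?thesis
  proof (cases "i \<le> m")
    case True
    then have "\<bar>v ?y - v ?x\<bar> \<le> (\<Sum>j = i..m. cell_variation g j)"
      using oscillation_chain[of v g ?x i ?y "nat (m - i)"] osc x y by simp
    also have "\<dots> \<le> (\<Sum>j = i - 2..i + 3. cell_variation g j)"
      using mi by (intro sum_mono2 cell_variation_nonneg) auto
    finally show ?thesis .
  next
    case False
    then have "\<bar>v ?x - v ?y\<bar> \<le> (\<Sum>j = m..i. cell_variation g j)"
      using oscillation_chain[of v g ?y m ?x "nat (i - m)"] osc x y by simp
    also have "\<dots> \<le> (\<Sum>j = i - 2..i + 3. cell_variation g j)"
      using mi by (intro sum_mono2 cell_variation_nonneg) auto
    finally show ?thesis by (simp add: abs_minus_commute)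
  qed
qed

text \<open>Cauchy-Schwarz on each cell of length \<open>h\<close> trades the integral of
  \<open>\<bar>g\<bar>\<close> for that of \<open>g^2\<close> at the price of one factor
  \<open>h\<close>.\<close>

lemma sum_cell_variation_squared:
  assumes g: "g \<in> L2_fun a b"
  shows "(\<Sum>i = 1..int N. (cell_variation g i)\<^sup>2) \<le> h * (L2_norm a b g)\<^sup>2"
proof -
  have gi: "set_integrable lborel {a..b} g" by (rule L2_fun_set_integrable[OF g])
  have g2: "set_integrable lborel {a..b} (\<lambda>x. (g x)\<^sup>2)" using g by (simp add: L2_fun_def)
  have sub: "set_integrable lborel (cell (of_int i)) f"
    if "set_integrable lborel {a..b} f" "1 \<le> i" "i \<le> int N" for i and f :: "real \<Rightarrow> real"
    by (rule set_integrable_subset[OF that(1)]) (use cell_subset[OF that(2,3)] in \<open>auto simp: cell_def\<close>)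
  have "(\<Sum>i = 1..int N. (cell_variation g i)\<^sup>2) \<le> (\<Sum>i = 1..int N. h * (LBINT x:cell (of_int i). (g x)\<^sup>2))"
  proof (rule sum_mono)
    fix i assume i: "i \<in> {1..int N}"
    have len: "node (of_int i + 1/2) - node (of_int i - 1/2) = h" by (simp add: node_def algebra_simps)
    have "(cell_variation g i)\<^sup>2 = (LBINT x:cell (of_int i). \<bar>g x\<bar>)\<^sup>2"
      using i by (simp add: cell_variation_def)
    also have "\<dots> \<le> h * (LBINT x:cell (of_int i). (g x)\<^sup>2)"
      using set_integral_abs_squared_le[of "node (of_int i - 1/2)" "node (of_int i + 1/2)" g]
        sub[OF gi, of i] sub[OF g2, of i] i h_pos len by (simp add: cell_def)
    finally show "(cell_variation g i)\<^sup>2 \<le> h * (LBINT x:cell (of_int i). (g x)\<^sup>2)" .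
  qed
  also have "\<dots> = h * (LBINT x:{a..b}. (g x)\<^sup>2)"
    by (subst LBINT_period_cells) (auto intro: sub[OF g2] simp: sum_distrib_left)
  also have "(LBINT x:{a..b}. (g x)\<^sup>2) = (L2_norm a b g)\<^sup>2"
    unfolding L2_norm_def set_lebesgue_integral_def
    by (intro real_sqrt_pow2[symmetric] Bochner_Integration.integral_nonneg) auto
  finally show ?thesis .
qed

text \<open>For each of the six offsets, Cauchy-Schwarz over the cells gives
  \<open>1 / sqrt h\<close> from the values of \<open>\<phi>\<close> and \<open>sqrt h\<close> from
  the variations, so no power of \<open>h\<close> remains. Cyclic reindexing makes the offsets
  alike.\<close>

lemma weighted_sum_bound:
  assumes g: "g \<in> L2_fun a b" and \<phi>: "\<phi> \<in> pw_poly s 0" and s: "s = 0 \<or> s = 1/2"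
  shows "(\<Sum>i = 1..int N. \<bar>\<phi> (node (of_int i + s))\<bar> * (\<Sum>j = i - 2..i + 3. cell_variation g j)) \<le> 6 * (L2_norm a b \<phi> * L2_norm a b g)"
proof -
  define c where "c i = \<phi> (node (of_int i + s))" for i :: int
  have cs: "(\<Sum>i = 1..int N. \<bar>c i\<bar> * cell_variation g (i + d)) \<le> L2_norm a b \<phi> * L2_norm a b g" for d
  proof -
    have "(\<Sum>i = 1..int N. \<bar>c i\<bar> * cell_variation g (i + d)) = (\<Sum>i = 1..int N. \<bar>c i\<bar> * \<bar>cell_variation g (i + d)\<bar>)"
      using cell_variation_nonneg by (simp add: abs_of_nonneg)
    also have "\<dots> \<le> L2_set c {1..int N} * L2_set (\<lambda>i. cell_variation g (i + d)) {1..int N}"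
      by (rule L2_set_mult_ineq)
    also have "\<dots> = sqrt (\<Sum>i = 1..int N. (c i)\<^sup>2) * sqrt (\<Sum>i = 1..int N. (cell_variation g i)\<^sup>2)"
      using sum_int_shift_periodic[of "\<lambda>i. (cell_variation g i)\<^sup>2" N d] cell_variation_periodic by (simp add: L2_set_def)
    also have "\<dots> \<le> sqrt ((L2_norm a b \<phi>)\<^sup>2 / h) * sqrt (h * (L2_norm a b g)\<^sup>2)"
      using sum_cell_variation_squared[OF g] L2_norm_pw_const[OF \<phi> s] h_pos
      by (intro mult_mono real_sqrt_le_mono) (simp_all add: c_def sum_nonneg)
    also have "\<dots> = sqrt ((L2_norm a b \<phi> * L2_norm a b g)\<^sup>2)"
      unfolding real_sqrt_mult[symmetric] using h_pos by (simp add: power_mult_distrib)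
    also have "\<dots> = L2_norm a b \<phi> * L2_norm a b g" by (simp add: L2_norm_nonneg)
    finally show ?thesis .
  qed
  have "(\<Sum>j = i - 2..i + 3. cell_variation g j) = (\<Sum>d = -2..3. cell_variation g (i + d))" for i
    by (rule sum.reindex_bij_witness[of _ "\<lambda>d. i + d" "\<lambda>j. j - i"]) auto
  then have "(\<Sum>i = 1..int N. \<bar>c i\<bar> * (\<Sum>j = i - 2..i + 3. cell_variation g j)) = (\<Sum>d = -2..3. \<Sum>i = 1..int N. \<bar>c i\<bar> * cell_variation g (i + d))"
    by (simp add: sum_distrib_left) (rule sum.swap)
  also have "\<dots> \<le> (\<Sum>d = -2..3::int. L2_norm a b \<phi> * L2_norm a b g)" by (intro sum_mono cs)
  also have "\<dots> = 6 * (L2_norm a b \<phi> * L2_norm a b g)" by simp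
  finally show ?thesis by (simp add: c_def)
qed

section \<open>Assembly of the estimate\<close>

lemma form_sums_bound:
  assumes K: "bounds_const_form l \<sigma> K"
    and \<sigma>: "\<sigma> \<ge> 2" and l: "l \<le> 2"
    and u: "u \<in> sobolev_space a b (\<sigma> + 1)" "cts u"
  shows "\<phi> \<in> Wbar \<Longrightarrow> \<bar>\<Sum>i = 1..int N. Btilde i (R l u) \<phi>\<bar>
      \<le> 6 * K * 2 ^ \<sigma> * h ^ \<sigma> * sobolev_norm a b (\<sigma> + 1) u * L2_norm a b \<phi>"
    and "\<phi> \<in> Vbar \<Longrightarrow> \<bar>\<Sum>i = 1..int N. Bhat i (R l u) \<phi>\<bar>
      \<le> 6 * K * 2 ^ \<sigma> * h ^ \<sigma> * sobolev_norm a b (\<sigma> + 1) u * L2_norm a b \<phi>"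
proof -
  have K0: "K \<ge> 0" using K by (simp add: bounds_const_form_def)
  have per: "periodic u" using u(1) by (simp add: sobolev_space_def periodic_iff)
  obtain g where g: "g \<in> L2_fun a b" "L2_norm a b g \<le> sobolev_norm a b (\<sigma> + 1) u"
    "\<And>j x. j < \<sigma> \<Longrightarrow> ((deriv ^^ j) u has_real_derivative (deriv ^^ Suc j) u x) (at x)"
    "cts ((deriv ^^ \<sigma>) u)"
    "\<And>x y. a \<le> x \<Longrightarrow> x \<le> y \<Longrightarrow> y \<le> b \<Longrightarrow> (deriv ^^ \<sigma>) u y - (deriv ^^ \<sigma>) u x = (LBINT t:{x..y}. g t)"
    using sobolev_space_regularity[of u \<sigma>] u by auto
  have c: "cts ((deriv ^^ j) u)" if "j \<le> \<sigma>" for j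
  proof (cases "j = \<sigma>")
    case False
    then show ?thesis using that by (intro DERIV_imp_continuous_on[OF g(3)]) simp
  qed (use g(4) in simp)
  have cl: "cts ((deriv ^^ j) u)" if "j \<le> l" for j using that l \<sigma> by (intro c) simp
  have R1: "rep (fst (R l u)) (of_int i) (\<rho> l (jet u (of_int i)))" for i
    by (rule R_rep(1)[OF cl per])
  have R2: "rep (snd (R l u)) (of_int i + 1/2) (\<rho> l (jet u (of_int i + 1/2)))" for i
    by (rule R_rep(2)[OF cl per])
  have osc: "\<bar>(deriv ^^ \<sigma>) u y - (deriv ^^ \<sigma>) u x\<bar> \<le> cell_variation g i" if "x \<in> cell (of_int i)" "y \<in> cell (of_int i)" for i x y
    by (rule oscillation_cell[OF periodic_deriv_funpow[OF per] L2_fun_set_integrable[OF g(1)] g(5) that])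
  \<comment> \<open>Both sums reduce to this one, with \<open>s = 0\<close> for \<open>Bhat\<close>
    and \<open>s = 1/2\<close> for \<open>Btilde\<close>.\<close>
  have main: "\<bar>\<Sum>i = 1..int N. \<phi> (node (of_int i + s)) * const_form l (jet u (of_int i + s))\<bar>
      \<le> 6 * K * 2 ^ \<sigma> * h ^ \<sigma> * sobolev_norm a b (\<sigma> + 1) u * L2_norm a b \<phi>"
    if \<phi>: "\<phi> \<in> pw_poly s 0" and s: "s = 0 \<or> s = 1/2" for s
  proof -
    let ?E = "\<lambda>i. \<Sum>j = i - 2..i + 3. cell_variation g j"
    have "\<bar>const_form l (jet u (of_int i + s))\<bar> \<le> K * (2 ^ \<sigma> * (h ^ \<sigma> * ?E i))" for i
      by (rule const_form_jet_bound[OF K \<sigma> g(3) c oscillation[OF osc s]])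
    then have "\<bar>\<Sum>i = 1..int N. \<phi> (node (of_int i + s)) * const_form l (jet u (of_int i + s))\<bar>
      \<le> (\<Sum>i = 1..int N. \<bar>\<phi> (node (of_int i + s))\<bar> * (K * (2 ^ \<sigma> * (h ^ \<sigma> * ?E i))))"
      by (intro order.trans[OF sum_abs] sum_mono) (simp add: abs_mult mult_left_mono)
    also have "\<dots> = K * 2 ^ \<sigma> * h ^ \<sigma> * (\<Sum>i = 1..int N. \<bar>\<phi> (node (of_int i + s))\<bar> * ?E i)"
      unfolding sum_distrib_left by (intro sum.cong refl) (simp only: ac_simps)
    also have "\<dots> \<le> K * 2 ^ \<sigma> * h ^ \<sigma> * (6 * (L2_norm a b \<phi> * L2_norm a b g))"
      using K0 h_pos by (intro mult_left_mono weighted_sum_bound[OF g(1) \<phi> s]) simp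
    also have "\<dots> \<le> K * 2 ^ \<sigma> * h ^ \<sigma> * (6 * (L2_norm a b \<phi> * sobolev_norm a b (\<sigma> + 1) u))"
      using K0 h_pos L2_norm_nonneg g(2) by (intro mult_left_mono) auto
    finally show ?thesis by (simp only: ac_simps)
  qed
  show "\<bar>\<Sum>i = 1..int N. Btilde i (R l u) \<phi>\<bar>
      \<le> 6 * K * 2 ^ \<sigma> * h ^ \<sigma> * sobolev_norm a b (\<sigma> + 1) u * L2_norm a b \<phi>" if \<phi>: "\<phi> \<in> Wbar"
  proof -
    have \<phi>': "\<phi> \<in> pw_poly (1/2) 0" using \<phi> by (simp add: Wbar_def)
    have "Btilde i (R l u) \<phi> = \<phi> (node (of_int i + 1/2)) * const_form l (jet u (of_int i + 1/2))" for i
      unfolding Btilde_eq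
    proof (rule B_form_pw_const[OF cl \<phi>' R2])
      show "rep (fst (R l u)) (of_int i + 1/2 - 1/2) (\<rho> l (jet u (of_int i + 1/2 - 1/2)))"
        using R1[of i] by simp
      have "of_int (i + 1) = (of_int i + 1/2 + 1/2 :: real)" by simp
      then show "rep (fst (R l u)) (of_int i + 1/2 + 1/2) (\<rho> l (jet u (of_int i + 1/2 + 1/2)))"
        using R1[of "i + 1"] by metis
    qed
    then show ?thesis using main[OF \<phi>'] by simp
  qed
  show "\<bar>\<Sum>i = 1..int N. Bhat i (R l u) \<phi>\<bar>
      \<le> 6 * K * 2 ^ \<sigma> * h ^ \<sigma> * sobolev_norm a b (\<sigma> + 1) u * L2_norm a b \<phi>" if \<phi>: "\<phi> \<in> Vbar"
  proof -
    have \<phi>': "\<phi> \<in> pw_poly 0 0" using \<phi> by (simp add: Vbar_def)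
    have "B_form (of_int i + 0) (fst (R l u)) (snd (R l u)) \<phi> = \<phi> (node (of_int i + 0)) * const_form l (jet u (of_int i + 0))" for i
    proof (rule B_form_pw_const[OF cl \<phi>'])
      show "rep (fst (R l u)) (of_int i + 0) (\<rho> l (jet u (of_int i + 0)))"
        using R1[of i] by simp
      have "of_int (i - 1) + 1/2 = (of_int i + 0 - 1/2 :: real)" by simp
      then show "rep (snd (R l u)) (of_int i + 0 - 1/2) (\<rho> l (jet u (of_int i + 0 - 1/2)))"
        using R2[of "i - 1"] by metis
      show "rep (snd (R l u)) (of_int i + 0 + 1/2) (\<rho> l (jet u (of_int i + 0 + 1/2)))"
        using R2[of i] by simp
    qed
    then show ?thesis using main[OF \<phi>'] by (simp add: Bhat_eq)
  qed
qed

end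

theorem theorem3p19:
  fixes a b CFL :: real and k \<sigma> :: nat
  assumes "a < b" and "CFL > 0" and "k \<ge> 1" and "\<sigma> = min (2 * k + 1) (k + 3)"
  shows "\<exists>M>0. \<forall>N\<ge>1. \<forall>l \<in> {1..min k 2}. \<forall>u \<phi>1 \<phi>2.
    u \<in> sobolev_space a b (\<sigma> + 1) \<longrightarrow> continuous_on UNIV u \<longrightarrow>
    \<phi>1 \<in> cdg.Vbar a b N \<longrightarrow> \<phi>2 \<in> cdg.Wbar a b N \<longrightarrow>
      \<bar>\<Sum>i = 1..int N. cdg.Btilde a b N CFL i (cdg.R a b N k CFL l u) \<phi>2\<bar>
        \<le> M * cdg.h a b N ^ \<sigma> * sobolev_norm a b (\<sigma> + 1) u * L2_norm a b \<phi>2 \<and>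
      \<bar>\<Sum>i = 1..int N. cdg.Bhat a b N CFL i (cdg.R a b N k CFL l u) \<phi>1\<bar>
        \<le> M * cdg.h a b N ^ \<sigma> * sobolev_norm a b (\<sigma> + 1) u * L2_norm a b \<phi>1"
proof -
  \<comment> \<open>Only the reference cell is fixed at this point; choosing the constants before
    \<open>N\<close> makes them independent of the mesh.\<close>
  interpret reference_cell k CFL using assms by unfold_locales auto
  have "\<forall>l \<in> {1..min k 2}. \<exists>K. bounds_const_form l \<sigma> K"
    unfolding assms(4) using const_form_remainder_bound by blast
  then obtain K where K: "\<And>l. l \<in> {1..min k 2} \<Longrightarrow> bounds_const_form l \<sigma> (K l)" by metis
  then have K0: "\<And>l. l \<in> {1..min k 2} \<Longrightarrow> K l \<ge> 0" by (simp add: bounds_const_form_def)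
  \<comment> \<open>One constant for all admissible \<open>l\<close>; the added 1 makes it strictly
    positive.\<close>
  define K' where "K' = 1 + (\<Sum>l\<in>{1..min k 2}. K l)"
  have K': "K' > 0" "\<And>l. l \<in> {1..min k 2} \<Longrightarrow> K l \<le> K'"
    using sum_nonneg[of "{1..min k 2}" K] member_le_sum[of _ "{1..min k 2}" K] K0 unfolding K'_def by fastforce+
  have bound: "bounds_const_form l \<sigma> K'" if l: "l \<in> {1..min k 2}" for l
    by (rule bounds_const_form_mono[OF K[OF l] K'(2)[OF l]])
  have \<sigma>: "\<sigma> \<ge> 2" using assms by simp
  show ?thesis
  proof (intro exI[of _ "6 * K' * 2 ^ \<sigma>"] conjI allI impI ballI)
    show "6 * K' * 2 ^ \<sigma> > 0" using K' by simp
    fix N l u \<phi>1 \<phi>2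
    assume N: "1 \<le> N" and l: "l \<in> {1..min k 2}"
      and u: "u \<in> sobolev_space a b (\<sigma> + 1)" "cts u"
      and \<phi>: "\<phi>1 \<in> cdg.Vbar a b N" "\<phi>2 \<in> cdg.Wbar a b N"
    interpret cdg_mesh a b N k CFL using assms N by unfold_locales auto
    show "\<bar>\<Sum>i = 1..int N. Btilde i (R l u) \<phi>2\<bar>
        \<le> 6 * K' * 2 ^ \<sigma> * h ^ \<sigma> * sobolev_norm a b (\<sigma> + 1) u * L2_norm a b \<phi>2"
      by (rule form_sums_bound(1)[OF bound[OF l] \<sigma> _ u \<phi>(2)]) (use l in simp)
    show "\<bar>\<Sum>i = 1..int N. Bhat i (R l u) \<phi>1\<bar>
        \<le> 6 * K' * 2 ^ \<sigma> * h ^ \<sigma> * sobolev_norm a b (\<sigma> + 1) u * L2_norm a b \<phi>1"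
      by (rule form_sums_bound(2)[OF bound[OF l] \<sigma> _ u \<phi>(1)]) (use l in simp)
  qed
qed

end
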